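(* Let $\Gamma$ be a non-virtually cyclic group acting properly, cocompactly and essentially on the CAT(0) cube complex $\mathcal{Z}$, and let $\mathbb{W}\subset\mathbb{H}(\mathcal{Z})$ be a $\Gamma$-invariant subset such that the action of $\Gamma$ on the restriction quotient $\mathcal{X}=\mathcal{Z}(\mathbb{W})$ is proper, cocompact and essential. Let $\phi:\mathcal{Z}\to\mathcal{X}$ be the restriction quotient map. Let $\overline\Gamma<\Gamma$ be a finite-index subgroup such that $\overline{\mathcal{Z}}=\overline\Gamma\backslash\mathcal{Z}$ and $\overline{\mathcal{X}}=\overline\Gamma\backslash\mathcal{X}$ are special cube complexes. Fix a base vertex $\widetilde o\in\mathcal{Z}$ and set $o=\phi(\widetilde o)$. Let $S_{\mathcal{Z}}$ and $S_{\mathcal{X}}\subset S_{\mathcal{Z}}$ be the sets of oriented hyperplanes of $\overline{\mathcal{Z}}$ and $\overline{\mathcal{X}}$. Then there exists a language $L_{\mathcal{X}}\subset(S_{\mathcal{X}})^\ast$ parametrized by a pruned finite-state automaton $\mathcal{A}_{\mathcal{X}}=(\mathcal{G}_{\mathcal{X}}=(V_{\mathcal{X}},E_{\mathcal{X}}),\pi_{\mathcal{X}},I_{\mathcal{X}},V_{\mathcal{X}})$ satisfying the following. (1) There exists $C\ge1$ such that any $w\in L_{\mathcal{X}}$ is represented by at most $C$ paths in $\mathcal{G}_{\mathcal{X}}$ starting at an initial state. (2) Every $w\in L_{\mathcal{X}}$ is represented by a unique combinatorial geodesic $\gamma_w\subset\mathcal{X}$ starting at the vertex $o$. Let $\tau_{\mathcal{X}}(w)$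 denote the final vertex of $\gamma_w$. (3) The map $\tau_{\mathcal{X}}:L_{\mathcal{X}}\to\mathcal{X}^0$ is a bijection. Moreover, there exist maps $\Psi:V_{\mathcal{X}}\to(S_{\mathcal{Z}}\setminus S_{\mathcal{X}})^\ast$ and $\Xi:V_{\mathcal{X}}\to\overline{\mathcal{X}}^0$ satisfying the following. (4) If $w\in L_{\mathcal{X}}$ is represented by the path $\omega=(v_0\xrightarrow{e_1}v_1\cdots\xrightarrow{e_n}v_n)$ in $\mathcal{G}_{\mathcal{X}}$ starting at an initial state, then the concatenation $$\alpha(\omega):=\Psi(v_0)\pi_{\mathcal{X}}(e_1)\Psi(v_1)\cdots\Psi(v_{n-1})\pi_{\mathcal{X}}(e_n)\in(S_{\mathcal{Z}})^\ast$$ can be represented by a unique geodesic path $\widetilde\gamma_{\alpha(\omega)}$ in $\mathcal{Z}$ with initial vertex $\widetilde o$ and final vertex $\tau_{\mathcal{Z}}(\alpha(\omega))$, so that $\phi(\tau_{\mathcal{Z}}(\alpha(\omega)))=\tau_{\mathcal{X}}(w)$. (5) If $w\in L_{\mathcal{X}}$ is represented by the path $\omega=(v_0\to v_1\cdots\to v_n)$ in $\mathcal{G}_{\mathcal{X}}$ starting at an initial state, then the path $\gamma_w=(\gamma_0,\dots,\gamma_n)$ in $\mathcal{X}$ projects to $(\Xi(v_0),\dots,\Xi(v_n))$ in $\overline{\mathcal{X}}$.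
   Context: Cube complexes. A non-positively curved (NPC) cube complex is a metric polyhedral complex whose polyhedra are unit Euclidean cubes and whose vertex links are flag complexes; it is CAT(0) if simply connected. Group actions are by cubical automorphisms. A hyperplane (resp. oriented hyperplane) of an NPC cube complex is an equivalence class of edges (resp. oriented edges) for the equivalence relation generated by being opposite (resp. opposite and parallel oriented) edges of a square; an (oriented) edge is dual to its class. $\mathbb{H}(\mathcal{X})$ is the set of hyperplanes; $\mathcal{X}^0$ the vertex set. In a CAT(0) cube complex each hyperplane $\mathfrak{h}$ partitions the vertices into two halfspaces $\mathfrak{h}^\pm$ (vertices being in the same class iff some/any combinatorial path joining them does not need to cross $\mathfrak{h}$). A subcomplex is convex if its vertex set is an intersection of halfspaces. A combinatorial path $\gamma=(\gamma_0,\dots,\gamma_n)$ is a sequence of consecutively adjacent vertices; it is geodesic if it is geodesic for the graph metric $d_{\mathcal{X}}$ on the 1-skeleton (equivalently, no two of its edges are dual to the same hyperplane). An action of $\Gamma$ on $\mathcal{X}$ is essential if for every hyperplane $\mathfrak{h}$ and vertex $x$, each halfspace $\mathfrak{h}^\pm$ contains elements of $\Gamma x$ arbitrarily far from $\mathfrak{h}^\mp$. The restriction quotient (Caprace–Sageev) of a CAT(0) cube complex $\mathcal{Z}$ by $\mathbb{W}\subset\mathbb{H}(\mathcal{Z})$ is a CAT(0) cube complex $\mathcal{Z}(\mathbb{W})$ with a surjective cellular map $\phi:\mathcal{Z}\to\mathcal{Z}(\mathbb{W})$ such that an edge is collapsed to a vertex iff it is dual to a hyperplane not in $\mathbb{W}$,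 with $\phi$ inducing a bijection between $\mathbb{W}$ and $\mathbb{H}(\mathcal{Z}(\mathbb{W}))$; if $\mathbb{W}$ is $\Gamma$-invariant, $\Gamma$ acts naturally on $\mathcal{Z}(\mathbb{W})$ and $\phi$ is equivariant. Special cube complexes are in the sense of Haglund–Wise: for a group $\overline\Gamma$ acting properly cocompactly on $\mathcal{X}$, $\overline\Gamma\backslash\mathcal{X}$ is special iff $\overline\Gamma$ injects into a right-angled Artin group $A_G$ inducing an equivariant isometric embedding of $\mathcal{X}$ as a convex subcomplex of the universal cover of the Salvetti complex of $A_G$. Each oriented hyperplane of $\overline{\mathcal{X}}$ corresponds to a $\overline\Gamma$-orbit of oriented hyperplanes in $\mathbb{W}\subset\mathbb{H}(\mathcal{Z})$, giving the inclusion $S_{\mathcal{X}}\subset S_{\mathcal{Z}}$. A word $\mathfrak{h}_1\cdots\mathfrak{h}_n\in(S_{\mathcal{Z}})^\ast$ (resp. $(S_{\mathcal{X}})^\ast$) is represented by a combinatorial path $(\gamma_0,\dots,\gamma_n)$ in $\mathcal{Z}$ (resp. $\mathcal{X}$) if for each $i$, $\mathfrak{h}_i$ is the image in $\overline{\mathcal{Z}}$ (resp. $\overline{\mathcal{X}}$) of the oriented hyperplane dual to the oriented edge from $\gamma_{i-1}$ to $\gamma_i$. Automata. For a finite set $S$, $S^\ast$ is the set of finite words over $S$ (including the empty word); a language over $S$ is a subset of $S^\ast$. An automaton over $S$ is a tuple $(\mathcal{G},\pi,I,F)$ with $\mathcal{G}=(V,E)$ a finite directed graph, $\pi:E\to S$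 a labeling function, and $I,F\subset V$ non-empty sets of initial and final states. A path is a finite sequence of consecutive directed edges (length-$0$ paths are vertices). A word $w$ is represented by the path $(v_0\xrightarrow{e_1}\cdots\xrightarrow{e_n}v_n)$ if $w=\pi(e_1)\cdots\pi(e_n)$, and accepted if moreover $v_0\in I$, $v_n\in F$. The language parametrized by the automaton is the set of accepted words. The automaton is pruned if every vertex is the final vertex of a path starting at an initial state. *)

theory Defs
  imports
    "HOL-Analysis.Analysis"
    "HOL-Algebra.Group_Action"
    "HOL-Algebra.Elementary_Groups"
    "Graph_Theory.Arc_Walk"
begin

section \<open>Cube complexes\<close>

text \<open>
  A cube complex is encoded by the family \<open>X\<close> of the vertex sets of its (closed, nonempty) cubes.
  The vertices of an \<open>n\<close>-cube are labelled by the subsets of \<open>{..<n}\<close>; its faces correspond to the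
  intervals of the Boolean lattice. As in the usual definition of a cubical complex as a polyhedral
  complex, two cubes are disjoint or meet in a common face. Every CAT(0) cube complex is of this
  form; quotients, where cubes need not be determined by their vertices, are treated below as
  orbit spaces.
\<close>

definition cube_chart :: "'a set set \<Rightarrow> nat \<Rightarrow> (nat set \<Rightarrow> 'a) \<Rightarrow> bool" where
  "cube_chart X n f \<longleftrightarrow> inj_on f (Pow {..<n}) \<and>
     {d \<in> X. d \<subseteq> f ` Pow {..<n}} =
     {f ` {A. B \<subseteq> A \<and> A \<subseteq> D} | B D. B \<subseteq> D \<and> D \<subseteq> {..<n}}"

definition cube_complex :: "'a set set \<Rightarrow> bool" where
  "cube_complex X \<longleftrightarrow>
     (\<forall>c\<in>X. \<exists>n f. cube_chart X n f \<and> c = f ` Pow {..<n}) \<and>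
     (\<forall>c\<in>X. \<forall>d\<in>X. c \<inter> d \<noteq> {} \<longrightarrow> c \<inter> d \<in> X)"

definition vertex_set :: "'a set set \<Rightarrow> 'a set" where
  "vertex_set X = \<Union>X"

definition edges :: "'a set set \<Rightarrow> 'a set set" where
  "edges X = {e \<in> X. card e = 2}"

definition squares :: "'a set set \<Rightarrow> 'a set set" where
  "squares X = {s \<in> X. card s = 4}"

text \<open>
  The link of \<open>v\<close>, its vertices being identified with the neighbours of \<open>v\<close>: one simplex for each
  cube containing \<open>v\<close>. The empty simplex is included.
\<close>

definition link :: "'a set set \<Rightarrow> 'a \<Rightarrow> 'a set set" where
  "link X v = {{u \<in> c. {v, u} \<in> edges X} | c. c \<in> X \<and> v \<in> c}"

definition flag_complex :: "'a set set \<Rightarrow> bool" where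
  "flag_complex K \<longleftrightarrow>
     (\<forall>N. finite N \<and> N \<subseteq> \<Union>K \<and> (\<forall>x\<in>N. \<forall>y\<in>N. x \<noteq> y \<longrightarrow> {x, y} \<in> K) \<longrightarrow> N \<in> K)"

text \<open>
  Geometric realization: the point with coordinates \<open>t\<close> of a unit cube is the system of
  multilinear weights that it puts on the vertices of the cube. This does not depend on the chart,
  and realizes faces compatibly. The realization carries the topology of pointwise convergence,
  which on finitely supported weights of total mass 1 is that of the \<open>l\<^sup>1\<close> metric; in finite
  dimension it is the topology of the length metric making all cubes unit Euclidean cubes.
\<close>

definition cube_point :: "nat \<Rightarrow> (nat set \<Rightarrow> 'a) \<Rightarrow> (nat \<Rightarrow> real) \<Rightarrow> 'a \<Rightarrow> real" where
  "cube_point n f t = (\<lambda>v. \<Sum>A\<in>Pow {..<n}.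
      if f A = v then (\<Prod>i<n. if i \<in> A then t i else 1 - t i) else 0)"

definition realization :: "'a set set \<Rightarrow> ('a \<Rightarrow> real) set" where
  "realization X =
     {cube_point n f t | n f t. cube_chart X n f \<and> (\<forall>i<n. 0 \<le> t i \<and> t i \<le> 1)}"

definition npc_cube_complex :: "'a set set \<Rightarrow> bool" where
  "npc_cube_complex X \<longleftrightarrow> cube_complex X \<and> (\<forall>v\<in>vertex_set X. flag_complex (link X v))"

definition cat0_cube_complex :: "'a set set \<Rightarrow> bool" where
  "cat0_cube_complex X \<longleftrightarrow> npc_cube_complex X \<and> simply_connected (realization X)"


section \<open>Hyperplanes, halfspaces and geodesics\<close>

definition opposite_edges :: "'a set set \<Rightarrow> ('a set \<times> 'a set) set" where
  "opposite_edges X = {(e, e'). e \<in> edges X \<and> e' \<in> edges X \<and> e \<inter> e' = {} \<and> e \<union> e' \<in> squares X}"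

definition hyperplanes :: "'a set set \<Rightarrow> 'a set set set" where
  "hyperplanes X = edges X // ((opposite_edges X)\<^sup>*)"

definition halfspaces :: "'a set set \<Rightarrow> 'a set set \<Rightarrow> 'a set set" where
  "halfspaces X h = vertex_set X // ({(x, y). {x, y} \<in> edges X \<and> {x, y} \<notin> h}\<^sup>*)"

definition convex_subcomplex :: "'a set set \<Rightarrow> 'a set set \<Rightarrow> bool" where
  "convex_subcomplex Y X \<longleftrightarrow>
     Y = {c \<in> X. c \<subseteq> vertex_set Y} \<and>
     (\<exists>\<H>. \<H> \<subseteq> (\<Union>h\<in>hyperplanes X. halfspaces X h) \<and> vertex_set Y = vertex_set X \<inter> \<Inter>\<H>)"

definition comb_path :: "'a set set \<Rightarrow> 'a list \<Rightarrow> bool" where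
  "comb_path X \<gamma> \<longleftrightarrow> \<gamma> \<noteq> [] \<and> set \<gamma> \<subseteq> vertex_set X \<and> successively (\<lambda>x y. {x, y} \<in> edges X) \<gamma>"

definition graph_dist :: "'a set set \<Rightarrow> 'a \<Rightarrow> 'a \<Rightarrow> nat" where
  "graph_dist X x y =
     (LEAST n. \<exists>\<gamma>. comb_path X \<gamma> \<and> hd \<gamma> = x \<and> last \<gamma> = y \<and> length \<gamma> = Suc n)"

definition geodesic :: "'a set set \<Rightarrow> 'a list \<Rightarrow> bool" where
  "geodesic X \<gamma> \<longleftrightarrow> comb_path X \<gamma> \<and> length \<gamma> = Suc (graph_dist X (hd \<gamma>) (last \<gamma>))"


section \<open>Group actions\<close>

definition cubical_action ::
    "('g, 'm) monoid_scheme \<Rightarrow> 'a set set \<Rightarrow> ('g \<Rightarrow> 'a \<Rightarrow> 'a) \<Rightarrow> bool" where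
  "cubical_action G X \<rho> \<longleftrightarrow>
     group_action G (vertex_set X) \<rho> \<and> (\<forall>g\<in>carrier G. \<forall>c\<in>X. \<rho> g ` c \<in> X)"

text \<open>
  Properness and cocompactness are stated with finite families of cubes in the place of compact
  subsets. Two subcomplexes intersect iff they have a common vertex.
\<close>

definition proper_action ::
    "('g, 'm) monoid_scheme \<Rightarrow> 'a set set \<Rightarrow> ('g \<Rightarrow> 'a \<Rightarrow> 'a) \<Rightarrow> bool" where
  "proper_action G X \<rho> \<longleftrightarrow>
     (\<forall>F. finite F \<and> F \<subseteq> X \<longrightarrow>
        finite {g \<in> carrier G. \<exists>c\<in>F. \<exists>d\<in>F. \<rho> g ` c \<inter> d \<noteq> {}})"

definition cocompact_action ::
    "('g, 'm) monoid_scheme \<Rightarrow> 'a set set \<Rightarrow> ('g \<Rightarrow> 'a \<Rightarrow> 'a) \<Rightarrow> bool" where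
  "cocompact_action G X \<rho> \<longleftrightarrow>
     (\<exists>F. finite F \<and> F \<subseteq> X \<and> (\<forall>c\<in>X. \<exists>g\<in>carrier G. \<exists>d\<in>F. c = \<rho> g ` d))"

definition essential_action ::
    "('g, 'm) monoid_scheme \<Rightarrow> 'a set set \<Rightarrow> ('g \<Rightarrow> 'a \<Rightarrow> 'a) \<Rightarrow> bool" where
  "essential_action G X \<rho> \<longleftrightarrow>
     (\<forall>h\<in>hyperplanes X. \<forall>x\<in>vertex_set X. \<forall>A\<in>halfspaces X h. \<forall>B\<in>halfspaces X h. A \<noteq> B \<longrightarrow>
        (\<forall>n. \<exists>g\<in>carrier G. \<rho> g x \<in> A \<and> (\<forall>y\<in>B. n \<le> graph_dist X (\<rho> g x) y)))"

definition virtually_cyclic :: "('g, 'm) monoid_scheme \<Rightarrow> bool" where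
  "virtually_cyclic G \<longleftrightarrow>
     (\<exists>C. subgroup C G \<and> finite (rcosets\<^bsub>G\<^esub> C) \<and> cyclic_group (G\<lparr>carrier := C\<rparr>))"


section \<open>Restriction quotients\<close>

text \<open>
  \<open>X\<close> is the restriction quotient of \<open>Z\<close> by \<open>W\<close>, with quotient map \<open>\<phi>\<close> (given on vertices): the map
  is cellular and surjective, as \<open>X\<close> consists of the images of the cubes of \<open>Z\<close>. These conditions
  determine \<open>X\<close> and \<open>\<phi>\<close> up to isomorphism: two vertices of \<open>Z\<close> are identified iff no hyperplane
  in \<open>W\<close> separates them.
\<close>

definition restriction_quotient ::
    "'a set set \<Rightarrow> 'a set set set \<Rightarrow> 'b set set \<Rightarrow> ('a \<Rightarrow> 'b) \<Rightarrow> bool" where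
  "restriction_quotient Z W X \<phi> \<longleftrightarrow>
     cat0_cube_complex X \<and>
     X = (`) \<phi> ` Z \<and>
     (\<forall>h\<in>hyperplanes Z. \<forall>e\<in>h. card (\<phi> ` e) = 1 \<longleftrightarrow> h \<notin> W) \<and>
     bij_betw (\<lambda>h. (`) \<phi> ` h) W (hyperplanes X)"


section \<open>Right-angled Artin groups and special quotients\<close>

definition simple_graph :: "nat set \<Rightarrow> nat set set \<Rightarrow> bool" where
  "simple_graph V E \<longleftrightarrow> finite V \<and> (\<forall>e\<in>E. e \<subseteq> V \<and> card e = 2)"

text \<open>The letter \<open>(s, True)\<close> is the generator \<open>s\<close>, and \<open>(s, False)\<close> is its inverse.\<close>

definition raag_words :: "nat set \<Rightarrow> (nat \<times> bool) list set" where
  "raag_words V = lists (V \<times> UNIV)"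

definition raag_step :: "nat set \<Rightarrow> nat set set \<Rightarrow> ((nat \<times> bool) list \<times> (nat \<times> bool) list) set" where
  "raag_step V E =
     {(u @ [(s, b), (s, \<not> b)] @ v, u @ v) | u v s b.
        u \<in> raag_words V \<and> v \<in> raag_words V \<and> s \<in> V} \<union>
     {(u @ [(s, b), (t, c)] @ v, u @ [(t, c), (s, b)] @ v) | u v s b t c.
        u \<in> raag_words V \<and> v \<in> raag_words V \<and> {s, t} \<in> E}"

definition raag_eq :: "nat set \<Rightarrow> nat set set \<Rightarrow> ((nat \<times> bool) list \<times> (nat \<times> bool) list) set" where
  "raag_eq V E = (raag_step V E \<union> (raag_step V E)\<inverse>)\<^sup>*"

definition raag :: "nat set \<Rightarrow> nat set set \<Rightarrow> (nat \<times> bool) list set monoid" where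
  "raag V E =
     \<lparr>carrier = raag_words V // raag_eq V E,
      monoid.mult = (\<lambda>x y. \<Union>u\<in>x. \<Union>v\<in>y. raag_eq V E `` {u @ v}),
      one = raag_eq V E `` {[]}\<rparr>"

text \<open>
  The universal cover of the Salvetti complex: its vertices are the elements of the group, and each
  element \<open>x\<close> and finite clique \<open>K\<close> span a cube whose vertices are the products of \<open>x\<close> with the
  elements of subsets of \<open>K\<close> (in any order, as these generators commute).
\<close>

definition salvetti_cover :: "nat set \<Rightarrow> nat set set \<Rightarrow> (nat \<times> bool) list set set set" where
  "salvetti_cover V E =
     {{x \<otimes>\<^bsub>raag V E\<^esub> (raag_eq V E `` {map (\<lambda>s. (s, True)) ss}) | ss. distinct ss \<and> set ss \<subseteq> K} | x K.
        x \<in> carrier (raag V E) \<and> finite K \<and> K \<subseteq> V \<and>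
        (\<forall>s\<in>K. \<forall>t\<in>K. s \<noteq> t \<longrightarrow> {s, t} \<in> E)}"

text \<open>
  The quotient of \<open>X\<close> by \<open>K\<close> is special in the sense of Haglund and Wise, in the form valid for
  proper cocompact actions. The image of \<open>X\<close> under \<open>f\<close> is the complex \<open>(`) f ` X\<close>; in particular
  \<open>f\<close> is required to be an isomorphism onto a full subcomplex.
\<close>

definition special_quotient ::
    "('g, 'm) monoid_scheme \<Rightarrow> 'a set set \<Rightarrow> ('g \<Rightarrow> 'a \<Rightarrow> 'a) \<Rightarrow> bool" where
  "special_quotient K X \<rho> \<longleftrightarrow>
     (\<exists>V E \<psi> f. simple_graph V E \<and>
        \<psi> \<in> hom K (raag V E) \<and> inj_on \<psi> (carrier K) \<and>
        f ` vertex_set X \<subseteq> carrier (raag V E) \<and> inj_on f (vertex_set X) \<and>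
        (\<forall>g\<in>carrier K. \<forall>x\<in>vertex_set X. f (\<rho> g x) = \<psi> g \<otimes>\<^bsub>raag V E\<^esub> f x) \<and>
        (\<forall>x\<in>vertex_set X. \<forall>y\<in>vertex_set X.
           graph_dist (salvetti_cover V E) (f x) (f y) = graph_dist X x y) \<and>
        convex_subcomplex ((`) f ` X) (salvetti_cover V E))"


section \<open>Oriented hyperplanes of a quotient complex\<close>

text \<open>
  The cells of the quotient of \<open>X\<close> by a group \<open>K\<close> acting via \<open>\<rho>\<close> are the \<open>K\<close>-orbits of cells of \<open>X\<close>.
  An oriented edge is the pair of its endpoints.
\<close>

definition oriented_edges :: "'a set set \<Rightarrow> ('a \<times> 'a) set" where
  "oriented_edges X = {(x, y). {x, y} \<in> edges X}"

definition parallel_edges :: "'a set set \<Rightarrow> (('a \<times> 'a) \<times> ('a \<times> 'a)) set" where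
  "parallel_edges X = {((a, b), (c, d)). {a, b, c, d} \<in> squares X \<and>
     {a, b} \<in> edges X \<and> {c, d} \<in> edges X \<and> {a, c} \<in> edges X \<and> {b, d} \<in> edges X}"

definition quotient_vertices ::
    "('g, 'm) monoid_scheme \<Rightarrow> 'a set set \<Rightarrow> ('g \<Rightarrow> 'a \<Rightarrow> 'a) \<Rightarrow> 'a set set" where
  "quotient_vertices K X \<rho> = orbits K (vertex_set X) \<rho>"

definition edge_orbit ::
    "('g, 'm) monoid_scheme \<Rightarrow> ('g \<Rightarrow> 'a \<Rightarrow> 'a) \<Rightarrow> 'a \<times> 'a \<Rightarrow> ('a \<times> 'a) set" where
  "edge_orbit K \<rho> e = orbit K (\<lambda>g. map_prod (\<rho> g) (\<rho> g)) e"

definition quotient_parallel ::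
    "('g, 'm) monoid_scheme \<Rightarrow> 'a set set \<Rightarrow> ('g \<Rightarrow> 'a \<Rightarrow> 'a) \<Rightarrow>
     (('a \<times> 'a) set \<times> ('a \<times> 'a) set) set" where
  "quotient_parallel K X \<rho> =
     {(edge_orbit K \<rho> e, edge_orbit K \<rho> e') | e e'. (e, e') \<in> parallel_edges X}"

definition quotient_oriented_hyperplanes ::
    "('g, 'm) monoid_scheme \<Rightarrow> 'a set set \<Rightarrow> ('g \<Rightarrow> 'a \<Rightarrow> 'a) \<Rightarrow> ('a \<times> 'a) set set set" where
  "quotient_oriented_hyperplanes K X \<rho> =
     (edge_orbit K \<rho> ` oriented_edges X) // ((quotient_parallel K X \<rho>)\<^sup>*)"

text \<open>
  The image in the quotient of the oriented hyperplane of \<open>X\<close> dual to \<open>e\<close>, that is, the oriented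
  hyperplane of the quotient dual to the image of \<open>e\<close>.
\<close>

definition quotient_label ::
    "('g, 'm) monoid_scheme \<Rightarrow> 'a set set \<Rightarrow> ('g \<Rightarrow> 'a \<Rightarrow> 'a) \<Rightarrow> 'a \<times> 'a \<Rightarrow> ('a \<times> 'a) set set" where
  "quotient_label K X \<rho> e = (quotient_parallel K X \<rho>)\<^sup>* `` {edge_orbit K \<rho> e}"

text \<open>
  The inclusion of the oriented hyperplanes of the quotient of \<open>X\<close> into those of the quotient of
  \<open>Z\<close>, where \<open>\<phi>\<close> is a restriction quotient map from \<open>Z\<close> to \<open>X\<close>: the image of \<open>s\<close> consists of the
  orbits of those uncollapsed oriented edges of \<open>Z\<close> which \<open>\<phi>\<close> maps to edges dual to \<open>s\<close>.
\<close>

definition hyperplane_inclusion ::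
    "('g, 'm) monoid_scheme \<Rightarrow> 'a set set \<Rightarrow> ('g \<Rightarrow> 'a \<Rightarrow> 'a) \<Rightarrow>
     'b set set \<Rightarrow> ('g \<Rightarrow> 'b \<Rightarrow> 'b) \<Rightarrow> ('a \<Rightarrow> 'b) \<Rightarrow>
     ('b \<times> 'b) set set \<Rightarrow> ('a \<times> 'a) set set" where
  "hyperplane_inclusion K Z \<rho> X \<sigma> \<phi> s =
     {edge_orbit K \<rho> e | e. e \<in> oriented_edges Z \<and> map_prod \<phi> \<phi> e \<in> oriented_edges X \<and>
        edge_orbit K \<sigma> (map_prod \<phi> \<phi> e) \<in> s}"

definition represents ::
    "('g, 'm) monoid_scheme \<Rightarrow> 'a set set \<Rightarrow> ('g \<Rightarrow> 'a \<Rightarrow> 'a) \<Rightarrow>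
     'a list \<Rightarrow> ('a \<times> 'a) set set list \<Rightarrow> bool" where
  "represents K X \<rho> \<gamma> w \<longleftrightarrow>
     comb_path X \<gamma> \<and> w = map (quotient_label K X \<rho>) (zip \<gamma> (tl \<gamma>))"

definition geodesic_representative ::
    "('g, 'm) monoid_scheme \<Rightarrow> 'a set set \<Rightarrow> ('g \<Rightarrow> 'a \<Rightarrow> 'a) \<Rightarrow> 'a \<Rightarrow>
     ('a \<times> 'a) set set list \<Rightarrow> 'a list \<Rightarrow> bool" where
  "geodesic_representative K X \<rho> x w \<gamma> \<longleftrightarrow>
     geodesic X \<gamma> \<and> hd \<gamma> = x \<and> represents K X \<rho> \<gamma> w"

text \<open>Meaningful only for words \<open>w\<close> with exactly one geodesic representative issuing from \<open>x\<close>.\<close>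

definition the_geodesic ::
    "('g, 'm) monoid_scheme \<Rightarrow> 'a set set \<Rightarrow> ('g \<Rightarrow> 'a \<Rightarrow> 'a) \<Rightarrow> 'a \<Rightarrow>
     ('a \<times> 'a) set set list \<Rightarrow> 'a list" where
  "the_geodesic K X \<rho> x w = (THE \<gamma>. geodesic_representative K X \<rho> x w \<gamma>)"

definition endpoint ::
    "('g, 'm) monoid_scheme \<Rightarrow> 'a set set \<Rightarrow> ('g \<Rightarrow> 'a \<Rightarrow> 'a) \<Rightarrow> 'a \<Rightarrow>
     ('a \<times> 'a) set set list \<Rightarrow> 'a" where
  "endpoint K X \<rho> x w = last (the_geodesic K X \<rho> x w)"


section \<open>Automata\<close>

record ('v, 'e, 's) automaton =
  graph :: "('v, 'e) pre_digraph"
  label :: "'e \<Rightarrow> 's"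
  initial :: "'v set"
  final :: "'v set"

definition automaton_over :: "'s set \<Rightarrow> ('v, 'e, 's) automaton \<Rightarrow> bool" where
  "automaton_over S \<A> \<longleftrightarrow> finite S \<and> fin_digraph (graph \<A>) \<and>
     label \<A> ` arcs (graph \<A>) \<subseteq> S \<and>
     initial \<A> \<noteq> {} \<and> initial \<A> \<subseteq> verts (graph \<A>) \<and>
     final \<A> \<noteq> {} \<and> final \<A> \<subseteq> verts (graph \<A>)"

text \<open>A path is given by its first vertex and its list of arcs.\<close>

definition initial_paths :: "('v, 'e, 's) automaton \<Rightarrow> 's list \<Rightarrow> ('v \<times> 'e list) set" where
  "initial_paths \<A> w = {(u, p). u \<in> initial \<A> \<and> (\<exists>v. pre_digraph.awalk (graph \<A>) u p v) \<and>
     w = map (label \<A>) p}"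

definition language :: "('v, 'e, 's) automaton \<Rightarrow> 's list set" where
  "language \<A> = {map (label \<A>) p | u p v.
     u \<in> initial \<A> \<and> v \<in> final \<A> \<and> pre_digraph.awalk (graph \<A>) u p v}"

definition pruned :: "('v, 'e, 's) automaton \<Rightarrow> bool" where
  "pruned \<A> \<longleftrightarrow> (\<forall>v\<in>verts (graph \<A>). \<exists>u\<in>initial \<A>. \<exists>p. pre_digraph.awalk (graph \<A>) u p v)"

text \<open>
  For a path with arcs \<open>e\<^sub>1, \<dots>, e\<^sub>n\<close> through the vertices \<open>v\<^sub>0, \<dots>, v\<^sub>n\<close>, the word
  \<open>\<Psi>(v\<^sub>0) \<iota>(\<pi>(e\<^sub>1)) \<Psi>(v\<^sub>1) \<dots> \<Psi>(v\<^sub>n\<^sub>-\<^sub>1) \<iota>(\<pi>(e\<^sub>n))\<close>, which does not involve \<open>\<Psi>(v\<^sub>n)\<close>.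
\<close>

definition interleave ::
    "('v, 'e, 's) automaton \<Rightarrow> ('v \<Rightarrow> 't list) \<Rightarrow> ('s \<Rightarrow> 't) \<Rightarrow> 'e list \<Rightarrow> 't list" where
  "interleave \<A> \<Psi> \<iota> p = concat (map (\<lambda>e. \<Psi> (tail (graph \<A>) e) @ [\<iota> (label \<A> e)]) p)"

end

theory Submission
  imports Defs
begin

text \<open>
  The geometry of both complexes takes place in universal covers of Salvetti complexes, where it is
  combinatorics of words. By specialness, \<open>Z\<close> and \<open>X\<close> are equivariantly convex subcomplexes of such covers,
  so a path with a given first vertex is a word in the generators of a right-angled Artin group. The
  label of an edge in the quotient determines its letter (\<open>label_of_letter\<close>), hence a word over the oriented
  hyperplanes of the quotient is represented by at most one path from a given vertex.

  A hyperplane of the cover is a coset of the subgroup generated by the link of a generator. Counting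
  crossings with signs gives an invariant of group elements, so a word that crosses no hyperplane twice
  is shortest; conversely, a word that is not shortest contains two inverse letters that commute with
  everything between them (\<open>deletion\<close>). Therefore the geodesics are the paths that cross no hyperplane
  twice (\<open>reduced_iff_distinct_hyp\<close>), convex subcomplexes contain the geodesics between their vertices
  (\<open>geodesically_closed\<close>), and each group element is represented by exactly one normal word, in which no
  letter can be moved to the left until it cancels or passes a larger one (\<open>normal_word_exists\<close>,
  \<open>normal_word_unique\<close>). Whether a letter may follow a normal word depends on a finite amount of data,
  namely the set of letters that the word blocks, and this set can be updated letter by letter
  (\<open>blocks_snoc\<close>). So the normal words of the paths from \<open>oX\<close> form a regular language \<open>L\<close> which reaches each
  vertex of \<open>X\<close> once.

  The fibres of \<open>\<phi>\<close> are convex. A path of \<open>X\<close> is lifted edge by edge: from the current vertex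
  \<open>z\<close>, move inside the fibre along a shortest path to some vertex from which the next edge can be
  crossed, and cross it. The lift of a geodesic is a geodesic (\<open>lift_reduced\<close>). Indeed, a hyperplane that is
  crossed twice is not in \<open>W\<close>, as \<open>\<phi>\<close> maps \<open>W\<close> injectively to the hyperplanes of \<open>X\<close>, and the image
  is a geodesic. So it is crossed by the motion in two fibres, and by deletion the first of these crossings commutes with
  everything up to the next lifted edge. Then it could have been omitted, and the motion in the first fibre
  was not shortest.

  The labels of the motion in the fibre only depend on the orbit of \<open>z\<close> and on the next label of the path
  in \<open>X\<close>. So the states of the automaton consist of the orbit of \<open>z\<close>, the set of blocked letters and an
  announcement of the next label (\<open>lookahead_automaton\<close>). Then \<open>\<Psi>\<close> is the word of labels of the motion in the
  fibre, \<open>\<Xi>\<close> is the orbit of \<open>\<phi> z\<close>, and a word of \<open>L\<close> determines all states of its path except for the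
  announcement of the last one.
\<close>

section \<open>Words in a right-angled Artin group\<close>

type_synonym letter = "nat \<times> bool"

definition linv :: "letter \<Rightarrow> letter" where
  "linv a = (fst a, \<not> snd a)"

lemma linv_simps [simp]: "linv (linv a) = a" "fst (linv a) = fst a" "linv a \<noteq> a" "a \<noteq> linv a"
  "linv (s, b) = (s, \<not> b)"
  by (auto simp: linv_def prod_eq_iff)

lemma linv_inj [simp]: "linv a = linv b \<longleftrightarrow> a = b"
  by (auto simp: linv_def prod_eq_iff)

lemma same_generator: "fst a = fst b \<Longrightarrow> a = b \<or> a = linv b"
  by (auto simp: linv_def prod_eq_iff)

locale raag_graph =
  fixes V :: "nat set" and E :: "nat set set"
  assumes simple: "simple_graph V E"
begin

abbreviation letters :: "letter set" where "letters \<equiv> V \<times> UNIV"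
abbreviation wordeq :: "letter list \<Rightarrow> letter list \<Rightarrow> bool" (infix "\<doteq>" 50)
  where "u \<doteq> v \<equiv> (u, v) \<in> raag_eq V E"

definition comm :: "letter \<Rightarrow> letter \<Rightarrow> bool" where
  "comm a b \<longleftrightarrow> {fst a, fst b} \<in> E"

lemma comm_sym: "comm a b \<longleftrightarrow> comm b a"
  by (simp add: comm_def insert_commute)

lemma comm_letters: "comm a b \<Longrightarrow> a \<in> letters" "comm a b \<Longrightarrow> b \<in> letters"
  using simple by (auto simp: comm_def simple_graph_def mem_Times_iff)

lemma comm_neq: "comm a b \<Longrightarrow> fst a \<noteq> fst b"
  using simple by (force simp: comm_def simple_graph_def)

lemma comm_linv [simp]: "comm (linv a) b \<longleftrightarrow> comm a b" "comm a (linv b) \<longleftrightarrow> comm a b"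
  by (auto simp: comm_def)

lemma linv_letters [simp]: "linv a \<in> letters \<longleftrightarrow> a \<in> letters"
  by (auto simp: linv_def mem_Times_iff)

abbreviation words :: "letter list set" where "words \<equiv> lists letters"

lemma raag_words_eq: "raag_words V = words"
  by (simp add: raag_words_def)

lemma finite_letters: "finite letters"
  using simple by (simp add: simple_graph_def)

lemma wordeq_refl [simp, intro]: "u \<doteq> u"
  by (simp add: raag_eq_def)

lemma wordeq_sym: "u \<doteq> v \<Longrightarrow> v \<doteq> u"
  unfolding raag_eq_def
  by (metis (no_types, lifting) converse_Un converse_converse rtrancl_converseD sup_commute)

lemma wordeq_trans [trans]: "u \<doteq> v \<Longrightarrow> v \<doteq> w \<Longrightarrow> u \<doteq> w"
  unfolding raag_eq_def by (rule rtrancl_trans)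

lemma step_wordeq: "(u, v) \<in> raag_step V E \<Longrightarrow> u \<doteq> v"
  by (auto simp: raag_eq_def)

lemma wordeq_invariant:
  assumes "u \<doteq> v" and "\<And>x y. (x, y) \<in> raag_step V E \<Longrightarrow> F x = F y"
  shows "F u = F v"
  using assms(1) unfolding raag_eq_def
  by (induction rule: rtrancl_induct) (auto dest: assms(2))

lemma raag_stepE:
  assumes "(x, y) \<in> raag_step V E"
  obtains (cancel) u a v where "x = u @ [a, linv a] @ v" "y = u @ v" "a \<in> letters" "u \<in> words" "v \<in> words"
  | (swap) u a b v where "x = u @ [a, b] @ v" "y = u @ [b, a] @ v" "comm a b" "u \<in> words" "v \<in> words"
  using assms unfolding raag_step_def raag_words_eq
proof (elim UnE CollectE exE conjE, goal_cases)
  case (1 u v s b)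
  then show ?case by (intro 1(1)[of u "(s, b)" v]) auto
next
  case (2 u v s b t c)
  then show ?case by (intro 2(2)[of u "(s, b)" "(t, c)" v]) (auto simp: comm_def)
qed

lemma cancel_step: "a \<in> letters \<Longrightarrow> u \<in> words \<Longrightarrow> v \<in> words \<Longrightarrow> (u @ [a, linv a] @ v, u @ v) \<in> raag_step V E"
  unfolding raag_step_def raag_words_eq by (cases a) auto

lemma swap_step: "comm a b \<Longrightarrow> u \<in> words \<Longrightarrow> v \<in> words \<Longrightarrow> (u @ [a, b] @ v, u @ [b, a] @ v) \<in> raag_step V E"
  unfolding raag_step_def raag_words_eq comm_def
  by (intro UnI2 CollectI exI[of _ u] exI[of _ v] exI[of _ "fst a"] exI[of _ "snd a"] exI[of _ "fst b"] exI[of _ "snd b"])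
    simp

lemma wordeq_words: "u \<doteq> v \<Longrightarrow> u \<in> words \<longleftrightarrow> v \<in> words"
  by (rule wordeq_invariant[where F = "\<lambda>u. u \<in> words"], assumption)
    (erule raag_stepE; simp add: comm_letters)

lemma step_context:
  assumes "(x, y) \<in> raag_step V E" "p \<in> words" "q \<in> words"
  shows "(p @ x @ q, p @ y @ q) \<in> raag_step V E"
  using assms(1)
proof (cases rule: raag_stepE)
  case (cancel u a v)
  then show ?thesis using cancel_step[of a "p @ u" "v @ q"] assms by simp
next
  case (swap u a b v)
  then show ?thesis using swap_step[of a b "p @ u" "v @ q"] assms by simp
qed

lemma wordeq_context:
  assumes "u \<doteq> v" "p \<in> words" "q \<in> words"
  shows "p @ u @ q \<doteq> p @ v @ q"
  using assms(1) unfolding raag_eq_def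
proof (induction rule: rtrancl_induct)
  case (step y z)
  then have "(p @ y @ q, p @ z @ q) \<in> raag_step V E \<union> (raag_step V E)\<inverse>"
    using step_context assms(2,3) by auto
  with step.IH show ?case by (rule rtrancl_into_rtrancl)
qed simp

lemma wordeq_append:
  assumes "u \<doteq> u'" "v \<doteq> v'" "u \<in> words" "v \<in> words"
  shows "u @ v \<doteq> u' @ v'"
proof -
  have "u @ v \<doteq> u' @ v" using wordeq_context[of u u' "[]" v] assms by simp
  also have "u' @ v \<doteq> u' @ v'" using wordeq_context[of v v' u' "[]"] assms wordeq_words by simp
  finally show ?thesis .
qed

definition winv :: "letter list \<Rightarrow> letter list" where
  "winv w = rev (map linv w)"

lemma winv_words [simp]: "winv w \<in> words \<longleftrightarrow> w \<in> words"
  by (induction w) (auto simp: winv_def)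

lemma winv_right: "w \<in> words \<Longrightarrow> w @ winv w \<doteq> []"
proof (induction w)
  case (Cons a w)
  have "a # w @ winv w @ [linv a] \<doteq> [a] @ [] @ [linv a]"
    using wordeq_context[of "w @ winv w" "[]" "[a]" "[linv a]"] Cons by simp
  also have "[a] @ [] @ [linv a] \<doteq> []"
    using cancel_step[of a "[]" "[]"] Cons step_wordeq by simp
  finally show ?case by (simp add: winv_def)
qed (simp add: winv_def)

lemma winv_left: "w \<in> words \<Longrightarrow> winv w @ w \<doteq> []"
  using winv_right[of "winv w"] winv_words[of w] by (simp add: winv_def rev_map comp_def del: winv_words)

lemma cancel_left:
  assumes "p @ u \<doteq> p @ v" "p \<in> words" "u \<in> words"
  shows "u \<doteq> v"
proof -
  have v: "v \<in> words" using assms wordeq_words[OF assms(1)] by simp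
  have *: "x \<doteq> winv p @ p @ x" if "x \<in> words" for x
    using wordeq_append[OF winv_left[of p] wordeq_refl[of x]] that assms wordeq_sym by auto
  have "u \<doteq> winv p @ p @ u" using * assms by simp
  also have "winv p @ p @ u \<doteq> winv p @ p @ v"
    using wordeq_context[OF assms(1), of "winv p" "[]"] assms by simp
  also have "winv p @ p @ v \<doteq> v" using * v wordeq_sym by blast
  finally show ?thesis .
qed

lemma cancel_right:
  assumes "u @ q \<doteq> v @ q" "q \<in> words" "u \<in> words" "v \<in> words"
  shows "u \<doteq> v"
proof -
  have *: "x \<doteq> x @ q @ winv q" if "x \<in> words" for x
    using wordeq_append[OF wordeq_refl[of x] winv_right[of q]] that assms wordeq_sym by auto
  have "u \<doteq> u @ q @ winv q" using * assms by simp
  also have "u @ q @ winv q \<doteq> v @ q @ winv q"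
    using wordeq_context[OF assms(1), of "[]" "winv q"] assms by simp
  also have "v @ q @ winv q \<doteq> v" using * assms wordeq_sym by blast
  finally show ?thesis .
qed

lemma cancel_pair: "a \<in> letters \<Longrightarrow> u \<in> words \<Longrightarrow> v \<in> words \<Longrightarrow> u @ a # linv a # v \<doteq> u @ v"
  using step_wordeq[OF cancel_step[of a u v]] by simp

lemma cancel_pair': "a \<in> letters \<Longrightarrow> u \<in> words \<Longrightarrow> v \<in> words \<Longrightarrow> u @ linv a # a # v \<doteq> u @ v"
  using cancel_pair[of "linv a" u v] by simp

lemma commute_past:
  assumes "\<forall>c\<in>set v. comm a c" "a \<in> letters"
  shows "a # v \<doteq> v @ [a]"
  using assms(1)
proof (induction v)
  case (Cons c v)
  have c: "comm a c" using Cons by simp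
  moreover have "v \<in> words" unfolding in_lists_conv_set using Cons.prems comm_letters(2) by (metis list.set_intros(2))
  moreover have "c \<in> letters" using c comm_letters by blast
  ultimately have c: "comm a c" "v \<in> words" "c \<in> letters" by auto
  have "a # c # v \<doteq> c # a # v"
    using step_wordeq[OF swap_step[of a c "[]" v]] c by simp
  also have "c # a # v \<doteq> c # v @ [a]"
    using wordeq_context[of "a # v" "v @ [a]" "[c]" "[]"] Cons c by simp
  finally show ?case by simp
qed simp

text \<open>Killing the generators outside \<open>T\<close> is a retraction of the group. It will often show that a shortest
  word cannot contain certain letters, because deleting them would not change the element.\<close>

lemma wordeq_filter:
  assumes "u \<doteq> v"
  shows "filter (\<lambda>a. fst a \<in> T) u \<doteq> filter (\<lambda>a. fst a \<in> T) v"
proof -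
  define fl where "fl = filter (\<lambda>a :: letter. fst a \<in> T)"
  have fl_words: "x \<in> words \<Longrightarrow> fl x \<in> words" for x by (auto simp: fl_def in_lists_conv_set)
  have *: "fl x \<doteq> fl y" if "(x, y) \<in> raag_step V E" for x y
    using that
  proof (cases rule: raag_stepE)
    case (cancel p a q)
    then show ?thesis
      using step_wordeq[OF cancel_step[of a "fl p" "fl q"]] fl_words by (auto simp: fl_def)
  next
    case (swap p a b q)
    then show ?thesis
      using step_wordeq[OF swap_step[of a b "fl p" "fl q"]] fl_words by (auto simp: fl_def)
  qed
  have "raag_eq V E `` {fl u} = raag_eq V E `` {fl v}"
    by (rule wordeq_invariant[OF assms, where F = "\<lambda>u. raag_eq V E `` {fl u}"])
      (use * wordeq_sym wordeq_trans in blast)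
  then show ?thesis using fl_def by blast
qed

definition expo :: "nat \<Rightarrow> letter list \<Rightarrow> int" where
  "expo s w = int (count_list w (s, True)) - int (count_list w (s, False))"

lemma expo_simps [simp]: "expo s [] = 0"
  "expo s (a # w) = (if fst a = s then (if snd a then 1 else -1) else 0) + expo s w"
  "expo s (u @ v) = expo s u + expo s v"
  by (auto simp: expo_def prod_eq_iff)

lemma wordeq_expo: "u \<doteq> v \<Longrightarrow> expo s u = expo s v"
  by (rule wordeq_invariant[where F = "expo s"]) (auto elim!: raag_stepE simp: linv_def)

section \<open>Walls\<close>

text \<open>The hyperplanes of the universal cover of the Salvetti complex that are dual to edges labelled by the
  generator \<open>s\<close> correspond to the cosets of the subgroup generated by the link of \<open>s\<close>: sliding an
  edge across a square multiplies its base by a generator that commutes with \<open>s\<close>.\<close>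

definition linkw :: "nat \<Rightarrow> letter list set" where
  "linkw s = {x. \<forall>c\<in>set x. {s, fst c} \<in> E}"

lemma linkw_simps [simp]: "[] \<in> linkw s" "u @ v \<in> linkw s \<longleftrightarrow> u \<in> linkw s \<and> v \<in> linkw s"
  "a # v \<in> linkw s \<longleftrightarrow> {s, fst a} \<in> E \<and> v \<in> linkw s" "winv u \<in> linkw s \<longleftrightarrow> u \<in> linkw s"
  by (auto simp: linkw_def winv_def)

lemma linkw_iff: "x \<in> linkw (fst a) \<longleftrightarrow> (\<forall>c\<in>set x. comm a c)"
  by (auto simp: linkw_def comm_def)

lemma linkw_words: "x \<in> linkw s \<Longrightarrow> x \<in> words"
  using simple by (force simp: linkw_def simple_graph_def in_lists_conv_set mem_Times_iff)

lemma linkw_self: "{s} \<notin> E"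
  using simple by (force simp: simple_graph_def)

text \<open>The base of an edge is its end from which it is traversed positively, so that an edge and its reverse
  have the same base.\<close>

definition wbase :: "letter list \<Rightarrow> letter \<Rightarrow> letter list" where
  "wbase p a = (if snd a then p else p @ [a])"

definition same_wall :: "letter list \<Rightarrow> letter \<Rightarrow> letter list \<Rightarrow> letter \<Rightarrow> bool" where
  "same_wall p a q b \<longleftrightarrow> fst a = fst b \<and> (\<exists>x\<in>linkw (fst a). wbase q b \<doteq> wbase p a @ x)"

lemma wbase_words [simp]: "p \<in> words \<Longrightarrow> a \<in> letters \<Longrightarrow> wbase p a \<in> words"
  by (simp add: wbase_def)

lemma same_wall_sym:
  assumes "same_wall p a q b" "p \<in> words" "a \<in> letters"
  shows "same_wall q b p a"
proof -
  obtain x where x: "x \<in> linkw (fst a)" "wbase q b \<doteq> wbase p a @ x" and f: "fst a = fst b"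
    using assms by (auto simp: same_wall_def)
  have "wbase q b @ winv x \<doteq> wbase p a @ x @ winv x"
    using wordeq_context[OF x(2), of "[]" "winv x"] linkw_words[OF x(1)] by simp
  also have "wbase p a @ x @ winv x \<doteq> wbase p a @ []"
    using wordeq_context[OF winv_right, of x "wbase p a" "[]"] linkw_words[OF x(1)] assms by simp
  finally have "wbase p a \<doteq> wbase q b @ winv x" using wordeq_sym by simp
  then show ?thesis using x f by (auto simp: same_wall_def)
qed

lemma same_wall_trans:
  assumes "same_wall p a q b" "same_wall q b r c" "p \<in> words" "a \<in> letters"
  shows "same_wall p a r c"
proof -
  obtain x where x: "x \<in> linkw (fst a)" "wbase q b \<doteq> wbase p a @ x" and f: "fst a = fst b"
    using assms by (auto simp: same_wall_def)
  obtain y where y: "y \<in> linkw (fst b)" "wbase r c \<doteq> wbase q b @ y" and g: "fst b = fst c"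
    using assms by (auto simp: same_wall_def)
  note y(2)
  also have "wbase q b @ y \<doteq> wbase p a @ x @ y"
    using wordeq_context[OF x(2), of "[]" y] linkw_words[OF y(1)] by simp
  finally show ?thesis using x y f g unfolding same_wall_def
    by (intro conjI bexI[of _ "x @ y"]) auto
qed

text \<open>
  The algebraic intersection number of the path reading a word from \<open>p\<close> with the wall of generator \<open>s\<close>
  and base \<open>g\<close>. As it is an invariant of the group element, it will bound lengths from below.\<close>

primrec crossing :: "nat \<Rightarrow> letter list \<Rightarrow> letter list \<Rightarrow> letter list \<Rightarrow> int" where
  "crossing s g p [] = 0"
| "crossing s g p (a # w) =
     (if fst a = s \<and> (\<exists>x\<in>linkw s. wbase p a \<doteq> g @ x) then (if snd a then 1 else -1) else 0)
     + crossing s g (p @ [a]) w"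

lemma crossing_append: "crossing s g p (u @ v) = crossing s g p u + crossing s g (p @ u) v"
  by (induction u arbitrary: p) auto

lemma crossing_base:
  assumes "p \<doteq> p'" "w \<in> words"
  shows "crossing s g p w = crossing s g p' w"
  using assms
proof (induction w arbitrary: p p')
  case (Cons a w)
  have e: "p @ [a] \<doteq> p' @ [a]" using wordeq_context[OF Cons.prems(1), of "[]" "[a]"] Cons.prems by simp
  have "wbase p a \<doteq> wbase p' a" using e Cons.prems by (auto simp: wbase_def)
  then have "wbase p a \<doteq> z \<longleftrightarrow> wbase p' a \<doteq> z" for z
    using wordeq_sym wordeq_trans by blast
  then show ?case using Cons.IH[OF e] Cons.prems by simp
qed simp

text \<open>A letter that commutes with \<open>a\<close> slides an edge labelled by \<open>a\<close> along its wall.\<close>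

lemma crossing_link:
  assumes "comm a c" "p \<in> words"
  shows "(\<exists>x\<in>linkw (fst a). wbase (p @ [c]) a \<doteq> g @ x) \<longleftrightarrow> (\<exists>x\<in>linkw (fst a). wbase p a \<doteq> g @ x)"
proof -
  have ac: "a \<in> letters" "c \<in> letters" using comm_letters assms(1) by auto
  have e: "wbase (p @ [c]) a \<doteq> wbase p a @ [c]"
    using step_wordeq[OF swap_step[of c a p "[]"]] assms by (simp add: wbase_def comm_sym)
  have c: "[c] \<in> linkw (fst a)" "[linv c] \<in> linkw (fst a)" using assms by (auto simp: comm_def)
  show ?thesis
  proof
    assume "\<exists>x\<in>linkw (fst a). wbase (p @ [c]) a \<doteq> g @ x"
    then obtain x where x: "x \<in> linkw (fst a)" "wbase (p @ [c]) a \<doteq> g @ x" by blast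
    have "wbase p a \<doteq> wbase p a @ [c, linv c]"
      using cancel_pair[of c "wbase p a" "[]"] ac assms wordeq_sym by simp
    also have "wbase p a @ [c, linv c] \<doteq> wbase (p @ [c]) a @ [linv c]"
      using wordeq_context[OF e, of "[]" "[linv c]"] ac wordeq_sym by simp
    also have "wbase (p @ [c]) a @ [linv c] \<doteq> g @ x @ [linv c]"
      using wordeq_context[OF x(2), of "[]" "[linv c]"] ac by simp
    finally show "\<exists>x\<in>linkw (fst a). wbase p a \<doteq> g @ x"
      using x c by (intro bexI[of _ "x @ [linv c]"]) auto
  next
    assume "\<exists>x\<in>linkw (fst a). wbase p a \<doteq> g @ x"
    then obtain x where x: "x \<in> linkw (fst a)" "wbase p a \<doteq> g @ x" by blast
    note e
    also have "wbase p a @ [c] \<doteq> g @ x @ [c]"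
      using wordeq_context[OF x(2), of "[]" "[c]"] ac by simp
    finally show "\<exists>x\<in>linkw (fst a). wbase (p @ [c]) a \<doteq> g @ x"
      using x c by (intro bexI[of _ "x @ [c]"]) auto
  qed
qed

text \<open>A cancelling pair of letters crosses the same wall in opposite directions, and two commuting letters
  cross the same two walls in either order.\<close>

lemma crossing_invariant:
  assumes "u \<doteq> v" "p \<in> words"
  shows "crossing s g p u = crossing s g p v"
proof (rule wordeq_invariant[OF assms(1)])
  fix x y assume "(x, y) \<in> raag_step V E"
  then show "crossing s g p x = crossing s g p y"
  proof (cases rule: raag_stepE)
    case (cancel u a v)
    have w: "p @ u \<in> words" "a \<in> letters" using cancel assms by auto
    have 1: "crossing s g (p @ u @ [a, linv a]) v = crossing s g (p @ u) v"
      using crossing_base[of "p @ u @ [a, linv a]" "p @ u" v] cancel_pair[of a "p @ u" "[]"] cancel w by simp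
    have b: "wbase (p @ u) a \<doteq> wbase (p @ u @ [a]) (linv a)"
      using wordeq_sym[OF cancel_pair[of a "p @ u" "[]"]] w by (cases "snd a") (simp_all add: wbase_def linv_def)
    then have 2: "wbase (p @ u) a \<doteq> z \<longleftrightarrow> wbase (p @ u @ [a]) (linv a) \<doteq> z" for z
      using wordeq_sym wordeq_trans by blast
    show ?thesis
      using cancel 1 2 by (simp add: crossing_append) (simp add: linv_def)
  next
    case (swap u a b v)
    have w: "p @ u \<in> words" using swap assms by auto
    have 1: "crossing s g (p @ u @ [a, b]) v = crossing s g (p @ u @ [b, a]) v"
      using crossing_base[of "p @ u @ [a, b]" "p @ u @ [b, a]" v] step_wordeq[OF swap_step[of a b "p @ u" "[]"]] swap w
      by simp
    have ba: "comm b a" "fst a \<noteq> fst b" using swap comm_sym comm_neq by auto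
    have "crossing s g (p @ u) [a, b] = crossing s g (p @ u) [b, a]"
      using crossing_link[of a b "p @ u" g] crossing_link[of b a "p @ u" g] w swap ba
      by (cases "fst a = s"; cases "fst b = s") simp_all
    then show ?thesis
      using swap 1 crossing_append[of s g p "u @ [a, b]" v] crossing_append[of s g p "u @ [b, a]" v]
      by (simp add: crossing_append)
  qed
qed

lemma crossing_zeroI:
  assumes "\<And>q b r. w = q @ b # r \<Longrightarrow> fst b = s \<Longrightarrow> \<not> (\<exists>x\<in>linkw s. wbase (p @ q) b \<doteq> g @ x)"
  shows "crossing s g p w = 0"
  using assms
proof (induction w arbitrary: p)
  case (Cons a w)
  have "crossing s g (p @ [a]) w = 0"
    by (rule Cons.IH) (use Cons.prems[of "a # q" for q] in auto)
  then show ?case using Cons.prems[of "[]" a w] by auto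
qed simp

definition reduced :: "letter list \<Rightarrow> bool" where
  "reduced w \<longleftrightarrow> w \<in> words \<and> (\<forall>v. v \<doteq> w \<longrightarrow> length w \<le> length v)"

definition distinct_walls :: "letter list \<Rightarrow> bool" where
  "distinct_walls w \<longleftrightarrow> (\<forall>p a v b q. w = p @ a # v @ b # q \<longrightarrow> \<not> same_wall p a (p @ a # v) b)"

lemma nth_split: "i < length w \<Longrightarrow> w = take i w @ w ! i # drop (Suc i) w"
  by (simp add: id_take_nth_drop)

lemma nth_split2:
  assumes "i < j" "j < length w"
  shows "w = take i w @ w ! i # (drop (Suc i) (take j w)) @ w ! j # drop (Suc j) w"
    "take j w = take i w @ w ! i # drop (Suc i) (take j w)"
proof -
  show *: "take j w = take i w @ w ! i # drop (Suc i) (take j w)"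
    using nth_split[of i "take j w"] assms by (simp add: min_def)
  show "w = take i w @ w ! i # (drop (Suc i) (take j w)) @ w ! j # drop (Suc j) w"
    using nth_split[OF assms(2)] * by (metis append_Cons append_assoc)
qed

text \<open>The word \<open>w\<close> crosses this wall exactly once, hence algebraically \<open>\<plusminus>1\<close> times. The algebraic count is the
  same for \<open>w'\<close>, so \<open>w'\<close> has to cross the wall, too.\<close>

lemma wall_crossed:
  assumes "distinct_walls w" "w \<doteq> w'" "w \<in> words" "w = p @ a # q"
  shows "\<exists>p' b q'. w' = p' @ b # q' \<and> same_wall p a p' b"
proof (rule ccontr)
  assume none: "\<not> ?thesis"
  define s where "s = fst a"
  define g where "g = wbase p a"
  have pw: "p \<in> words" "a \<in> letters" "q \<in> words" using assms by auto
  have sw: "(\<exists>x\<in>linkw s. wbase r b \<doteq> g @ x) \<longleftrightarrow> same_wall p a r b" if "fst b = s" for r b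
    using that by (auto simp: same_wall_def s_def g_def)
  have 0: "crossing s g [] w' = 0"
    by (rule crossing_zeroI) (use none sw in auto)
  have 1: "crossing s g [] p = 0"
  proof (rule crossing_zeroI)
    fix r b t assume s: "p = r @ b # t" "fst b = s"
    show "\<not> (\<exists>x\<in>linkw s. wbase ([] @ r) b \<doteq> g @ x)"
    proof
      assume "\<exists>x\<in>linkw s. wbase ([] @ r) b \<doteq> g @ x"
      then have "same_wall p a r b" using sw[OF s(2), of r] by simp
      then have "same_wall r b p a" using same_wall_sym pw by blast
      moreover have "\<not> same_wall r b (r @ b # t) a"
        using assms(1)[unfolded distinct_walls_def, rule_format, of r b t a q] assms(4) s(1) by simp
      ultimately show False using s by simp
    qed
  qed
  have 2: "crossing s g (p @ [a]) q = 0"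
  proof (rule crossing_zeroI)
    fix r b t assume s: "q = r @ b # t" "fst b = s"
    show "\<not> (\<exists>x\<in>linkw s. wbase ((p @ [a]) @ r) b \<doteq> g @ x)"
    proof
      assume "\<exists>x\<in>linkw s. wbase ((p @ [a]) @ r) b \<doteq> g @ x"
      then have "same_wall p a (p @ a # r) b" using sw[OF s(2), of "p @ a # r"] by simp
      then show False using assms(1,4) s(1) unfolding distinct_walls_def by blast
    qed
  qed
  have "\<exists>x\<in>linkw s. wbase p a \<doteq> g @ x"
    by (intro bexI[of _ "[]"]) (auto simp: g_def)
  then have "crossing s g [] w \<noteq> 0"
    using assms(4) 1 2 by (simp add: crossing_append s_def)
  then show False using 0 crossing_invariant[OF assms(2), of "[]" s g] by simp
qed

text \<open>Every word for the same element crosses all walls of \<open>w\<close>, one letter crossing one wall only.\<close>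

lemma distinct_walls_reduced:
  assumes "distinct_walls w" "w \<in> words"
  shows "reduced w"
  unfolding reduced_def
proof (intro conjI allI impI)
  fix w' assume "w' \<doteq> w"
  then have e: "w \<doteq> w'" by (rule wordeq_sym)
  have w': "w' \<in> words" using wordeq_words[OF e] assms by simp
  have "\<exists>j<length w'. same_wall (take i w) (w ! i) (take j w') (w' ! j)" if i: "i < length w" for i
  proof -
    obtain p' b q' where "w' = p' @ b # q'" "same_wall (take i w) (w ! i) p' b"
      using wall_crossed[OF assms(1) e assms(2), of "take i w" "w ! i" "drop (Suc i) w"] nth_split[OF i]
      by auto
    then show ?thesis by (intro exI[of _ "length p'"]) auto
  qed
  then obtain J where J: "\<And>i. i < length w \<Longrightarrow> J i < length w' \<and> same_wall (take i w) (w ! i) (take (J i) w') (w' ! J i)"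
    by metis
  have wi: "take i w \<in> words" "w ! i \<in> letters" if "i < length w" for i
    using assms that by (auto simp: in_lists_conv_set dest: in_set_takeD nth_mem)
  have wi': "take i w' \<in> words" "w' ! i \<in> letters" if "i < length w'" for i
    using w' that by (auto simp: in_lists_conv_set dest: in_set_takeD nth_mem)
  have ne: "J i \<noteq> J j" if "i < j" "j < length w" for i j
  proof
    assume "J i = J j"
    then have "same_wall (take (J i) w') (w' ! J i) (take j w) (w ! j)"
      using J[of j] same_wall_sym wi[of j] that by auto
    then have "same_wall (take i w) (w ! i) (take j w) (w ! j)"
      using same_wall_trans[of "take i w" "w ! i" "take (J i) w'" "w' ! J i"] J[of i] wi[of i] that by simp
    then show False using assms(1) nth_split2[OF that] unfolding distinct_walls_def by metis
  qed
  have "inj_on J {..<length w}"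
    by (rule inj_onI) (metis ne lessThan_iff linorder_neqE_nat)
  then have "card {..<length w} \<le> card {..<length w'}"
    by (rule card_inj_on_le) (use J in auto)
  then show "length w \<le> length w'" by simp
qed (use assms in simp)

lemma reduced_words: "reduced w \<Longrightarrow> w \<in> words"
  by (simp add: reduced_def)

lemma reduced_infix:
  assumes "reduced (p @ w @ q)"
  shows "reduced w"
  unfolding reduced_def
proof (intro conjI allI impI)
  have pq: "p \<in> words" "w \<in> words" "q \<in> words" using reduced_words[OF assms] by auto
  then show "w \<in> words" by simp
  fix v assume "v \<doteq> w"
  then have "p @ v @ q \<doteq> p @ w @ q" using wordeq_context pq by blast
  then show "length w \<le> length v" using assms by (auto simp: reduced_def)
qed

lemma reduced_length: "reduced v \<Longrightarrow> u \<doteq> v \<Longrightarrow> length v \<le> length u"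
  by (simp add: reduced_def)

lemma reduced_wordeq: "reduced w \<Longrightarrow> w \<doteq> v \<Longrightarrow> length v = length w \<Longrightarrow> reduced v"
  unfolding reduced_def by (metis wordeq_sym wordeq_trans wordeq_words)

lemma reduced_exists: "w \<in> words \<Longrightarrow> \<exists>v. v \<doteq> w \<and> reduced v"
proof -
  assume w: "w \<in> words"
  obtain v where v: "v \<doteq> w" "\<And>u. u \<doteq> w \<Longrightarrow> length v \<le> length u"
    using ex_has_least_nat[of "\<lambda>v. v \<doteq> w" w length] by auto
  then have "reduced v"
    unfolding reduced_def using w wordeq_words[OF v(1)] wordeq_trans[OF _ v(1)] by simp
  then show ?thesis using v by blast
qed

text \<open>Otherwise the retraction onto the link would shorten \<open>v\<close>.\<close>

lemma reduced_in_link: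
  assumes "reduced v" "x \<in> linkw s" "v \<doteq> x"
  shows "v \<in> linkw s"
proof -
  define T where "T = {t. {s, t} \<in> E}"
  have "filter (\<lambda>a. fst a \<in> T) x = x" using assms(2) by (simp add: linkw_def T_def filter_id_conv)
  then have "filter (\<lambda>a. fst a \<in> T) v \<doteq> x" using wordeq_filter[OF assms(3), of T] by simp
  then have "filter (\<lambda>a. fst a \<in> T) v \<doteq> v" using wordeq_trans wordeq_sym[OF assms(3)] by blast
  then have "length v \<le> length (filter (\<lambda>a. fst a \<in> T) v)" using assms(1) by (auto simp: reduced_def)
  moreover have "length (filter (\<lambda>a. fst a \<in> T) v) \<le> length v" by simp
  ultimately have "filter (\<lambda>a. fst a \<in> T) v = v"
    by (metis filter_id_conv length_filter_less linorder_not_le)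
  then show ?thesis by (auto simp: linkw_def T_def filter_id_conv)
qed

lemma link_commutes: "x \<in> linkw (fst a) \<Longrightarrow> a \<in> letters \<Longrightarrow> a # x \<doteq> x @ [a]"
  using commute_past linkw_iff by blast

lemma bookends_cancel:
  assumes "a \<in> letters" "v \<in> linkw (fst a)"
  shows "a # v @ [linv a] \<doteq> v"
proof -
  have v: "v \<in> words" using assms linkw_words by blast
  have "a # v @ [linv a] \<doteq> v @ [a, linv a]"
    using wordeq_context[OF link_commutes[OF assms(2,1)], of "[]" "[linv a]"] assms by simp
  also have "v @ [a, linv a] \<doteq> v" using cancel_pair[of a v "[]"] assms v by simp
  finally show ?thesis .
qed

text \<open>
  If \<open>a\<close> and \<open>b\<close> cross the same wall, then the part of \<open>a v b\<close> between their bases represents an element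
  \<open>x\<close> of the link of \<open>a\<close>. If \<open>b = a\<close>, this makes the shortest word \<open>a v\<close> equal to \<open>x\<close>, which is absurd
  as \<open>a\<close> is not in its own link. So \<open>b\<close> is the inverse of \<open>a\<close>, and \<open>v\<close> itself represents \<open>x\<close>.\<close>

lemma same_wall_bookends:
  assumes sw: "same_wall p a (p @ a # v) b" and w: "p \<in> words" "b \<in> letters" and r: "reduced (a # v)"
  shows "b = linv a \<and> v \<in> linkw (fst a)"
proof -
  have av: "a \<in> letters" "v \<in> words" using reduced_words[OF r] by auto
  have fab: "fst a = fst b" using sw by (simp add: same_wall_def)
  have rv: "reduced v" using reduced_infix[of "[a]" v "[]"] r by simp
  obtain x where x: "x \<in> linkw (fst a)" "wbase (p @ a # v) b \<doteq> wbase p a @ x"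
    using sw by (auto simp: same_wall_def)
  have xw: "x \<in> words" using x linkw_words by blast
  have contra: False if "a # v \<doteq> x"
    using reduced_in_link[OF r x(1) that] linkw_self by simp
  show ?thesis
  proof (cases "b = a")
    case True
    have "a # v \<doteq> x"
    proof (cases "snd a")
      case t: True
      then show ?thesis using cancel_left[of p "a # v" x] x True w av by (simp add: wbase_def)
    next
      case False
      then have "p @ (a # v @ [a]) \<doteq> p @ (a # x)" using x True by (simp add: wbase_def)
      then have "a # v @ [a] \<doteq> a # x" using cancel_left w av by auto
      then have "(a # v) @ [a] \<doteq> x @ [a]" using link_commutes[OF x(1)] av wordeq_trans by simp
      then show ?thesis using cancel_right[of "a # v" "[a]" x] av xw by simp
    qed
    then show ?thesis using contra by blast
  next
    case False
    then have b: "b = linv a" using same_generator[of b a] fab by auto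
    have "v \<doteq> x"
    proof (cases "snd a")
      case t: True
      then have "p @ (a # v @ [linv a]) \<doteq> p @ x" using x b by (simp add: wbase_def linv_def)
      then have 1: "a # v @ [linv a] \<doteq> x" using cancel_left[of p "a # v @ [linv a]" x] w av by simp
      have "a # x @ [linv a] \<doteq> x" using bookends_cancel[OF av(1) x(1)] .
      then have "a # v @ [linv a] \<doteq> a # x @ [linv a]" using 1 wordeq_trans wordeq_sym by blast
      then have "v @ [linv a] \<doteq> x @ [linv a]"
        using cancel_left[of "[a]" "v @ [linv a]" "x @ [linv a]"] av by simp
      then show ?thesis using cancel_right[of v "[linv a]" x] av xw by simp
    next
      case f: False
      then have "(p @ [a]) @ v \<doteq> (p @ [a]) @ x" using x b by (simp add: wbase_def linv_def)
      then show ?thesis using cancel_left[of "p @ [a]" v x] w av by simp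
    qed
    then show ?thesis using reduced_in_link[OF rv x(1)] b by blast
  qed
qed

lemma reduced_distinct_walls:
  assumes "reduced w"
  shows "distinct_walls w"
  unfolding distinct_walls_def
proof (intro allI impI notI)
  fix p a v b q assume w: "w = p @ a # v @ b # q" and sw: "same_wall p a (p @ a # v) b"
  have r: "reduced (a # v)" "reduced (a # v @ [b])"
    using reduced_infix[of p "a # v" "b # q"] reduced_infix[of p "a # v @ [b]" q] assms w by simp_all
  have ww: "p \<in> words" "a \<in> letters" "b \<in> letters" using reduced_words[OF assms] w by auto
  have "b = linv a" "v \<in> linkw (fst a)" using same_wall_bookends[OF sw ww(1,3) r(1)] by auto
  then have "v \<doteq> a # v @ [b]" using bookends_cancel[OF ww(2)] wordeq_sym by simp
  then show False using r(2) by (auto simp: reduced_def)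
qed

text \<open>
  A word stops being shortest at the first letter that crosses a wall for the second time, and then the
  two letters crossing it cancel, after commuting one of them past the letters in between.\<close>

lemma deletion:
  assumes "w \<in> words" "\<not> reduced w"
  obtains p a v q where "w = p @ a # v @ linv a # q" "v \<in> linkw (fst a)" "reduced (p @ a # v)"
proof -
  have "\<exists>p a v q. w = p @ a # v @ linv a # q \<and> v \<in> linkw (fst a) \<and> reduced (p @ a # v)"
    using assms
  proof (induction w rule: rev_induct)
    case Nil
    then show ?case by (simp add: reduced_def)
  next
    case (snoc b u)
    show ?case
    proof (cases "reduced u")
      case False
      then obtain p a v q where "u = p @ a # v @ linv a # q" "v \<in> linkw (fst a)" "reduced (p @ a # v)"
        using snoc by auto
      then show ?thesis by (intro exI[of _ p] exI[of _ a] exI[of _ v] exI[of _ "q @ [b]"]) simp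
    next
      case True
      have "\<not> distinct_walls (u @ [b])" using snoc.prems distinct_walls_reduced by blast
      then obtain p a v c q where d: "u @ [b] = p @ a # v @ c # q" and sw: "same_wall p a (p @ a # v) c"
        by (auto simp: distinct_walls_def)
      have "q = []"
      proof (rule ccontr)
        assume "q \<noteq> []"
        then obtain q' where "q = q' @ [b]" using d by (metis append_Cons append_assoc last_appendR last_snoc append_butlast_last_id list.discI)
        then have "u = p @ a # v @ c # q'" using d by simp
        then show False using reduced_distinct_walls[OF True] sw unfolding distinct_walls_def by blast
      qed
      then have u: "u = p @ a # v" "c = b" using d by (auto simp: append_eq_append_conv2 Cons_eq_append_conv)
      have "reduced (a # v)" using reduced_infix[of p "a # v" "[]"] True u by simp
      then have "b = linv a \<and> v \<in> linkw (fst a)"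
        using same_wall_bookends[of p a v b] sw u snoc.prems by auto
      then show ?thesis using u True by (intro exI[of _ p] exI[of _ a] exI[of _ v] exI[of _ "[]"]) simp
    qed
  qed
  then show ?thesis using that by blast
qed

lemma reduced_pair: "comm p q \<Longrightarrow> reduced [p, q]"
proof (rule ccontr)
  assume c: "comm p q" and "\<not> reduced [p, q]"
  moreover have "[p, q] \<in> words" using comm_letters[OF c] by simp
  ultimately obtain x a v y where d: "[p, q] = x @ a # v @ linv a # y" using deletion by metis
  have "length (x @ a # v @ linv a # y) = 2" unfolding d[symmetric] by simp
  then have "x = []" "v = []" "y = []" by simp_all
  then show False using d comm_neq[OF c] by simp
qed

section \<open>Normal forms\<close>

text \<open>The word \<open>u\<close> blocks \<open>b\<close> if \<open>b\<close>, appended to \<open>u\<close>, can be moved to the left until it cancels or until it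
  has passed a larger letter. Letters are compared by their generators only, since commuting letters
  have different generators.\<close>

definition blocks :: "letter list \<Rightarrow> letter \<Rightarrow> bool" where
  "blocks u b \<longleftrightarrow> (\<exists>p a v. u = p @ a # v \<and> (\<forall>c\<in>set v. comm b c) \<and> (a = linv b \<or> (comm b a \<and> fst b < fst a)))"

definition normal_word :: "letter list \<Rightarrow> bool" where
  "normal_word w \<longleftrightarrow> w \<in> words \<and> (\<forall>u b q. w = u @ b # q \<longrightarrow> \<not> blocks u b)"

text \<open>The set of letters blocked by a word is updated letter by letter, without knowledge of the word.
  For this reason the normal words form a regular language.\<close>

lemma blocks_snoc:
  "blocks (u @ [a]) b \<longleftrightarrow> a = linv b \<or> (comm b a \<and> (fst b < fst a \<or> blocks u b))"
proof
  assume "blocks (u @ [a]) b"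
  then obtain p d v where d: "u @ [a] = p @ d # v" "\<forall>c\<in>set v. comm b c" "d = linv b \<or> (comm b d \<and> fst b < fst d)"
    by (auto simp: blocks_def)
  show "a = linv b \<or> (comm b a \<and> (fst b < fst a \<or> blocks u b))"
  proof (cases v rule: rev_cases)
    case Nil
    then show ?thesis using d by auto
  next
    case (snoc v' c)
    then have "u = p @ d # v'" "c = a" using d(1) by auto
    then have "comm b a" "\<forall>c\<in>set v'. comm b c" "u = p @ d # v'" using d snoc by auto
    then show ?thesis using d(3) unfolding blocks_def by blast
  qed
next
  assume "a = linv b \<or> (comm b a \<and> (fst b < fst a \<or> blocks u b))"
  then consider "a = linv b \<or> comm b a \<and> fst b < fst a" | "comm b a" "blocks u b" by blast
  then show "blocks (u @ [a]) b"
  proof cases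
    case 1
    then show ?thesis unfolding blocks_def by (intro exI[of _ u] exI[of _ a] exI[of _ "[]"]) simp
  next
    case 2
    then obtain p d v where "u = p @ d # v" "\<forall>c\<in>set v. comm b c" "d = linv b \<or> (comm b d \<and> fst b < fst d)"
      by (auto simp: blocks_def)
    then show ?thesis unfolding blocks_def using 2
      by (intro exI[of _ p] exI[of _ d] exI[of _ "v @ [a]"]) auto
  qed
qed

lemma not_blocks_Nil [simp]: "\<not> blocks [] b"
  by (simp add: blocks_def)

lemma normal_word_Nil [simp]: "normal_word []"
  by (simp add: normal_word_def)

lemma normal_word_snoc: "normal_word (u @ [b]) \<longleftrightarrow> normal_word u \<and> b \<in> letters \<and> \<not> blocks u b"
proof
  assume n: "normal_word (u @ [b])"
  have "\<not> blocks p c" if "u = p @ c # q" for p c q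
    using n that unfolding normal_word_def by auto
  then show "normal_word u \<and> b \<in> letters \<and> \<not> blocks u b"
    using n unfolding normal_word_def by auto
next
  assume n: "normal_word u \<and> b \<in> letters \<and> \<not> blocks u b"
  have "\<not> blocks p c" if "u @ [b] = p @ c # q" for p c q
  proof (cases q rule: rev_cases)
    case Nil
    then show ?thesis using that n by auto
  next
    case (snoc q' d)
    then have "u = p @ c # q'" using that by auto
    then show ?thesis using n unfolding normal_word_def by blast
  qed
  then show "normal_word (u @ [b])" using n unfolding normal_word_def by auto
qed

lemma normal_word_reduced:
  assumes "normal_word w"
  shows "reduced w"
proof (rule ccontr)
  assume "\<not> reduced w"
  moreover have "w \<in> words" using assms by (simp add: normal_word_def)
  ultimately obtain p a v q where d: "w = p @ a # v @ linv a # q" "v \<in> linkw (fst a)"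
    using deletion[of w] by metis
  have "blocks (p @ a # v) (linv a)"
    unfolding blocks_def using d(2) linkw_iff by (intro exI[of _ p] exI[of _ a] exI[of _ v]) auto
  moreover have "w = (p @ a # v) @ linv a # q" using d(1) by simp
  ultimately show False using assms unfolding normal_word_def by blast
qed

lemma normal_word_tail: "normal_word (b # w) \<Longrightarrow> normal_word w"
  unfolding normal_word_def blocks_def by simp (metis append_Cons)

text \<open>Among the shortest words for an element, one with the lexicographically least sequence of generators
  is normal: a blocked letter could be moved to the left.\<close>

lemma normal_word_exists:
  assumes "w \<in> words"
  shows "\<exists>v. v \<doteq> w \<and> normal_word v"
proof -
  define R where "R = {v. v \<doteq> w \<and> reduced v}"
  define gens where "gens = map fst ` R"
  obtain v0 where "v0 \<in> R" using reduced_exists[OF assms] by (auto simp: R_def)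
  then have "map fst v0 \<in> gens" by (auto simp: gens_def)
  then obtain z where z: "z \<in> gens" "\<And>y. (y, z) \<in> lenlex less_than \<Longrightarrow> y \<notin> gens"
    using wfE_min[OF wf_lenlex[OF wf_less_than]] by metis
  then obtain v where v: "v \<doteq> w" "reduced v" "z = map fst v" by (auto simp: gens_def R_def)
  have "normal_word v"
    unfolding normal_word_def
  proof (intro conjI allI impI notI)
    show vw: "v \<in> words" using v reduced_words by blast
    fix u b q assume vq: "v = u @ b # q" and "blocks u b"
    then obtain p a m where d: "u = p @ a # m" "\<forall>c\<in>set m. comm b c" "a = linv b \<or> (comm b a \<and> fst b < fst a)"
      by (auto simp: blocks_def)
    have ws: "p \<in> words" "a \<in> letters" "m \<in> words" "b \<in> letters" "q \<in> words" using vw vq d(1) by auto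
    show False
    proof (cases "a = linv b")
      case True
      then have "m \<in> linkw (fst a)" using d(2) linkw_iff[of m b] by simp
      then have "m \<doteq> a # m @ [b]" using bookends_cancel[of a m] True ws wordeq_sym by simp
      moreover have "reduced (a # m @ [b])" using reduced_infix[of p "a # m @ [b]" q] v vq d(1) by simp
      ultimately show False by (auto simp: reduced_def)
    next
      case False
      then have ab: "comm b a" "fst b < fst a" using d(3) by auto
      \<comment> \<open>moving \<open>b\<close> in front of \<open>a\<close> gives a smaller word of the same length\<close>
      have "b # a # m \<doteq> (a # m) @ [b]" using commute_past[of "a # m" b] ab d(2) ws by simp
      then have "p @ (b # a # m) @ q \<doteq> p @ ((a # m) @ [b]) @ q" using wordeq_context ws by blast
      then have e: "p @ (b # a # m) @ q \<doteq> v" using vq d by simp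
      have "reduced (p @ (b # a # m) @ q)"
        using reduced_wordeq[OF v(2) wordeq_sym[OF e]] vq d by simp
      then have "p @ (b # a # m) @ q \<in> R" using wordeq_trans[OF e v(1)] by (simp add: R_def)
      then have "map fst (p @ (b # a # m) @ q) \<in> gens" unfolding gens_def by (rule imageI)
      moreover have "(map fst (p @ (b # a # m) @ q), z) \<in> lenlex less_than"
        unfolding v(3) vq d(1) using ab(2) by (auto simp: lenlex_conv lex_conv intro!: exI[of _ "map fst p"])
      ultimately show False using z(2) by blast
    qed
  qed
  then show ?thesis using v by blast
qed

text \<open>Suppose \<open>b \<noteq> b'\<close>. As the inverse of \<open>b\<close> shortens \<open>b' w'\<close>, deletion finds \<open>b\<close> inside \<open>b' w'\<close>, after letters
  that commute with it; the first of these is the larger letter \<open>b'\<close>, so \<open>b\<close> was blocked.\<close>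

lemma normal_word_head:
  assumes "normal_word (b # w)" "normal_word (b' # w')" "b # w \<doteq> b' # w'" "fst b \<le> fst b'"
  shows "b = b'"
proof (rule ccontr)
  assume ne: "b \<noteq> b'"
  have r: "reduced (b # w)" "reduced (b' # w')" using assms normal_word_reduced by auto
  have ws: "b \<in> letters" "w \<in> words" "b' \<in> letters" "w' \<in> words"
    using reduced_words[OF r(1)] reduced_words[OF r(2)] by auto
  have len: "length w = length w'"
    using r assms(3) wordeq_sym[OF assms(3)] unfolding reduced_def by force
  have "[linv b] @ b # w \<doteq> [linv b] @ b' # w'"
    using wordeq_context[OF assms(3), of "[linv b]" "[]"] ws by simp
  then have "linv b # b' # w' \<doteq> linv b # b # w" using wordeq_sym by simp
  also have "linv b # b # w \<doteq> w" using cancel_pair'[of b "[]" w] ws by simp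
  finally have e: "linv b # b' # w' \<doteq> w" .
  have "\<not> reduced (linv b # b' # w')"
    using wordeq_sym[OF e] len by (auto simp: reduced_def)
  moreover have "linv b # b' # w' \<in> words" using ws by simp
  ultimately obtain p a v q where d: "linv b # b' # w' = p @ a # v @ linv a # q" "v \<in> linkw (fst a)"
    using deletion[of "linv b # b' # w'"] by metis
  have "p = []"
  proof (rule ccontr)
    assume "p \<noteq> []"
    then obtain p' where p': "b' # w' = p' @ a # v @ linv a # q" using d(1) by (cases p) auto
    have "blocks (p' @ a # v) (linv a)"
      unfolding blocks_def using d(2) linkw_iff by (intro exI[of _ p'] exI[of _ a] exI[of _ v]) auto
    moreover have "b' # w' = (p' @ a # v) @ linv a # q" using p' by simp
    ultimately show False using assms(2) unfolding normal_word_def by blast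
  qed
  then have d': "a = linv b" "b' # w' = v @ b # q" using d(1) by auto
  then obtain v' where v': "v = b' # v'" using ne by (cases v) auto
  have cm: "\<forall>c\<in>set v. comm b c" using d(2) d'(1) linkw_iff[of v b] by simp
  then have "comm b b'" using v' by simp
  then have "fst b < fst b'" using assms(4) comm_neq[of b b'] by simp
  then have "blocks v b"
    unfolding blocks_def using v' cm by (intro exI[of _ "[]"] exI[of _ b'] exI[of _ v']) auto
  then show False using assms(2) d'(2) unfolding normal_word_def by blast
qed

lemma normal_word_unique:
  assumes "normal_word w" "normal_word w'" "w \<doteq> w'"
  shows "w = w'"
  using assms
proof (induction w arbitrary: w')
  case Nil
  then have "reduced w'" using normal_word_reduced by blast
  then have "length w' \<le> 0" using Nil(3) unfolding reduced_def by force
  then show ?case by simp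
next
  case (Cons b w)
  have r: "reduced (b # w)" "reduced w'" using Cons normal_word_reduced by auto
  have "length w' = length (b # w)"
    using r Cons.prems(3) wordeq_sym[OF Cons.prems(3)] unfolding reduced_def by force
  then obtain b' v where w': "w' = b' # v" by (cases w') auto
  have bb: "b = b'"
  proof (cases "fst b \<le> fst b'")
    case True
    then show ?thesis using normal_word_head Cons.prems w' by blast
  next
    case False
    then have "b' = b" using normal_word_head[of b' v b w] Cons.prems w' wordeq_sym by auto
    then show ?thesis by simp
  qed
  have "w \<doteq> v" using cancel_left[of "[b]" w v] Cons.prems(3) w' bb reduced_words[OF r(1)] by simp
  then show ?case using Cons.IH[of v] Cons.prems normal_word_tail w' bb by blast
qed

end

section \<open>The universal cover of the Salvetti complex\<close>

context raag_graph
begin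

abbreviation G where "G \<equiv> raag V E"
abbreviation S where "S \<equiv> salvetti_cover V E"

definition cl :: "letter list \<Rightarrow> letter list set" where
  "cl w = raag_eq V E `` {w}"

text \<open>The vertex reached from \<open>p\<close> by reading \<open>w\<close>. Left translations commute with it.\<close>

definition act :: "letter list set \<Rightarrow> letter list \<Rightarrow> letter list set" where
  "act p w = p \<otimes>\<^bsub>G\<^esub> cl w"

lemma cl_eq_iff [simp]: "cl u = cl v \<longleftrightarrow> u \<doteq> v"
proof
  assume "cl u = cl v"
  moreover have "v \<in> cl v" by (simp add: cl_def)
  ultimately have "v \<in> cl u" by blast
  then show "u \<doteq> v" by (simp add: cl_def)
next
  assume e: "u \<doteq> v"
  show "cl u = cl v"
    unfolding cl_def using wordeq_trans[OF e] wordeq_trans[OF wordeq_sym[OF e]] by auto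
qed

lemma carrier_raag: "carrier G = cl ` words"
  by (auto simp: raag_def quotient_def cl_def raag_words_eq)

lemma carrierE: assumes "p \<in> carrier G" obtains u where "u \<in> words" "p = cl u"
  using assms by (auto simp: carrier_raag)

lemma cl_carrier [simp]: "u \<in> words \<Longrightarrow> cl u \<in> carrier G"
  unfolding carrier_raag by (rule imageI)

lemma mult_cl:
  assumes "u \<in> words" "v \<in> words"
  shows "cl u \<otimes>\<^bsub>G\<^esub> cl v = cl (u @ v)"
proof -
  have "raag_eq V E `` {u' @ v'} = cl (u @ v)" if "u \<doteq> u'" "v \<doteq> v'" for u' v'
    using wordeq_append[OF that assms] cl_eq_iff[of "u' @ v'" "u @ v"] wordeq_sym by (simp add: cl_def)
  moreover have "u \<in> cl u" "v \<in> cl v" by (auto simp: cl_def)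
  ultimately have "(\<Union>u'\<in>cl u. \<Union>v'\<in>cl v. raag_eq V E `` {u' @ v'}) = cl (u @ v)"
    unfolding cl_def by blast
  then show ?thesis by (simp add: raag_def)
qed

lemma act_cl: "u \<in> words \<Longrightarrow> w \<in> words \<Longrightarrow> act (cl u) w = cl (u @ w)"
  by (simp add: act_def mult_cl)

lemma act_closed [simp]: "p \<in> carrier G \<Longrightarrow> w \<in> words \<Longrightarrow> act p w \<in> carrier G"
  by (elim carrierE) (simp add: act_cl)

lemma act_append: "p \<in> carrier G \<Longrightarrow> u \<in> words \<Longrightarrow> v \<in> words \<Longrightarrow> act p (u @ v) = act (act p u) v"
  by (elim carrierE) (simp add: act_cl)

lemma act_Nil [simp]: "p \<in> carrier G \<Longrightarrow> act p [] = p"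
  by (elim carrierE) (simp add: act_cl)

lemma act_eq_iff:
  assumes "p \<in> carrier G" "u \<in> words" "v \<in> words"
  shows "act p u = act p v \<longleftrightarrow> u \<doteq> v"
  using assms wordeq_context[of u v _ "[]"] cancel_left[of _ u v]
  by (elim carrierE) (auto simp: act_cl)

lemma act_transitive:
  assumes "p \<in> carrier G" "q \<in> carrier G"
  shows "\<exists>w\<in>words. q = act p w"
proof -
  obtain u v where uv: "u \<in> words" "p = cl u" "v \<in> words" "q = cl v" using assms by (auto elim!: carrierE)
  have "u @ winv u @ v \<doteq> [] @ v"
    using wordeq_context[OF winv_right[OF uv(1)], of "[]" v] uv by simp
  then have "q = act p (winv u @ v)" using uv wordeq_sym by (simp add: act_cl)
  then show ?thesis using uv by (intro bexI[of _ "winv u @ v"]) auto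
qed

lemma mult_act:
  "g \<in> carrier G \<Longrightarrow> p \<in> carrier G \<Longrightarrow> w \<in> words \<Longrightarrow> g \<otimes>\<^bsub>G\<^esub> act p w = act (g \<otimes>\<^bsub>G\<^esub> p) w"
  by (elim carrierE) (simp add: act_cl mult_cl)

abbreviation step :: "letter list set \<Rightarrow> letter \<Rightarrow> letter list set" (infixl "\<cdot>" 75)
  where "p \<cdot> a \<equiv> act p [a]"

lemma act_Cons: "p \<in> carrier G \<Longrightarrow> a \<in> letters \<Longrightarrow> w \<in> words \<Longrightarrow> act p (a # w) = act (p \<cdot> a) w"
  using act_append[of p "[a]" w] by simp

lemma act_snoc: "p \<in> carrier G \<Longrightarrow> a \<in> letters \<Longrightarrow> w \<in> words \<Longrightarrow> act p (w @ [a]) = act p w \<cdot> a"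
  using act_append[of p w "[a]"] by simp

lemma step_linv: "p \<in> carrier G \<Longrightarrow> a \<in> letters \<Longrightarrow> p \<cdot> a \<cdot> linv a = p"
  using cancel_pair[of a "[]" "[]"] act_eq_iff[of p "[a, linv a]" "[]"] act_Cons[of p a "[linv a]"] by simp

lemma step_comm: "p \<in> carrier G \<Longrightarrow> comm a b \<Longrightarrow> p \<cdot> a \<cdot> b = p \<cdot> b \<cdot> a"
  using step_wordeq[OF swap_step[of a b "[]" "[]"]] act_eq_iff[of p "[a, b]" "[b, a]"]
    act_Cons[of p a "[b]"] act_Cons[of p b "[a]"] comm_letters by simp

lemma act_expo:
  assumes "act p u = act p v" "p \<in> carrier G" "u \<in> words" "v \<in> words"
  shows "expo s u = expo s v"
  using assms act_eq_iff wordeq_expo by blast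

text \<open>Exponent sums of generators distinguish all the vertices of a cube. They will be used to recognize
  edges and squares by their numbers of vertices.\<close>

lemma step_inj:
  assumes "p \<cdot> a = p \<cdot> b" "p \<in> carrier G" "a \<in> letters" "b \<in> letters"
  shows "a = b"
proof -
  have "expo (fst a) [a] = expo (fst a) [b]" using act_expo[OF assms(1,2), of "fst a"] assms(3,4) by simp
  then have "fst a = fst b \<and> snd a = snd b" by (simp split: if_splits)
  then show ?thesis by (simp add: prod_eq_iff)
qed

lemma step_neq: "p \<in> carrier G \<Longrightarrow> a \<in> letters \<Longrightarrow> p \<cdot> a \<noteq> p"
  using act_expo[of p "[a]" "[]" "fst a"] by (auto split: if_splits)

lemma step_step_neq:
  assumes "p \<in> carrier G" "a \<in> letters" "b \<in> letters" "c \<in> letters" "fst a \<noteq> fst b"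
  shows "p \<cdot> a \<cdot> b \<noteq> p \<cdot> c" "p \<cdot> a \<cdot> b \<noteq> p"
  using act_expo[of p "[a, b]" "[c]" "fst a"] act_expo[of p "[a, b]" "[c]" "fst b"]
    act_expo[of p "[a, b]" "[]" "fst a"] act_Cons[of p a "[b]"] assms
  by (auto split: if_splits)

definition pos :: "nat list \<Rightarrow> letter list" where
  "pos ss = map (\<lambda>s. (s, True)) ss"

text \<open>The cube spanned by the vertex \<open>x\<close> and the clique \<open>K\<close>.\<close>

definition cube :: "letter list set \<Rightarrow> nat set \<Rightarrow> letter list set set" where
  "cube x K = {act x (pos ss) | ss. distinct ss \<and> set ss \<subseteq> K}"

lemma salvetti_cover_cubes:
  "S = {cube x K | x K. x \<in> carrier G \<and> finite K \<and> K \<subseteq> V \<and> (\<forall>s\<in>K. \<forall>t\<in>K. s \<noteq> t \<longrightarrow> {s, t} \<in> E)}"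
  unfolding salvetti_cover_def cube_def act_def cl_def pos_def ..

lemma distinct_lists_le_two:
  assumes "distinct ss" "set ss \<subseteq> {s, t}"
  shows "ss \<in> {[], [s], [t], [s, t], [t, s]}"
proof (cases ss)
  case 1: (Cons a l)
  show ?thesis
  proof (cases l)
    case 2: (Cons b l')
    show ?thesis using assms 1 2 by (cases l') auto
  qed (use assms 1 in auto)
qed simp

lemma cube_empty: "x \<in> carrier G \<Longrightarrow> cube x {} = {x}"
  by (auto simp: cube_def pos_def)

lemma cube_single: "x \<in> carrier G \<Longrightarrow> cube x {s} = {x, x \<cdot> (s, True)}"
proof -
  assume x: "x \<in> carrier G"
  have "distinct ss \<and> set ss \<subseteq> {s} \<longleftrightarrow> ss \<in> {[], [s]}" for ss
    using distinct_lists_le_two[of ss s s] by auto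
  then have "cube x {s} = (\<lambda>ss. act x (pos ss)) ` {[], [s]}"
    unfolding cube_def by blast
  then show ?thesis using x by (simp add: pos_def)
qed

lemma cube_pair:
  assumes x: "x \<in> carrier G" and st: "{s, t} \<in> E"
  shows "cube x {s, t} = {x, x \<cdot> (s, True), x \<cdot> (t, True), x \<cdot> (s, True) \<cdot> (t, True)}"
proof -
  have c: "comm (s, True) (t, True)" "s \<noteq> t" using st comm_neq[of "(s, True)" "(t, True)"] by (auto simp: comm_def)
  have l: "(s, True) \<in> letters" "(t, True) \<in> letters" using c comm_letters by blast+
  have "distinct ss \<and> set ss \<subseteq> {s, t} \<longleftrightarrow> ss \<in> {[], [s], [t], [s, t], [t, s]}" for ss
    using distinct_lists_le_two[of ss s t] c by auto
  then have "cube x {s, t} = (\<lambda>ss. act x (pos ss)) ` {[], [s], [t], [s, t], [t, s]}"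
    unfolding cube_def by blast
  then show ?thesis
    using x l act_Cons[of x "(s, True)" "[(t, True)]"] act_Cons[of x "(t, True)" "[(s, True)]"]
      step_comm[OF x c(1)] by (simp add: pos_def insert_commute)
qed

lemma cube_memI0: "x \<in> carrier G \<Longrightarrow> x \<in> cube x K"
  unfolding cube_def by (intro CollectI exI[of _ "[]"]) (simp add: pos_def)

lemma cube_memI1: "s \<in> K \<Longrightarrow> x \<cdot> (s, True) \<in> cube x K"
  unfolding cube_def by (intro CollectI exI[of _ "[s]"]) (simp add: pos_def)

lemma cube_memI2: "s \<in> K \<Longrightarrow> t \<in> K \<Longrightarrow> s \<noteq> t \<Longrightarrow> act x [(s, True), (t, True)] \<in> cube x K"
  unfolding cube_def by (intro CollectI exI[of _ "[s, t]"]) (simp add: pos_def)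

lemma vertex_set_salvetti: "vertex_set S = carrier G"
proof
  show "vertex_set S \<subseteq> carrier G"
  proof
    fix p assume "p \<in> vertex_set S"
    then obtain x K where x: "x \<in> carrier G" "K \<subseteq> V" "p \<in> cube x K"
      unfolding vertex_set_def salvetti_cover_cubes by blast
    then obtain ss where "p = act x (pos ss)" "set ss \<subseteq> V" by (auto simp: cube_def)
    moreover have "pos ss \<in> words" using calculation(2) by (auto simp: pos_def in_lists_conv_set)
    ultimately show "p \<in> carrier G" using x(1) by simp
  qed
  show "carrier G \<subseteq> vertex_set S"
  proof
    fix p assume p: "p \<in> carrier G"
    then have "{p} \<in> S" unfolding salvetti_cover_cubes using cube_empty[OF p] by fastforce
    then show "p \<in> vertex_set S" by (auto simp: vertex_set_def)
  qed
qed

lemma card_three: "distinct [a, b, c] \<Longrightarrow> card {a, b, c} = 3"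
  by simp

lemma card_four: "card {a, b, c, d} = 4 \<longleftrightarrow> distinct [a, b, c, d]"
  by (simp add: card_insert_if)

lemma card_five: "distinct [a, b, c, d, e] \<Longrightarrow> card {a, b, c, d, e} = 5"
  by simp

lemma salvetti_edges: "e \<in> edges S \<longleftrightarrow> (\<exists>x\<in>carrier G. \<exists>s\<in>V. e = {x, x \<cdot> (s, True)})"
proof
  assume "e \<in> edges S"
  then obtain x K where x: "x \<in> carrier G" "finite K" "K \<subseteq> V" "e = cube x K"
    and c: "\<forall>s\<in>K. \<forall>t\<in>K. s \<noteq> t \<longrightarrow> {s, t} \<in> E" and card: "card (cube x K) = 2"
    unfolding edges_def salvetti_cover_cubes by blast
  have one: "s = t" if st: "s \<in> K" "t \<in> K" for s t
  proof (rule ccontr)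
    assume ne: "s \<noteq> t"
    have l: "(s, True) \<in> letters" "(t, True) \<in> letters" using st x by auto
    have "card {x, x \<cdot> (s, True), x \<cdot> (t, True)} = 3"
      using step_neq[OF x(1) l(1)] step_neq[OF x(1) l(2)] step_inj[OF _ x(1) l] ne
      by (intro card_three) (simp, metis prod.inject)
    moreover have "{x, x \<cdot> (s, True), x \<cdot> (t, True)} \<subseteq> cube x K"
      using cube_memI0[OF x(1)] cube_memI1 st by blast
    moreover have "finite (cube x K)" using card card_ge_0_finite[of "cube x K"] by simp
    ultimately show False using card_mono[of "cube x K"] card by (metis Suc_1 eval_nat_numeral(3) not_less_eq_eq order_refl)
  qed
  have "K \<noteq> {}" using card cube_empty[OF x(1)] by auto
  then obtain s where "s \<in> K" by blast
  then have "K = {s}" using one by blast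
  then show "\<exists>x\<in>carrier G. \<exists>s\<in>V. e = {x, x \<cdot> (s, True)}" using x cube_single[OF x(1), of s] by blast
next
  assume "\<exists>x\<in>carrier G. \<exists>s\<in>V. e = {x, x \<cdot> (s, True)}"
  then obtain x s where xs: "x \<in> carrier G" "s \<in> V" "e = {x, x \<cdot> (s, True)}" by blast
  then have "e = cube x {s}" using cube_single by simp
  then have "e \<in> S" unfolding salvetti_cover_cubes using xs by blast
  moreover have "card e = 2" using xs step_neq[of x "(s, True)"] by simp
  ultimately show "e \<in> edges S" by (simp add: edges_def)
qed

lemma edge_iff_step: "{p, q} \<in> edges S \<longleftrightarrow> p \<in> carrier G \<and> (\<exists>a\<in>letters. q = p \<cdot> a)"
proof
  assume "{p, q} \<in> edges S"
  then obtain x s where xs: "x \<in> carrier G" "s \<in> V" "{p, q} = {x, x \<cdot> (s, True)}"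
    unfolding salvetti_edges by blast
  then consider "p = x" "q = x \<cdot> (s, True)" | "p = x \<cdot> (s, True)" "q = x" by (auto simp: doubleton_eq_iff)
  then show "p \<in> carrier G \<and> (\<exists>a\<in>letters. q = p \<cdot> a)"
  proof cases
    case 1
    then show ?thesis using xs by (intro conjI bexI[of _ "(s, True)"]) simp_all
  next
    case 2
    then have "q = p \<cdot> (s, False)" using step_linv[of x "(s, True)"] xs by simp
    then show ?thesis using 2 xs by (intro conjI bexI[of _ "(s, False)"]) simp_all
  qed
next
  assume "p \<in> carrier G \<and> (\<exists>a\<in>letters. q = p \<cdot> a)"
  then obtain a where a: "p \<in> carrier G" "a \<in> letters" "q = p \<cdot> a" by blast
  show "{p, q} \<in> edges S"
  proof (cases "snd a")
    case True
    then have "a = (fst a, True)" "fst a \<in> V" using a by (auto simp: prod_eq_iff)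
    then show ?thesis using a unfolding salvetti_edges by metis
  next
    case False
    then have f: "linv a = (fst a, True)" "fst a \<in> V" using a by (auto simp: linv_def)
    have "p = q \<cdot> linv a" "q \<in> carrier G" using step_linv a by auto
    then have "\<exists>x\<in>carrier G. \<exists>s\<in>V. {p, q} = {x, x \<cdot> (s, True)}"
      using f by (intro bexI[of _ q] bexI[of _ "fst a"]) auto
    then show ?thesis using salvetti_edges by simp
  qed
qed

lemma salvetti_squares:
  "q \<in> squares S \<longleftrightarrow> (\<exists>x\<in>carrier G. \<exists>s t. {s, t} \<in> E \<and>
     q = {x, x \<cdot> (s, True), x \<cdot> (t, True), x \<cdot> (s, True) \<cdot> (t, True)})" (is "_ \<longleftrightarrow> ?R")
proof
  assume "q \<in> squares S"
  then obtain x K where x: "x \<in> carrier G" "finite K" "K \<subseteq> V" "q = cube x K"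
    and c: "\<forall>s\<in>K. \<forall>t\<in>K. s \<noteq> t \<longrightarrow> {s, t} \<in> E" and card: "card (cube x K) = 4"
    unfolding squares_def salvetti_cover_cubes by blast
  have l: "(s, True) \<in> letters" if "s \<in> K" for s using that x by auto
  have fin: "finite (cube x K)" using card card_ge_0_finite[of "cube x K"] by simp
  have two: False if st: "s \<in> K" "t \<in> K" "r \<in> K" "s \<noteq> t" "s \<noteq> r" "t \<noteq> r" for r s t
  proof -
    let ?A = "{act x [(s, True), (t, True)], x, x \<cdot> (s, True), x \<cdot> (t, True), x \<cdot> (r, True)}"
    have e: "act x [(s, True), (t, True)] = x \<cdot> (s, True) \<cdot> (t, True)" using act_Cons[of x "(s, True)" "[(t, True)]"] x l st by simp
    have "card ?A = 5"
      unfolding e using step_neq[OF x(1) l] step_inj[OF _ x(1) l l] step_step_neq[OF x(1) l l l] st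
      by (intro card_five) (simp, metis prod.inject)
    moreover have "?A \<subseteq> cube x K"
      using cube_memI0[OF x(1)] cube_memI1 cube_memI2 st by blast
    ultimately have "5 \<le> card (cube x K)" using card_mono[OF fin] by metis
    then show False using card by simp
  qed
  have "K \<noteq> {}" using card cube_empty[OF x(1)] by auto
  then obtain s where s: "s \<in> K" by blast
  have "card (cube x {s}) \<le> 2" unfolding cube_single[OF x(1)] by (simp add: card_insert_if)
  then have "K \<noteq> {s}" using card by auto
  then obtain t where t: "t \<in> K" "t \<noteq> s" using s by blast
  have "K = {s, t}" using two s t by blast
  moreover have "{s, t} \<in> E" using c s t by metis
  moreover have "q = {x, x \<cdot> (s, True), x \<cdot> (t, True), x \<cdot> (s, True) \<cdot> (t, True)}"
    using x(4) cube_pair[OF x(1)] calculation by simp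
  ultimately show ?R using x(1) by metis
next
  assume ?R
  then obtain x s t where xs: "x \<in> carrier G" "{s, t} \<in> E"
    "q = {x, x \<cdot> (s, True), x \<cdot> (t, True), x \<cdot> (s, True) \<cdot> (t, True)}" by blast
  then have "comm (s, True) (t, True)" by (simp add: comm_def)
  note st = comm_letters[OF this] comm_neq[OF this]
  have "q = cube x {s, t}" using xs cube_pair by simp
  moreover have "{t, s} \<in> E" using xs by (simp add: insert_commute)
  ultimately have "q \<in> S" unfolding salvetti_cover_cubes using xs st
    by (intro CollectI exI[of _ x] exI[of _ "{s, t}"]) auto
  moreover have "card q = 4"
    unfolding xs(3) card_four
    using step_neq[OF xs(1)] step_inj[OF _ xs(1) st(1,2)] step_step_neq[OF xs(1) st(1,2,1)]
      step_step_neq[OF xs(1) st(1,2,2)] st by (simp, metis prod.inject)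
  ultimately show "q \<in> squares S" by (simp add: squares_def)
qed

text \<open>The corners of a square play symmetric roles, by trading a generator for its inverse.\<close>

lemma square_at_corner:
  assumes "q \<in> squares S" "x \<in> q"
  shows "\<exists>a b. comm a b \<and> x \<in> carrier G \<and> q = {x, x \<cdot> a, x \<cdot> b, x \<cdot> a \<cdot> b}"
proof -
  obtain p s t where p: "p \<in> carrier G" "{s, t} \<in> E"
    "q = {p, p \<cdot> (s, True), p \<cdot> (t, True), p \<cdot> (s, True) \<cdot> (t, True)}"
    using assms(1) unfolding salvetti_squares by blast
  define a b where ab: "a = (s, True)" "b = (t, True)"
  have c: "comm a b" "comm (linv a) b" "comm a (linv b)" "comm (linv a) (linv b)"
    using p(2) by (auto simp: ab comm_def)
  note l = comm_letters[OF c(1)] comm_letters[OF c(4)]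
  have q: "q = {p, p \<cdot> a, p \<cdot> b, p \<cdot> a \<cdot> b}" using p ab by simp
  have pa: "p \<cdot> a \<in> carrier G" "p \<cdot> b \<in> carrier G" "p \<cdot> a \<cdot> b \<in> carrier G" using p l by auto
  consider "x = p" | "x = p \<cdot> a" | "x = p \<cdot> b" | "x = p \<cdot> a \<cdot> b" using assms(2) q by blast
  then show ?thesis
  proof cases
    case 1
    then show ?thesis using q c p by (intro exI[of _ a] exI[of _ b] conjI) simp_all
  next
    case 2
    have "x \<cdot> linv a = p" using 2 step_linv p l by simp
    then have "q = {x, x \<cdot> linv a, x \<cdot> b, x \<cdot> linv a \<cdot> b}" using q 2 by (simp add: insert_commute)
    then show ?thesis using c pa 2 by (intro exI[of _ "linv a"] exI[of _ b] conjI) simp_all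
  next
    case 3
    have "x \<cdot> linv b = p" using 3 step_linv p l by simp
    then have "q = {x, x \<cdot> linv b, x \<cdot> a, x \<cdot> linv b \<cdot> a}" using q 3 step_comm[OF p(1) c(1)] by (simp add: insert_commute)
    then show ?thesis using c pa 3 by (intro exI[of _ "linv b"] exI[of _ a] conjI) (simp_all add: comm_sym)
  next
    case 4
    have e: "x = p \<cdot> b \<cdot> a" using 4 step_comm[OF p(1) c(1)] by simp
    have "x \<cdot> linv b = p \<cdot> a" using 4 step_linv pa l by simp
    moreover have "x \<cdot> linv a = p \<cdot> b" using e step_linv pa l by simp
    moreover have "p \<cdot> b \<cdot> linv b = p" using step_linv p l by simp
    ultimately have "q = {x, x \<cdot> linv a, x \<cdot> linv b, x \<cdot> linv a \<cdot> linv b}" using q 4 by (simp add: insert_commute)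
    then show ?thesis using c pa 4 by (intro exI[of _ "linv a"] exI[of _ "linv b"] conjI) simp_all
  qed
qed

lemma square_steps:
  assumes "p \<in> carrier G" "comm a b"
  shows "{p, p \<cdot> a, p \<cdot> b, p \<cdot> a \<cdot> b} \<in> squares S"
proof -
  have pos: "{p, p \<cdot> a, p \<cdot> b, p \<cdot> a \<cdot> b} \<in> squares S"
    if "p \<in> carrier G" "comm a b" "snd a" "snd b" for p a b
  proof -
    have "a = (fst a, True)" "b = (fst b, True)" "{fst a, fst b} \<in> E"
      using that by (auto simp: prod_eq_iff comm_def)
    then show ?thesis using that(1) unfolding salvetti_squares by metis
  qed
  have flip: "{p, p \<cdot> a, p \<cdot> b, p \<cdot> a \<cdot> b} = {p \<cdot> a, p \<cdot> a \<cdot> linv a, p \<cdot> a \<cdot> b, p \<cdot> a \<cdot> linv a \<cdot> b}"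
    if "p \<in> carrier G" "comm a b" for p a b
    using step_linv[OF that(1) comm_letters(1)[OF that(2)]] by (simp add: insert_commute)
  have half: "{p, p \<cdot> a, p \<cdot> b, p \<cdot> a \<cdot> b} \<in> squares S"
    if "p \<in> carrier G" "comm a b" "snd b" for p a b
  proof (cases "snd a")
    case False
    then have "snd (linv a)" by (simp add: linv_def)
    then show ?thesis
      unfolding flip[OF that(1,2)] using pos[of "p \<cdot> a" "linv a" b] that comm_letters[OF that(2)] by simp
  qed (use pos that in blast)
  show ?thesis
  proof (cases "snd b")
    case False
    have "{p, p \<cdot> a, p \<cdot> b, p \<cdot> a \<cdot> b} = {p, p \<cdot> b, p \<cdot> a, p \<cdot> b \<cdot> a}"
      using step_comm[OF assms] by (simp add: insert_commute)
    also have "\<dots> = {p \<cdot> b, p \<cdot> b \<cdot> linv b, p \<cdot> b \<cdot> a, p \<cdot> b \<cdot> linv b \<cdot> a}"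
      using flip[of p b a] assms comm_sym by simp
    also have "\<dots> = {p \<cdot> b, p \<cdot> b \<cdot> a, p \<cdot> b \<cdot> linv b, p \<cdot> b \<cdot> a \<cdot> linv b}"
      using step_comm[of "p \<cdot> b" a "linv b"] assms comm_letters[OF assms(2)] by (simp add: insert_commute)
    finally have "{p, p \<cdot> a, p \<cdot> b, p \<cdot> a \<cdot> b} = {p \<cdot> b, p \<cdot> b \<cdot> a, p \<cdot> b \<cdot> linv b, p \<cdot> b \<cdot> a \<cdot> linv b}" .
    moreover have "snd (linv b)" using False by (simp add: linv_def)
    ultimately show ?thesis
      using half[of "p \<cdot> b" a "linv b"] assms comm_letters[OF assms(2)] by simp
  qed (use half assms in blast)
qed

lemma opposite_pair:
  assumes "{a, b} \<union> e = {a, b, c, d}" "{a, b} \<inter> e = {}" "distinct [a, b, c, d]"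
  shows "e = {c, d}"
  using assms by auto

lemma opposite_edges_steps:
  assumes "({x, x \<cdot> a}, e) \<in> opposite_edges S" "x \<in> carrier G" "a \<in> letters"
  shows "\<exists>b. comm a b \<and> e = {x \<cdot> b, x \<cdot> b \<cdot> a}"
proof -
  have o: "e \<in> edges S" "{x, x \<cdot> a} \<inter> e = {}" "{x, x \<cdot> a} \<union> e \<in> squares S"
    using assms by (auto simp: opposite_edges_def)
  obtain c d where cd: "comm c d" "{x, x \<cdot> a} \<union> e = {x, x \<cdot> c, x \<cdot> d, x \<cdot> c \<cdot> d}"
    using square_at_corner[OF o(3), of x] by (metis UnI1 insertI1)
  note l = comm_letters[OF cd(1)] comm_neq[OF cd(1)]
  have d: "distinct [x, x \<cdot> c, x \<cdot> d, x \<cdot> c \<cdot> d]"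
    using o(3) unfolding cd(2) squares_def mem_Collect_eq card_four by blast
  have "x \<cdot> a \<in> {x, x \<cdot> a} \<union> e" by simp
  then have "x \<cdot> a \<in> {x, x \<cdot> c, x \<cdot> d, x \<cdot> c \<cdot> d}" unfolding cd(2) .
  moreover have "x \<cdot> a \<noteq> x" using step_neq assms by simp
  moreover have "x \<cdot> a \<noteq> x \<cdot> c \<cdot> d" using step_step_neq(1)[OF assms(2) l(1,2) assms(3) l(3)] by simp
  ultimately have "x \<cdot> a = x \<cdot> c \<or> x \<cdot> a = x \<cdot> d" by simp
  then consider "a = c" | "a = d" using step_inj[OF _ assms(2,3)] l by metis
  then show ?thesis
  proof cases
    case 1
    have "e = {x \<cdot> d, x \<cdot> c \<cdot> d}" using opposite_pair[of x "x \<cdot> c" e] cd(2) o(2) d 1 by simp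
    then show ?thesis using 1 cd step_comm[OF assms(2) cd(1)] by (intro exI[of _ d]) simp
  next
    case 2
    have "e = {x \<cdot> c, x \<cdot> c \<cdot> d}"
      using opposite_pair[of x "x \<cdot> d" e "x \<cdot> c" "x \<cdot> c \<cdot> d"] cd(2) o(2) d 2
      by (simp add: insert_commute) metis
    then show ?thesis using 2 cd comm_sym[of c d] by (intro exI[of _ c]) simp
  qed
qed

lemma opposite_edgesI:
  assumes "x \<in> carrier G" "comm a b"
  shows "({x, x \<cdot> a}, {x \<cdot> b, x \<cdot> b \<cdot> a}) \<in> opposite_edges S"
proof -
  note l = comm_letters[OF assms(2)]
  have s: "{x, x \<cdot> b, x \<cdot> a, x \<cdot> b \<cdot> a} \<in> squares S"
    using square_steps[of x b a] assms comm_sym by blast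
  then have "distinct [x, x \<cdot> b, x \<cdot> a, x \<cdot> b \<cdot> a]" unfolding squares_def mem_Collect_eq card_four by blast
  then have "{x, x \<cdot> a} \<inter> {x \<cdot> b, x \<cdot> b \<cdot> a} = {}" by (simp add: eq_commute)
  moreover have "{x, x \<cdot> a} \<union> {x \<cdot> b, x \<cdot> b \<cdot> a} = {x, x \<cdot> b, x \<cdot> a, x \<cdot> b \<cdot> a}" by (simp add: insert_commute)
  moreover have "{x, x \<cdot> a} \<in> edges S" "{x \<cdot> b, x \<cdot> b \<cdot> a} \<in> edges S"
    unfolding edge_iff_step using assms(1) l by (auto intro!: conjI bexI)
  ultimately show ?thesis using s unfolding opposite_edges_def by (metis (mono_tags, lifting) case_prodI mem_Collect_eq)
qed

lemma opposite_edges_sym: "sym (opposite_edges Y)"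
  by (auto simp: sym_def opposite_edges_def Un_commute)

lemma edge_wbase:
  assumes "x \<in> carrier G" "u \<in> words" "a \<in> letters"
  shows "{act x u, act x (u @ [a])} = {act x (wbase u a), act x (wbase u a) \<cdot> (fst a, True)}"
proof (cases "snd a")
  case True
  then have "a = (fst a, True)" by (simp add: prod_eq_iff)
  then show ?thesis using True assms act_snoc[of x a u] by (metis wbase_def)
next
  case False
  then have a: "linv a = (fst a, True)" by (simp add: linv_def)
  have "act x (u @ [a]) \<cdot> (fst a, True) = act x u"
    unfolding a[symmetric] using act_snoc[of x a u] step_linv[of "act x u" a] assms by simp
  then show ?thesis using False by (simp add: wbase_def insert_commute)
qed

lemma translate_edge:
  assumes "y \<in> linkw s" "p \<in> carrier G" "s \<in> V"
  shows "({p, p \<cdot> (s, True)}, {act p y, act p y \<cdot> (s, True)}) \<in> (opposite_edges S)\<^sup>*"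
  using assms(1)
proof (induction y rule: rev_induct)
  case Nil
  then show ?case using assms by simp
next
  case (snoc c y)
  have y: "y \<in> words" "c \<in> letters" using linkw_words[OF snoc.prems] by auto
  have c: "comm (s, True) c" using snoc.prems by (simp add: comm_def)
  have "({act p y, act p y \<cdot> (s, True)}, {act p y \<cdot> c, act p y \<cdot> c \<cdot> (s, True)}) \<in> opposite_edges S"
    using opposite_edgesI[OF _ c] assms y by simp
  moreover have "act p (y @ [c]) = act p y \<cdot> c" using act_snoc assms y by simp
  ultimately show ?case using snoc by (auto intro: rtrancl_into_rtrancl)
qed

text \<open>The word of the link that relates the two bases is read along a strip of squares.\<close>

lemma same_wall_parallel:
  assumes "same_wall u a v b" "x \<in> carrier G" "u \<in> words" "v \<in> words" "a \<in> letters" "b \<in> letters"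
  shows "({act x u, act x (u @ [a])}, {act x v, act x (v @ [b])}) \<in> (opposite_edges S)\<^sup>*"
proof -
  obtain y where y: "y \<in> linkw (fst a)" "wbase v b \<doteq> wbase u a @ y" and f: "fst b = fst a"
    using assms(1) unfolding same_wall_def by metis
  have "act x (wbase v b) = act (act x (wbase u a)) y"
    using act_eq_iff[of x "wbase v b" "wbase u a @ y"] act_append[of x "wbase u a" y] linkw_words[OF y(1)] y(2) assms
    by simp
  moreover have "fst a \<in> V" using assms(5) by (cases a) simp
  ultimately show ?thesis
    using translate_edge[OF y(1), of "act x (wbase u a)"] f assms by (simp add: edge_wbase)
qed

text \<open>Crossing a square multiplies the base by a letter of the link.\<close>

lemma parallel_same_wall:
  assumes "({act x u, act x (u @ [a])}, e) \<in> (opposite_edges S)\<^sup>*"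
    and x: "x \<in> carrier G" "u \<in> words" "a \<in> letters"
  shows "\<exists>v\<in>words. \<exists>b\<in>letters. e = {act x v, act x (v @ [b])} \<and> same_wall u a v b"
  using assms(1)
proof (induction rule: rtrancl_induct)
  case base
  have "same_wall u a u a" unfolding same_wall_def by (intro conjI bexI[of _ "[]"]) simp_all
  then show ?case using x by blast
next
  case (step e e')
  then obtain v b where v: "v \<in> words" "b \<in> letters" "e = {act x v, act x v \<cdot> b}" "same_wall u a v b"
    using act_snoc x(1) by metis
  obtain c where c: "comm b c" "e' = {act x v \<cdot> c, act x v \<cdot> c \<cdot> b}"
    using opposite_edges_steps[of "act x v" b e'] step.hyps(2) v x by auto
  note l = comm_letters[OF c(1)]
  have e': "e' = {act x (v @ [c]), act x ((v @ [c]) @ [b])}"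
    using c(2) act_snoc[of x c v] act_snoc[of x b "v @ [c]"] v x l by simp
  have "wbase (v @ [c]) b \<doteq> wbase v b @ [c]"
    using step_wordeq[OF swap_step[of c b v "[]"]] c(1) v(1) by (simp add: wbase_def comm_sym)
  then have "same_wall v b (v @ [c]) b"
    using c(1) unfolding same_wall_def by (intro conjI bexI[of _ "[c]"]) (simp_all add: comm_def)
  then have "same_wall u a (v @ [c]) b" using same_wall_trans[OF v(4)] x by blast
  then show ?case using e' v l by (intro bexI[of _ "v @ [c]"] bexI[of _ b] conjI) simp_all
qed

lemma same_edge_same_wall:
  assumes "{act x u, act x (u @ [a])} = {act x v, act x (v @ [b])}"
    and x: "x \<in> carrier G" "u \<in> words" "a \<in> letters" "v \<in> words" "b \<in> letters"
  shows "same_wall u a v b"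
proof -
  have l: "(fst a, True) \<in> letters" "(fst b, True) \<in> letters" using x by (cases a; cases b; simp)+
  define p where "p = act x (wbase u a)"
  define q where "q = act x (wbase v b)"
  have pq: "p \<in> carrier G" "q \<in> carrier G" using x by (simp_all add: p_def q_def)
  have e: "{p, p \<cdot> (fst a, True)} = {q, q \<cdot> (fst b, True)}"
    using assms(1) x by (simp add: edge_wbase p_def q_def)
  have "p = q \<and> p \<cdot> (fst a, True) = q \<cdot> (fst b, True)"
  proof (rule ccontr)
    assume "\<not> ?thesis"
    then have "q = p \<cdot> (fst a, True)" "p = q \<cdot> (fst b, True)" using e by (auto simp: doubleton_eq_iff)
    then have "act p [(fst a, True), (fst b, True)] = act p []"
      using act_Cons[of p "(fst a, True)" "[(fst b, True)]"] pq l by simp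
    then have "expo (fst a) [(fst a, True), (fst b, True)] = expo (fst a) []"
      using act_expo[of p "[(fst a, True), (fst b, True)]" "[]" "fst a"] pq l by simp
    then show False by (simp split: if_splits)
  qed
  then have "p = q" "fst a = fst b" using step_inj[of p "(fst a, True)" "(fst b, True)"] pq l by auto
  then have "wbase v b \<doteq> wbase u a" using act_eq_iff[of x "wbase v b" "wbase u a"] x by (simp add: p_def q_def)
  then show ?thesis using \<open>fst a = fst b\<close> unfolding same_wall_def by (intro conjI bexI[of _ "[]"]) simp_all
qed

lemma parallel_same_wall':
  assumes "({act x u, act x (u @ [a])}, {act x v, act x (v @ [b])}) \<in> (opposite_edges S)\<^sup>*"
    and x: "x \<in> carrier G" "u \<in> words" "a \<in> letters" "v \<in> words" "b \<in> letters"
  shows "same_wall u a v b"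
proof -
  obtain v' b' where v: "v' \<in> words" "b' \<in> letters" "{act x v, act x (v @ [b])} = {act x v', act x (v' @ [b'])}" "same_wall u a v' b'"
    using parallel_same_wall[OF assms(1-4)] by metis
  have "same_wall v' b' v b" using same_edge_same_wall[OF v(3)[symmetric]] v x by blast
  then show ?thesis using same_wall_trans v(4) x by blast
qed

text \<open>A reduced word between two points of a halfspace cannot cross the bounding wall:
  any path avoiding the wall crosses it algebraically zero times.\<close>

lemma halfspace_reduced:
  assumes h: "h \<in> hyperplanes S" "C \<in> halfspaces S h"
    and p: "p \<in> C" "act p w \<in> C" and w: "reduced w"
  shows "act p (take i w) \<in> C"
proof -
  define R where "R = {(x, y). {x, y} \<in> edges S \<and> {x, y} \<notin> h}"
  have symR: "sym (R\<^sup>*)" by (rule sym_rtrancl) (auto simp: sym_def R_def insert_commute)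
  obtain x0 where x0: "x0 \<in> carrier G" "C = R\<^sup>* `` {x0}"
    using h(2) unfolding halfspaces_def R_def[symmetric] vertex_set_salvetti by (elim quotientE)
  have Rc: "y \<in> carrier G" if "(x, y) \<in> R\<^sup>*" "x \<in> carrier G" for x y
    using that
  proof (induction rule: rtrancl_induct)
    case (step y z)
    then have "{z, y} \<in> edges S" unfolding R_def by (simp add: insert_commute)
    then show ?case unfolding edge_iff_step by blast
  qed
  have pc: "p \<in> carrier G" using Rc x0 p(1) by blast
  have ww: "w \<in> words" using w reduced_words by blast
  have avoid: "\<exists>w'\<in>words. q = act p w' \<and> (\<forall>u a v. w' = u @ a # v \<longrightarrow> {act p u, act p (u @ [a])} \<notin> h)"
    if "(p, q) \<in> R\<^sup>*" for q
    using that
  proof (induction rule: rtrancl_induct)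
    case base
    then show ?case using pc by (intro bexI[of _ "[]"]) simp_all
  next
    case (step y z)
    then obtain w' where w': "w' \<in> words" "y = act p w'"
      "\<forall>u a v. w' = u @ a # v \<longrightarrow> {act p u, act p (u @ [a])} \<notin> h" by blast
    have yz: "{y, z} \<in> edges S" "{y, z} \<notin> h" using step.hyps(2) by (auto simp: R_def)
    then obtain b where b: "b \<in> letters" "z = y \<cdot> b" unfolding edge_iff_step by blast
    have z: "z = act p (w' @ [b])" using b w' act_snoc pc by simp
    have "{act p u, act p (u @ [a])} \<notin> h" if d: "w' @ [b] = u @ a # v" for u a v
    proof (cases v rule: rev_cases)
      case Nil
      then have "u = w'" "a = b" using d by simp_all
      then show ?thesis using yz(2) z w'(2) by simp
    next
      case (snoc v' c)
      then have "w' = u @ a # v'" using d by simp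
      then show ?thesis using w'(3) by blast
    qed
    moreover have "w' @ [b] \<in> words" using w'(1) b(1) by simp
    ultimately show ?case using z by blast
  qed
  have "(p, act p w) \<in> R\<^sup>*"
    using p symD[OF symR, of x0 p] rtrancl_trans[of p x0 R "act p w"] unfolding x0(2) by simp
  then obtain w' where w': "w' \<in> words" "act p w = act p w'"
    "\<forall>u a v. w' = u @ a # v \<longrightarrow> {act p u, act p (u @ [a])} \<notin> h"
    using avoid by blast
  have ww': "w \<doteq> w'" using w'(1,2) ww pc act_eq_iff by blast
  have hcl: "e' \<in> h" if "e \<in> h" "(e, e') \<in> (opposite_edges S)\<^sup>*" for e e'
    using h(1) that unfolding hyperplanes_def quotient_def by (auto intro: rtrancl_trans)
  show ?thesis
  proof (induction i)
    case 0
    then show ?case using p pc by simp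
  next
    case (Suc i)
    show ?case
    proof (cases "i < length w")
      case True
      note s = nth_split[OF True] take_Suc_conv_app_nth[OF True]
      have l: "take i w \<in> words" "w ! i \<in> letters" using ww s(1) by (metis append_in_lists_conv lists.simps list.inject list.distinct(1))+
      let ?e = "{act p (take i w), act p (take i w @ [w ! i])}"
      have "?e \<notin> h"
      proof
        assume e: "?e \<in> h"
        obtain u b v where v: "w' = u @ b # v" "same_wall (take i w) (w ! i) u b"
          using wall_crossed[OF reduced_distinct_walls[OF w] ww' ww s(1)] by blast
        have "(?e, {act p u, act p (u @ [b])}) \<in> (opposite_edges S)\<^sup>*"
          using same_wall_parallel[OF v(2) pc l(1) _ l(2)] w'(1) v(1) by simp
        then show False using hcl[OF e] w'(3) v(1) by blast
      qed
      moreover have "?e \<in> edges S"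
        unfolding edge_iff_step using act_snoc[OF pc l(2,1)] l pc by (intro conjI bexI[of _ "w ! i"]) simp_all
      ultimately have "(act p (take i w), act p (take (Suc i) w)) \<in> R" using s(2) by (simp add: R_def)
      then show ?thesis using Suc unfolding x0(2) by (auto intro: rtrancl_into_rtrancl)
    qed (use Suc in simp)
  qed
qed

end

section \<open>Convex subcomplexes of the cover\<close>

locale convex_in_salvetti = raag_graph V E for V E +
  fixes X :: "'a set set" and f :: "'a \<Rightarrow> (nat \<times> bool) list set"
  assumes f_into: "f ` vertex_set X \<subseteq> carrier (raag V E)"
    and f_inj: "inj_on f (vertex_set X)"
    and convex: "convex_subcomplex ((`) f ` X) (salvetti_cover V E)"
begin

abbreviation VX where "VX \<equiv> vertex_set X"

lemma f_carrier [simp]: "x \<in> VX \<Longrightarrow> f x \<in> carrier G"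
  using f_into by blast

lemma f_eq_iff: "x \<in> VX \<Longrightarrow> y \<in> VX \<Longrightarrow> f x = f y \<longleftrightarrow> x = y"
  using f_inj by (simp add: inj_on_eq_iff)

lemma vertex_set_image: "vertex_set ((`) f ` X) = f ` VX"
  by (auto simp: vertex_set_def)

lemma cell_iff: "c \<subseteq> VX \<Longrightarrow> c \<in> X \<longleftrightarrow> f ` c \<in> S"
proof
  have Y: "(`) f ` X = {c \<in> S. c \<subseteq> f ` VX}"
    using convex unfolding convex_subcomplex_def vertex_set_image by (rule conjunct1)
  show "f ` c \<in> S" if "c \<in> X"
  proof -
    have "f ` c \<in> (`) f ` X" using that by (rule imageI)
    then show ?thesis unfolding Y by simp
  qed
  assume c: "c \<subseteq> VX" "f ` c \<in> S"
  then have "f ` c \<in> (`) f ` X" unfolding Y by (simp add: image_mono)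
  then obtain d where d: "d \<in> X" "f ` c = f ` d" by (rule imageE)
  then have "d \<subseteq> VX" by (auto simp: vertex_set_def)
  then have "c = d" using inj_on_image_eq_iff[OF f_inj c(1)] d(2) by blast
  then show "c \<in> X" using d by simp
qed

lemma card_image_f: "c \<subseteq> VX \<Longrightarrow> card (f ` c) = card c"
  using f_inj by (meson card_image inj_on_subset)

lemma edge_iff: "e \<subseteq> VX \<Longrightarrow> e \<in> edges X \<longleftrightarrow> f ` e \<in> edges S"
  using cell_iff card_image_f by (simp add: edges_def)

lemma square_iff: "q \<subseteq> VX \<Longrightarrow> q \<in> squares X \<longleftrightarrow> f ` q \<in> squares S"
  using cell_iff card_image_f by (simp add: squares_def)

lemma edge_vertices: "e \<in> edges X \<Longrightarrow> e \<subseteq> VX" "q \<in> squares X \<Longrightarrow> q \<subseteq> VX"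
  by (auto simp: edges_def squares_def vertex_set_def)

lemma edge_step_iff: "x \<in> VX \<Longrightarrow> y \<in> VX \<Longrightarrow> {x, y} \<in> edges X \<longleftrightarrow> (\<exists>a\<in>letters. f y = f x \<cdot> a)"
  using edge_iff[of "{x, y}"] edge_iff_step[of "f x" "f y"] by simp

text \<open>A convex subcomplex is an intersection of halfspaces, so it inherits their convexity.\<close>

lemma geodesically_closed:
  assumes "x \<in> VX" "y \<in> VX" "f y = act (f x) w" "reduced w"
  shows "act (f x) (take i w) \<in> f ` VX"
proof -
  obtain \<H> where H: "\<H> \<subseteq> (\<Union>h\<in>hyperplanes S. halfspaces S h)" "f ` VX = vertex_set S \<inter> \<Inter>\<H>"
    using convex unfolding convex_subcomplex_def vertex_set_image by metis
  have "take i w \<in> words" using reduced_words[OF assms(4)] by (meson in_lists_conv_set in_set_takeD)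
  then have "act (f x) (take i w) \<in> carrier G" using assms(1) by simp
  moreover have "act (f x) (take i w) \<in> C" if C: "C \<in> \<H>" for C
  proof -
    obtain h where h: "h \<in> hyperplanes S" "C \<in> halfspaces S h" using H(1) C by blast
    have "f x \<in> f ` VX" "f y \<in> f ` VX" using assms(1,2) by simp_all
    then have "f x \<in> C" "f y \<in> C" unfolding H(2) using C by simp_all
    then show ?thesis using halfspace_reduced[OF h _ _ assms(4)] assms(3) by simp
  qed
  ultimately show ?thesis unfolding H(2) vertex_set_salvetti by blast
qed

section \<open>Paths as words\<close>

text \<open>Paths are encoded by a first vertex and a word, through the embedding \<open>f\<close> into the cover. Here \<open>nxt\<close> is
  the neighbour along a letter, a path is \<open>valid\<close> if it does not leave the complex, and \<open>tgt\<close>, \<open>vs\<close> and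
  \<open>eds\<close> are its last vertex, its vertices and its oriented edges.\<close>

definition nxt :: "'a \<Rightarrow> letter \<Rightarrow> 'a" where
  "nxt x a = inv_into VX f (f x \<cdot> a)"

lemma f_nxt: "f x \<cdot> a \<in> f ` VX \<Longrightarrow> f (nxt x a) = f x \<cdot> a" "f x \<cdot> a \<in> f ` VX \<Longrightarrow> nxt x a \<in> VX"
  by (simp_all add: nxt_def f_inv_into_f inv_into_into)

lemma nxt_eq: "y \<in> VX \<Longrightarrow> f y = f x \<cdot> a \<Longrightarrow> nxt x a = y"
  unfolding nxt_def using f_inj by (metis inv_into_f_f)

primrec valid :: "'a \<Rightarrow> letter list \<Rightarrow> bool" where
  "valid x [] \<longleftrightarrow> x \<in> VX"
| "valid x (a # w) \<longleftrightarrow> x \<in> VX \<and> a \<in> letters \<and> f x \<cdot> a \<in> f ` VX \<and> valid (nxt x a) w"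

primrec tgt :: "'a \<Rightarrow> letter list \<Rightarrow> 'a" where
  "tgt x [] = x"
| "tgt x (a # w) = tgt (nxt x a) w"

primrec vs :: "'a \<Rightarrow> letter list \<Rightarrow> 'a list" where
  "vs x [] = [x]"
| "vs x (a # w) = x # vs (nxt x a) w"

definition eds :: "'a \<Rightarrow> letter list \<Rightarrow> ('a \<times> 'a) list" where
  "eds x w = zip (vs x w) (tl (vs x w))"

lemma vs_Cons_tl: "vs x w = x # tl (vs x w)"
  by (cases w) simp_all

lemma eds_simps [simp]: "eds x [] = []" "eds x (a # w) = (x, nxt x a) # eds (nxt x a) w"
  unfolding eds_def by (simp, subst (2) vs.simps, simp, metis vs_Cons_tl zip_Cons_Cons)

lemma vs_props [simp]: "hd (vs x w) = x" "last (vs x w) = tgt x w" "length (vs x w) = Suc (length w)" "vs x w \<noteq> []"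
proof -
  show "last (vs x w) = tgt x w"
    by (induction w arbitrary: x) (simp_all, metis list.distinct(1) vs_Cons_tl)
  show "length (vs x w) = Suc (length w)" by (induction w arbitrary: x) simp_all
  show "hd (vs x w) = x" "vs x w \<noteq> []" by (cases w; simp)+
qed

lemma tgt_append [simp]: "tgt x (u @ v) = tgt (tgt x u) v"
  by (induction u arbitrary: x) simp_all

lemma eds_append [simp]: "eds x (u @ v) = eds x u @ eds (tgt x u) v"
  by (induction u arbitrary: x) simp_all

lemma eds_length [simp]: "length (eds x w) = length w"
  by (induction w arbitrary: x) simp_all

lemma valid_start: "valid x w \<Longrightarrow> x \<in> VX"
  by (cases w) simp_all

lemma valid_words: "valid x w \<Longrightarrow> w \<in> words"
  by (induction w arbitrary: x) auto

lemma take_words: "w \<in> words \<Longrightarrow> take i w \<in> words"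
  by (meson in_lists_conv_set in_set_takeD)

lemma valid_tgt: "valid x w \<Longrightarrow> tgt x w \<in> VX"
  by (induction w arbitrary: x) simp_all

lemma f_tgt: "valid x w \<Longrightarrow> f (tgt x w) = act (f x) w"
proof (induction w arbitrary: x)
  case (Cons a w)
  then have "f (tgt x (a # w)) = act (f (nxt x a)) w" by simp
  also have "f (nxt x a) = f x \<cdot> a" using Cons.prems f_nxt by simp
  also have "act (f x \<cdot> a) w = act (f x) (a # w)"
    using act_Cons[of "f x" a w] Cons.prems valid_words[of "nxt x a" w] by simp
  finally show ?case .
qed simp

lemma valid_append [simp]: "valid x (u @ v) \<longleftrightarrow> valid x u \<and> valid (tgt x u) v"
  by (induction u arbitrary: x) (auto dest: valid_start)

lemma validI:
  assumes "x \<in> VX" "w \<in> words" "\<And>i. i \<le> length w \<Longrightarrow> act (f x) (take i w) \<in> f ` VX"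
  shows "valid x w"
  using assms
proof (induction w arbitrary: x)
  case (Cons a w)
  have a: "f x \<cdot> a \<in> f ` VX" using Cons.prems(3)[of 1] by simp
  have "valid (nxt x a) w"
  proof (rule Cons.IH)
    show "nxt x a \<in> VX" "w \<in> words" using f_nxt[OF a] Cons.prems by simp_all
    fix i assume "i \<le> length w"
    then have "act (f x) (take (Suc i) (a # w)) \<in> f ` VX" using Cons.prems(3)[of "Suc i"] by simp
    moreover have "take i w \<in> words" using Cons.prems(2) take_words by simp
    ultimately show "act (f (nxt x a)) (take i w) \<in> f ` VX"
      using act_Cons[of "f x" a "take i w"] f_nxt[OF a] Cons.prems by simp
  qed
  then show ?case using Cons.prems a by simp
qed simp

lemma tgt_eqI: "valid x w \<Longrightarrow> y \<in> VX \<Longrightarrow> f y = act (f x) w \<Longrightarrow> tgt x w = y"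
  using f_tgt f_eq_iff valid_tgt by metis

lemma same_tgt_wordeq: "valid x w \<Longrightarrow> valid x w' \<Longrightarrow> tgt x w = tgt x w' \<Longrightarrow> w \<doteq> w'"
  using f_tgt[of x w] f_tgt[of x w'] act_eq_iff[of "f x" w w']
    valid_words[of x w] valid_words[of x w'] valid_start[of x w] by simp

lemma reduced_valid:
  assumes "x \<in> VX" "y \<in> VX" "f y = act (f x) w" "reduced w"
  shows "valid x w" "tgt x w = y"
proof -
  show "valid x w" using geodesically_closed[OF assms] reduced_words[OF assms(4)] assms(1) by (intro validI)
  then show "tgt x w = y" using tgt_eqI assms by blast
qed

lemma reduced_valid_wordeq:
  assumes "valid x w" "w \<doteq> w'" "reduced w'"
  shows "valid x w'" "tgt x w' = tgt x w"
proof -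
  have "f (tgt x w) = act (f x) w'"
    using f_tgt[OF assms(1)] act_eq_iff[of "f x" w w'] assms(2) valid_words[OF assms(1)] valid_start[OF assms(1)]
      reduced_words[OF assms(3)] by simp
  then show "valid x w'" "tgt x w' = tgt x w" 
    using reduced_valid[OF valid_start[OF assms(1)] valid_tgt[OF assms(1)] _ assms(3)] by simp_all
qed

lemma connected:
  assumes "x \<in> VX" "y \<in> VX"
  shows "\<exists>w. reduced w \<and> valid x w \<and> tgt x w = y"
proof -
  obtain w where w: "w \<in> words" "f y = act (f x) w" 
    using act_transitive[OF f_carrier[OF assms(1)] f_carrier[OF assms(2)]] by blast
  obtain v where v: "v \<doteq> w" "reduced v" using reduced_exists[OF w(1)] by blast
  have "f y = act (f x) v" using w v act_eq_iff[of "f x" v w] assms(1) reduced_words[OF v(2)] by simp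
  then show ?thesis using reduced_valid assms v by blast
qed

lemma edge_nxt: "x \<in> VX \<Longrightarrow> a \<in> letters \<Longrightarrow> f x \<cdot> a \<in> f ` VX \<Longrightarrow> {x, nxt x a} \<in> edges X"
  using edge_step_iff f_nxt by blast

lemma edgeE:
  assumes "{x, y} \<in> edges X"
  obtains a where "valid x [a]" "y = nxt x a"
proof -
  have v: "x \<in> VX" "y \<in> VX" using edge_vertices(1)[OF assms] by auto
  then obtain a where a: "a \<in> letters" "f y = f x \<cdot> a" using assms edge_step_iff by blast
  have "f x \<cdot> a \<in> f ` VX" using v(2) unfolding a(2)[symmetric] by blast
  moreover have "y = nxt x a" using nxt_eq v a by simp
  ultimately show ?thesis using that[of a] v a f_nxt[of x a] by simp
qed

lemma comb_path_vs: "valid x w \<Longrightarrow> comb_path X (vs x w)"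
proof (induction w arbitrary: x)
  case Nil
  then show ?case by (simp add: comb_path_def)
next
  case (Cons a w)
  then have "comb_path X (vs (nxt x a) w)" "{x, nxt x a} \<in> edges X" "x \<in> VX" using edge_nxt by auto
  then show ?case unfolding comb_path_def by (subst (asm) vs_Cons_tl) (auto simp: successively_Cons)
qed

lemma comb_path_word: "comb_path X \<gamma> \<Longrightarrow> \<exists>w. valid (hd \<gamma>) w \<and> \<gamma> = vs (hd \<gamma>) w"
proof (induction \<gamma>)
  case Nil
  then show ?case by (simp add: comb_path_def)
next
  case (Cons x \<gamma>)
  show ?case
  proof (cases \<gamma>)
    case Nil
    then show ?thesis using Cons.prems by (intro exI[of _ "[]"]) (simp add: comb_path_def)
  next
    case (Cons y \<gamma>')
    then have xy: "{x, y} \<in> edges X" "comb_path X \<gamma>" using Cons.prems by (auto simp: comb_path_def)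
    then obtain w where w: "valid y w" "\<gamma> = vs y w" using Cons.IH Cons by auto
    obtain a where a: "valid x [a]" "y = nxt x a" using edgeE[OF xy(1)] .
    show ?thesis using w a by (intro exI[of _ "a # w"]) simp
  qed
qed

text \<open>Paths with the same ends read words for the same element, and every shortest word for this element is
  read by a path of the complex, by convexity.\<close>

lemma geodesic_vs:
  assumes "valid x w"
  shows "geodesic X (vs x w) \<longleftrightarrow> reduced w"
proof -
  define P where "P n \<longleftrightarrow> (\<exists>\<gamma>. comb_path X \<gamma> \<and> hd \<gamma> = x \<and> last \<gamma> = tgt x w \<and> length \<gamma> = Suc n)" for n
  have d: "graph_dist X x (tgt x w) = (LEAST n. P n)" by (simp add: graph_dist_def P_def)
  have P: "P n \<longleftrightarrow> (\<exists>v. valid x v \<and> tgt x v = tgt x w \<and> length v = n)" for n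
  proof
    assume "P n"
    then obtain \<gamma> where g: "comb_path X \<gamma>" "hd \<gamma> = x" "last \<gamma> = tgt x w" "length \<gamma> = Suc n"
      by (auto simp: P_def)
    then obtain v where "valid x v" "\<gamma> = vs x v" using comb_path_word by blast
    then show "\<exists>v. valid x v \<and> tgt x v = tgt x w \<and> length v = n" using g by auto
  next
    assume "\<exists>v. valid x v \<and> tgt x v = tgt x w \<and> length v = n"
    then obtain v where v: "valid x v" "tgt x v = tgt x w" "length v = n" by blast
    then show "P n" unfolding P_def using comb_path_vs[OF v(1)] by (intro exI[of _ "vs x v"]) simp
  qed
  have Pw: "P (length w)" using P assms by blast
  have "geodesic X (vs x w) \<longleftrightarrow> length w = (LEAST n. P n)"
    using comb_path_vs[OF assms] by (simp add: geodesic_def d)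
  also have "\<dots> \<longleftrightarrow> (\<forall>n. P n \<longrightarrow> length w \<le> n)"
    using LeastI[of P, OF Pw] Least_le[of P, OF Pw] Least_le[of P] by auto
  also have "\<dots> \<longleftrightarrow> reduced w"
  proof
    assume L: "\<forall>n. P n \<longrightarrow> length w \<le> n"
    obtain v where v: "v \<doteq> w" "reduced v" using reduced_exists[OF valid_words[OF assms]] by blast
    have "valid x v" "tgt x v = tgt x w" using reduced_valid_wordeq[OF assms wordeq_sym[OF v(1)] v(2)] by auto
    then have "length w \<le> length v" using L P by blast
    moreover have "length v \<le> length w" using v(2) wordeq_sym[OF v(1)] by (simp add: reduced_def)
    ultimately show "reduced w" using reduced_wordeq[OF v(2,1)] by simp
  next
    assume r: "reduced w"
    show "\<forall>n. P n \<longrightarrow> length w \<le> n"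
      using r same_tgt_wordeq[OF _ assms] unfolding P reduced_def by blast
  qed
  finally show ?thesis .
qed

section \<open>Hyperplanes crossed by a path\<close>

definition hyp :: "'a \<times> 'a \<Rightarrow> 'a set set" where
  "hyp e = (opposite_edges X)\<^sup>* `` {{fst e, snd e}}"

lemma opposite_rtrancl_sym: "(e, e') \<in> (opposite_edges X)\<^sup>* \<Longrightarrow> (e', e) \<in> (opposite_edges X)\<^sup>*"
  using sym_rtrancl[OF opposite_edges_sym] by (rule symD)

lemma hyp_eq_iff: "hyp e = hyp e' \<longleftrightarrow> ({fst e, snd e}, {fst e', snd e'}) \<in> (opposite_edges X)\<^sup>*"
proof
  assume "hyp e = hyp e'"
  moreover have "{fst e', snd e'} \<in> hyp e'" by (simp add: hyp_def)
  ultimately have "{fst e', snd e'} \<in> hyp e" by simp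
  then show "({fst e, snd e}, {fst e', snd e'}) \<in> (opposite_edges X)\<^sup>*" by (simp add: hyp_def)
next
  assume a: "({fst e, snd e}, {fst e', snd e'}) \<in> (opposite_edges X)\<^sup>*"
  show "hyp e = hyp e'"
    unfolding hyp_def using rtrancl_trans[OF a] rtrancl_trans[OF opposite_rtrancl_sym[OF a]] by auto
qed

lemma opposite_image:
  assumes "(e, e') \<in> opposite_edges X"
  shows "(f ` e, f ` e') \<in> opposite_edges S"
proof -
  have e: "e \<in> edges X" "e' \<in> edges X" "e \<inter> e' = {}" "e \<union> e' \<in> squares X"
    using assms by (auto simp: opposite_edges_def)
  note v = edge_vertices(1)[OF e(1)] edge_vertices(1)[OF e(2)]
  have "f ` e \<inter> f ` e' = f ` (e \<inter> e')" using inj_on_image_Int[OF f_inj v] by simp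
  moreover have "f ` e \<union> f ` e' = f ` (e \<union> e')" by blast
  ultimately show ?thesis
    using e edge_iff[OF v(1)] edge_iff[OF v(2)] square_iff[of "e \<union> e'"] v by (simp add: opposite_edges_def)
qed

lemma opposite_image_rtrancl: "(e, e') \<in> (opposite_edges X)\<^sup>* \<Longrightarrow> (f ` e, f ` e') \<in> (opposite_edges S)\<^sup>*"
  by (induction rule: rtrancl_induct) (auto intro: rtrancl_into_rtrancl opposite_image)

lemma opposite_preimage:
  assumes "(f ` e, f ` e') \<in> opposite_edges S" "e \<subseteq> VX" "e' \<subseteq> VX"
  shows "(e, e') \<in> opposite_edges X"
proof -
  have "f ` (e \<inter> e') = {}" using assms inj_on_image_Int[OF f_inj assms(2,3)] by (simp add: opposite_edges_def)
  moreover have "f ` e \<union> f ` e' = f ` (e \<union> e')" by blast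
  ultimately show ?thesis
    using assms edge_iff[OF assms(2)] edge_iff[OF assms(3)] square_iff[of "e \<union> e'"] by (simp add: opposite_edges_def)
qed

text \<open>Parallel edges of the complex are parallel in the cover, hence dual to the same wall.\<close>

lemma reduced_distinct_hyp:
  assumes "valid x w" "reduced w" "w = p @ a # v @ b # q"
  shows "hyp (tgt x p, tgt x (p @ [a])) \<noteq> hyp (tgt x (p @ a # v), tgt x (p @ a # v @ [b]))"
proof
  assume "hyp (tgt x p, tgt x (p @ [a])) = hyp (tgt x (p @ a # v), tgt x (p @ a # v @ [b]))"
  then have "(f ` {tgt x p, tgt x (p @ [a])}, f ` {tgt x (p @ a # v), tgt x (p @ a # v @ [b])}) \<in> (opposite_edges S)\<^sup>*"
    unfolding hyp_eq_iff fst_conv snd_conv by (rule opposite_image_rtrancl)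
  moreover have val: "valid x p" "valid x (p @ [a])" "valid x (p @ a # v)" "valid x (p @ a # v @ [b])"
    using assms(1) unfolding assms(3) by (auto dest: valid_start)
  ultimately have "({act (f x) p, act (f x) (p @ [a])}, {act (f x) (p @ a # v), act (f x) ((p @ a # v) @ [b])}) \<in> (opposite_edges S)\<^sup>*"
    using f_tgt[OF val(1)] f_tgt[OF val(2)] f_tgt[OF val(3)] f_tgt[OF val(4)] by (simp del: tgt_append tgt.simps)
  moreover have "p \<in> words" "p @ a # v \<in> words" "a \<in> letters" "b \<in> letters" "f x \<in> carrier G"
    using valid_words[OF assms(1)] valid_start[OF assms(1)] assms(3) by simp_all
  ultimately have "same_wall p a (p @ a # v) b" using parallel_same_wall' by blast
  then show False using reduced_distinct_walls[OF assms(2)] assms(3) unfolding distinct_walls_def by blast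
qed

lemma square_nxt:
  assumes "comm a c" "valid x [a, c]" "f x \<cdot> c \<in> f ` VX"
  shows "valid x [c, a]" "nxt (nxt x c) a = nxt (nxt x a) c" "({x, nxt x a}, {nxt x c, nxt (nxt x c) a}) \<in> opposite_edges X"
proof -
  have x: "x \<in> VX" "a \<in> letters" "c \<in> letters" using assms by simp_all
  have v: "nxt x a \<in> VX" "nxt (nxt x a) c \<in> VX" "f (nxt x a) = f x \<cdot> a" "f (nxt (nxt x a) c) = f x \<cdot> a \<cdot> c"
    using assms(2) f_nxt by auto
  have c: "nxt x c \<in> VX" "f (nxt x c) = f x \<cdot> c" using f_nxt assms(3) by auto
  have e: "f (nxt (nxt x a) c) = f (nxt x c) \<cdot> a" using v c step_comm[OF f_carrier[OF x(1)] assms(1)] by simp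
  then show n: "nxt (nxt x c) a = nxt (nxt x a) c" using nxt_eq[of "nxt (nxt x a) c" "nxt x c" a] v(2) by simp
  have "f (nxt x c) \<cdot> a \<in> f ` VX" unfolding e[symmetric] using v(2) by simp
  then show "valid x [c, a]" using x c assms(3) n v(2) by simp
  have "(f ` {x, nxt x a}, f ` {nxt x c, nxt (nxt x c) a}) \<in> opposite_edges S"
    using opposite_edgesI[OF f_carrier[OF x(1)] assms(1)] v c e n by simp
  then show "({x, nxt x a}, {nxt x c, nxt (nxt x c) a}) \<in> opposite_edges X"
    using opposite_preimage x v c n by simp
qed

text \<open>A strip of squares along a path whose letters all commute with a given letter.\<close>

lemma ladder:
  assumes "v \<in> linkw (fst a)" "valid x v" "valid x (a # v)"
  shows "({x, nxt x a}, {tgt x v, tgt x (a # v)}) \<in> (opposite_edges X)\<^sup>*"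
    and "f (tgt x v) \<cdot> a \<in> f ` VX" "tgt x (a # v) = nxt (tgt x v) a"
  using assms
proof (induction v arbitrary: x)
  case Nil
  { case 1 then show ?case by simp }
  { case 2 then show ?case by simp }
  { case 3 then show ?case by simp }
next
  case (Cons c v)
  have main: "({x, nxt x a}, {tgt x (c # v), tgt x (a # c # v)}) \<in> (opposite_edges X)\<^sup>* \<and>
    f (tgt x (c # v)) \<cdot> a \<in> f ` VX \<and> tgt x (a # c # v) = nxt (tgt x (c # v)) a"
    if as: "c # v \<in> linkw (fst a)" "valid x (c # v)" "valid x (a # c # v)" for x
  proof -
    have c: "comm a c" "v \<in> linkw (fst a)" using as(1) by (simp_all add: comm_def)
    have vc: "valid (nxt x c) v" "f x \<cdot> c \<in> f ` VX" using as(2) by simp_all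
    have "valid x [a, c]" using as(3) by (auto dest: valid_start)
    note s = square_nxt[OF c(1) this vc(2)]
    have va: "valid (nxt x c) (a # v)" using s(1,2) as(3) by simp
    have t: "tgt (nxt x c) (a # v) = tgt x (a # c # v)" using s(2) by simp
    show ?thesis
      using Cons.IH[OF c(2) vc(1) va] s(3) t by (auto intro: converse_rtrancl_into_rtrancl)
  qed
  { case 1 show ?case using main[OF 1] by (rule conjunct1) }
  { case 2 show ?case using main[OF 2] by (elim conjE) }
  { case 3 show ?case using main[OF 3] by (elim conjE) }
qed

text \<open>The path reading \<open>v\<close> from \<open>x\<close> stays in the complex, since \<open>v\<close> is a shortest word between two of its
  vertices. So the whole strip between it and the given path lies in the complex.\<close>

lemma bookends_same_hyp:
  assumes "valid x (a # v @ [linv a])" "v \<in> linkw (fst a)" "reduced v"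
  shows "hyp (x, nxt x a) = hyp (tgt x (a # v), tgt x (a # v @ [linv a]))"
proof -
  have x: "x \<in> VX" "a \<in> letters" "valid x (a # v)" using assms(1) by auto
  have "a # v @ [linv a] \<doteq> v" using bookends_cancel x assms by blast
  then have v: "valid x v" "tgt x v = tgt x (a # v @ [linv a])"
    using reduced_valid_wordeq[OF assms(1) _ assms(3)] by auto
  have "({x, nxt x a}, {tgt x v, tgt x (a # v)}) \<in> (opposite_edges X)\<^sup>*"
    using ladder(1)[OF assms(2) v(1) x(3)] .
  then show ?thesis unfolding hyp_eq_iff fst_conv snd_conv v(2)[symmetric] by (simp only: insert_commute)
qed

lemma not_reduced_repeats_hyp:
  assumes "valid x w" "\<not> reduced w"
  obtains p a v q where "w = p @ a # v @ linv a # q" "v \<in> linkw (fst a)" "reduced (p @ a # v)"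
    "hyp (tgt x p, tgt x (p @ [a])) = hyp (tgt x (p @ a # v), tgt x (p @ a # v @ [linv a]))"
proof -
  obtain p a v q where d: "w = p @ a # v @ linv a # q" "v \<in> linkw (fst a)" "reduced (p @ a # v)"
    using deletion[OF valid_words[OF assms(1)] assms(2)] by metis
  have "valid (tgt x p) (a # v @ [linv a])" using assms(1) d(1) by (auto dest: valid_start)
  moreover have "reduced v" using reduced_infix[of "p @ [a]" v "[]"] d(3) by simp
  ultimately have "hyp (tgt x p, tgt x (p @ [a])) = hyp (tgt x (p @ a # v), tgt x (p @ a # v @ [linv a]))"
    using bookends_same_hyp[OF _ d(2), of "tgt x p"] by simp
  then show ?thesis using that d by blast
qed

lemma eds_split: "eds x (p @ a # q) = eds x p @ (tgt x p, tgt x (p @ [a])) # eds (tgt x (p @ [a])) q"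
  by simp

text \<open>
  Edges dual to the same hyperplane of the complex are dual to the same wall, which a shortest word
  crosses only once. Conversely, deletion in a path that is not geodesic produces two letters that cancel
  along a strip of squares, and the edges at the ends of the strip are dual to one hyperplane.\<close>

lemma reduced_iff_distinct_hyp:
  assumes "valid x w"
  shows "reduced w \<longleftrightarrow> distinct (map hyp (eds x w))"
proof
  assume r: "reduced w"
  show "distinct (map hyp (eds x w))"
  proof (rule ccontr)
    assume "\<not> distinct (map hyp (eds x w))"
    then obtain i j where ij: "i < j" "j < length w" "hyp (eds x w ! i) = hyp (eds x w ! j)"
      unfolding distinct_conv_nth by (auto, metis linorder_neqE_nat)
    define p where "p = take i w"
    define v where "v = drop (Suc i) (take j w)"
    note s = nth_split2[OF ij(1,2), folded p_def v_def]
    have len: "length p = i" "length (p @ w ! i # v) = j" using ij s(2) by (simp_all add: p_def v_def)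
    have "eds x w ! i = (tgt x p, tgt x (p @ [w ! i]))"
      by (subst s(1)) (simp only: eds_split nth_append len eds_length, simp)
    moreover have "eds x w ! j = (tgt x (p @ w ! i # v), tgt x (p @ w ! i # v @ [w ! j]))"
      using eds_split[of x "p @ w ! i # v" "w ! j" "drop (Suc j) w"] s(1) len(2)
      by (metis append_Cons append_assoc eds_length nth_append_length)
    ultimately show False using reduced_distinct_hyp[OF assms r s(1)] ij(3) by simp
  qed
next
  assume d: "distinct (map hyp (eds x w))"
  show "reduced w"
  proof (rule ccontr)
    assume "\<not> reduced w"
    then obtain p a v q where n: "w = p @ a # v @ linv a # q"
      "hyp (tgt x p, tgt x (p @ [a])) = hyp (tgt x (p @ a # v), tgt x (p @ a # v @ [linv a]))"
      using not_reduced_repeats_hyp[OF assms] by metis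
    show False using d n(2) unfolding n(1) by simp
  qed
qed

section \<open>Parallel edges\<close>

definition letter_of :: "'a \<times> 'a \<Rightarrow> letter" where
  "letter_of e = (THE a. a \<in> letters \<and> f (snd e) = f (fst e) \<cdot> a)"

lemma letter_of_eq: "x \<in> VX \<Longrightarrow> a \<in> letters \<Longrightarrow> f y = f x \<cdot> a \<Longrightarrow> letter_of (x, y) = a"
  unfolding letter_of_def by (rule the_equality) (use step_inj f_carrier in \<open>simp, metis fst_conv snd_conv\<close>)

lemma letter_of_nxt: "valid x [a] \<Longrightarrow> letter_of (x, nxt x a) = a"
  using letter_of_eq[of x a] f_nxt[of x a] by simp

lemma letter_of_eds: "valid x w \<Longrightarrow> map letter_of (eds x w) = w"
proof (induction w arbitrary: x)
  case (Cons a w)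
  then have "valid x [a]" by (auto dest: valid_start)
  then show ?case using Cons letter_of_nxt[of x a] by simp
qed simp

lemma eds_oriented: "valid x w \<Longrightarrow> e \<in> set (eds x w) \<Longrightarrow> e \<in> oriented_edges X"
  by (induction w arbitrary: x) (auto simp: oriented_edges_def edge_nxt)

lemma parallel_sym: "(e, e') \<in> parallel_edges X \<Longrightarrow> (e', e) \<in> parallel_edges X"
  unfolding parallel_edges_def by (auto simp: insert_commute)

lemma parallel_oriented: "(e, e') \<in> parallel_edges X \<Longrightarrow> e \<in> oriented_edges X \<and> e' \<in> oriented_edges X"
  unfolding parallel_edges_def oriented_edges_def by auto

lemma parallel_opposite: "((a, b), (c, d)) \<in> parallel_edges X \<Longrightarrow> ({a, b}, {c, d}) \<in> opposite_edges X"
proof -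
  assume "((a, b), (c, d)) \<in> parallel_edges X"
  then have p: "{a, b, c, d} \<in> squares X" "{a, b} \<in> edges X" "{c, d} \<in> edges X"
    by (simp_all add: parallel_edges_def)
  then have "distinct [a, b, c, d]" unfolding squares_def mem_Collect_eq card_four by blast
  then have "{a, b} \<inter> {c, d} = {}" by auto
  moreover have "{a, b} \<union> {c, d} = {a, b, c, d}" by auto
  ultimately show ?thesis using p unfolding opposite_edges_def by (simp only: mem_Collect_eq case_prod_conv)
qed

lemma parallel_rtrancl_hyp: "(e, e') \<in> (parallel_edges X)\<^sup>* \<Longrightarrow> hyp e = hyp e'"
proof (induction rule: rtrancl_induct)
  case (step e' e'')
  then have "({fst e', snd e'}, {fst e'', snd e''}) \<in> opposite_edges X"
    using parallel_opposite by (metis prod.collapse)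
  then have "hyp e' = hyp e''" unfolding hyp_eq_iff by blast
  then show ?case using step by simp
qed simp

text \<open>
  Seen from its corner \<open>a\<close>, the square consists of \<open>a\<close>, two neighbours along commuting letters and the
  opposite corner. As \<open>b\<close> and \<open>c\<close> are adjacent to \<open>a\<close>, they are the neighbours.\<close>

lemma parallel_letters:
  assumes "((a, b), (c, d)) \<in> parallel_edges X"
  obtains p q where "comm p q" "valid a [p, q]" "valid a [q, p]" "b = nxt a p" "c = nxt a q"
    "d = nxt b q" "d = nxt c p"
proof -
  have par: "{a, b, c, d} \<in> squares X" "{a, b} \<in> edges X" "{c, d} \<in> edges X"
    using assms by (simp_all add: parallel_edges_def)
  have ac: "{a, c} \<in> edges X" using assms by (simp add: parallel_edges_def)
  have v: "a \<in> VX" "b \<in> VX" "c \<in> VX" "d \<in> VX" using edge_vertices(2)[OF par(1)] by auto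
  have dist: "distinct [a, b, c, d]" using par(1) unfolding squares_def mem_Collect_eq card_four by blast
  obtain p where p: "p \<in> letters" "f b = f a \<cdot> p" using edge_step_iff[OF v(1,2)] par(2) by blast
  obtain q where q: "q \<in> letters" "f c = f a \<cdot> q" using edge_step_iff[OF v(1,3)] ac by blast
  have "{f a, f b, f c, f d} \<in> squares S" using square_iff[of "{a, b, c, d}"] par(1) v by simp
  then obtain p' q' where c': "comm p' q'" "{f a, f b, f c, f d} = {f a, f a \<cdot> p', f a \<cdot> q', f a \<cdot> p' \<cdot> q'}"
    using square_at_corner[of _ "f a"] by (metis insertI1)
  note l = comm_letters[OF c'(1)] comm_neq[OF c'(1)]
  have fa: "f a \<in> carrier G" using v by simp
  have nb: "x \<cdot> r \<noteq> x \<cdot> p' \<cdot> q'" if "x \<in> carrier G" "r \<in> letters" for x r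
    using step_step_neq(1)[OF that(1) l(1,2) that(2) l(3)] by simp
  have "f b \<in> {f a, f a \<cdot> p', f a \<cdot> q', f a \<cdot> p' \<cdot> q'}" "f c \<in> {f a, f a \<cdot> p', f a \<cdot> q', f a \<cdot> p' \<cdot> q'}"
    unfolding c'(2)[symmetric] by simp_all
  then have pq: "p = p' \<or> p = q'" "q = p' \<or> q = q'"
    unfolding p(2) q(2) using nb[OF fa p(1)] nb[OF fa q(1)] step_neq[OF fa p(1)] step_neq[OF fa q(1)]
      step_inj[OF _ fa p(1)] step_inj[OF _ fa q(1)] l by auto
  have "p \<noteq> q" using f_eq_iff[of b c] v dist p q by auto
  then have pq': "p = p' \<and> q = q' \<or> p = q' \<and> q = p'" using pq by auto
  then have comm: "comm p q" using c'(1) comm_sym[of p' q'] by auto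
  have sw: "f a \<cdot> p \<cdot> q = f a \<cdot> q \<cdot> p" using step_comm[OF fa comm] .
  have set: "{f a, f b, f c, f d} = {f a, f b, f c, f a \<cdot> p \<cdot> q}"
    using pq'
  proof
    assume "p = p' \<and> q = q'"
    then show ?thesis using c'(2) p(2) q(2) by simp
  next
    assume "p = q' \<and> q = p'"
    then show ?thesis using c'(2) p(2) q(2) sw by (simp add: insert_commute)
  qed
  have "f d \<in> {f a, f b, f c, f a \<cdot> p \<cdot> q}" unfolding set[symmetric] by simp
  moreover have "f d \<noteq> f a" "f d \<noteq> f b" "f d \<noteq> f c" using f_eq_iff[OF v(4)] v dist by auto
  ultimately have d: "f d = f a \<cdot> p \<cdot> q" by simp
  have n: "nxt a p = b" "nxt a q = c" "nxt b q = d" "nxt c p = d"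
    using nxt_eq[OF v(2)] nxt_eq[OF v(3)] nxt_eq[OF v(4)] p q d sw by simp_all
  have im: "f a \<cdot> p \<in> f ` VX" "f a \<cdot> q \<in> f ` VX" "f b \<cdot> q \<in> f ` VX" "f c \<cdot> p \<in> f ` VX"
    using v p(2) q(2) d sw by (metis imageI)+
  have "valid a [p, q]" "valid a [q, p]"
    unfolding valid.simps n using v p(1) q(1) im by simp_all
  then show ?thesis using that[of p q] comm n[symmetric] by blast
qed

lemma parallel_letter: "(e, e') \<in> parallel_edges X \<Longrightarrow> letter_of e = letter_of e'"
proof -
  assume a: "(e, e') \<in> parallel_edges X"
  obtain a b c d where e: "e = (a, b)" "e' = (c, d)" by (metis prod.collapse)
  obtain p q where "valid a [p, q]" "valid a [q, p]" "b = nxt a p" "c = nxt a q" "d = nxt c p"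
    using parallel_letters[of a b c d] a e by metis
  then show ?thesis using e letter_of_nxt[of a p] letter_of_nxt[of c p] by (auto dest: valid_start)
qed

lemma parallel_rtrancl_letter: "(e, e') \<in> (parallel_edges X)\<^sup>* \<Longrightarrow> letter_of e = letter_of e'"
  by (induction rule: rtrancl_induct) (auto dest: parallel_letter)

lemma letter_of_flip:
  assumes "(x, y) \<in> oriented_edges X"
  shows "letter_of (y, x) = linv (letter_of (x, y))"
proof -
  obtain a where a: "valid x [a]" "y = nxt x a" using assms edgeE unfolding oriented_edges_def by blast
  have "f x = f y \<cdot> linv a" using step_linv[of "f x" a] f_nxt[of x a] a by simp
  then have "letter_of (y, x) = linv a" using letter_of_eq[of y "linv a" x] a by (auto dest: valid_start)
  then show ?thesis using letter_of_nxt a by simp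
qed

lemma square_parallel:
  assumes "comm a c" "valid x [a, c]" "f x \<cdot> c \<in> f ` VX"
  shows "((x, nxt x a), (nxt x c, nxt (nxt x a) c)) \<in> parallel_edges X"
proof -
  note s = square_nxt[OF assms]
  have o: "{x, nxt x a} \<union> {nxt x c, nxt (nxt x a) c} \<in> squares X" "{x, nxt x a} \<in> edges X" "{nxt x c, nxt (nxt x a) c} \<in> edges X"
    using s(3) unfolding s(2) opposite_edges_def by (simp_all only: mem_Collect_eq case_prod_conv)
  moreover have "{x, nxt x a} \<union> {nxt x c, nxt (nxt x a) c} = {x, nxt x a, nxt x c, nxt (nxt x a) c}" by auto
  moreover have "{x, nxt x c} \<in> edges X" "{nxt x a, nxt (nxt x a) c} \<in> edges X"
    using edge_nxt assms(2) s(1) by simp_all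
  ultimately show ?thesis by (simp add: parallel_edges_def)
qed

lemma opposite_parallel:
  assumes "({x, y}, {x', y'}) \<in> opposite_edges X"
  shows "((x, y), (x', y')) \<in> parallel_edges X \<or> ((x, y), (y', x')) \<in> parallel_edges X"
proof -
  have e: "{x, y} \<in> edges X" "{x', y'} \<in> edges X" using assms by (simp_all add: opposite_edges_def)
  obtain a where a: "valid x [a]" "y = nxt x a" using edgeE[OF e(1)] .
  have v: "x \<in> VX" "y \<in> VX" "x' \<in> VX" "y' \<in> VX" "a \<in> letters" using edge_vertices(1) e a by auto
  have fy: "f y = f x \<cdot> a" using a f_nxt[of x a] by simp
  have "({f x, f x \<cdot> a}, {f x', f y'}) \<in> opposite_edges S" using opposite_image[OF assms] fy by simp
  then obtain c where c: "comm a c" "{f x', f y'} = {f x \<cdot> c, f x \<cdot> c \<cdot> a}"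
    using opposite_edges_steps v f_carrier by metis
  have cl: "c \<in> letters" using comm_letters c by blast
  have par: "((x, y), (u, w)) \<in> parallel_edges X" if uw: "u \<in> VX" "w \<in> VX" "f u = f x \<cdot> c" "f w = f x \<cdot> c \<cdot> a" for u w
  proof -
    have fw: "f w = f y \<cdot> c" using uw fy step_comm[OF f_carrier[OF v(1)] c(1)] by simp
    have n: "nxt x c = u" "nxt y c = w" using nxt_eq uw fw by simp_all
    have im: "f x \<cdot> c \<in> f ` VX" "f y \<cdot> c \<in> f ` VX" using uw fw by (metis imageI)+
    have "valid x [a, c]" using a im cl n uw by simp
    then show ?thesis using square_parallel[OF c(1) _ im(1)] a n by simp
  qed
  consider "f x' = f x \<cdot> c" "f y' = f x \<cdot> c \<cdot> a" | "f y' = f x \<cdot> c" "f x' = f x \<cdot> c \<cdot> a"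
    using c(2) by (metis doubleton_eq_iff)
  then show ?thesis using par v by cases blast+
qed

lemma parallel_flip: "((a, b), (c, d)) \<in> parallel_edges X \<Longrightarrow> ((b, a), (d, c)) \<in> parallel_edges X"
  unfolding parallel_edges_def by (auto simp: insert_commute)

text \<open>Hyperplanes are classes of unoriented edges, so orientations may disagree.\<close>

lemma same_hyp_parallel:
  assumes "e \<in> oriented_edges X" "e' \<in> oriented_edges X" "hyp e = hyp e'"
  shows "(e, e') \<in> (parallel_edges X)\<^sup>* \<or> (e, (snd e', fst e')) \<in> (parallel_edges X)\<^sup>*"
proof -
  have "\<forall>x y. c = {x, y} \<longrightarrow> (e, (x, y)) \<in> (parallel_edges X)\<^sup>* \<or> (e, (y, x)) \<in> (parallel_edges X)\<^sup>*"
    if "({fst e, snd e}, c) \<in> (opposite_edges X)\<^sup>*" for c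
    using that
  proof (induction rule: rtrancl_induct)
    case base
    show ?case by (auto simp: doubleton_eq_iff)
  next
    case (step c d)
    show ?case
    proof (intro allI impI)
      fix x y assume d: "d = {x, y}"
      have "c \<in> edges X" using step.hyps(2) by (simp add: opposite_edges_def)
      then obtain u v where c: "c = {u, v}" unfolding edges_def by (auto simp: card_2_iff)
      have "((u, v), (x, y)) \<in> parallel_edges X \<or> ((u, v), (y, x)) \<in> parallel_edges X"
        using opposite_parallel step.hyps(2) c d by blast
      then have "((u, v), (x, y)) \<in> parallel_edges X \<and> ((v, u), (y, x)) \<in> parallel_edges X
        \<or> ((u, v), (y, x)) \<in> parallel_edges X \<and> ((v, u), (x, y)) \<in> parallel_edges X"
        using parallel_flip by blast
      moreover have "(e, (u, v)) \<in> (parallel_edges X)\<^sup>* \<or> (e, (v, u)) \<in> (parallel_edges X)\<^sup>*"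
        using step.IH c by blast
      ultimately show "(e, (x, y)) \<in> (parallel_edges X)\<^sup>* \<or> (e, (y, x)) \<in> (parallel_edges X)\<^sup>*"
        by (meson rtrancl_into_rtrancl)
    qed
  qed
  then show ?thesis using assms(3) unfolding hyp_eq_iff by (metis prod.collapse)
qed

end

section \<open>Special actions\<close>

locale special_complex = convex_in_salvetti V E X f for V E and X :: "'a set set" and f +
  fixes K :: "('g, 'm) monoid_scheme" and \<sigma> :: "'g \<Rightarrow> 'a \<Rightarrow> 'a" and \<psi>
  assumes action: "cubical_action K X \<sigma>"
    and \<psi>_hom: "\<psi> \<in> hom K (raag V E)"
    and f_equivariant: "\<forall>g\<in>carrier K. \<forall>x\<in>vertex_set X. f (\<sigma> g x) = \<psi> g \<otimes>\<^bsub>raag V E\<^esub> f x"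
begin

lemma group_action_X: "group_action K VX \<sigma>"
  using action by (simp add: cubical_action_def)

lemma \<psi>_carrier: "g \<in> carrier K \<Longrightarrow> \<psi> g \<in> carrier G"
  using \<psi>_hom by (auto simp: hom_def)

lemma \<sigma>_VX [simp]: "g \<in> carrier K \<Longrightarrow> x \<in> VX \<Longrightarrow> \<sigma> g x \<in> VX"
  using group_action.element_image[OF group_action_X] by blast

lemma \<sigma>_inj: "g \<in> carrier K \<Longrightarrow> inj_on (\<sigma> g) VX"
  using group_action.inj_prop[OF group_action_X] by blast

lemma K_group: "group K"
  using group_action_X unfolding group_action_def group_hom_def by blast

lemma \<sigma>_mult: "g \<in> carrier K \<Longrightarrow> h \<in> carrier K \<Longrightarrow> x \<in> VX \<Longrightarrow> \<sigma> (g \<otimes>\<^bsub>K\<^esub> h) x = \<sigma> g (\<sigma> h x)"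
  using group_action.composition_rule[OF group_action_X] by blast

lemma \<sigma>_inv: "g \<in> carrier K \<Longrightarrow> x \<in> VX \<Longrightarrow> \<sigma> (inv\<^bsub>K\<^esub> g) (\<sigma> g x) = x"
  using group_action.orbit_sym_aux[OF group_action_X] by blast

lemma inv_closed: "g \<in> carrier K \<Longrightarrow> inv\<^bsub>K\<^esub> g \<in> carrier K"
  using group.inv_closed[OF K_group] .

lemma f_\<sigma>: "g \<in> carrier K \<Longrightarrow> x \<in> VX \<Longrightarrow> f (\<sigma> g x) = \<psi> g \<otimes>\<^bsub>G\<^esub> f x"
  using f_equivariant by blast

lemma \<sigma>_cell:
  assumes "g \<in> carrier K" "c \<in> X"
  shows "\<sigma> g ` c \<in> X" "card (\<sigma> g ` c) = card c"
proof -
  show "\<sigma> g ` c \<in> X" using action assms by (auto simp: cubical_action_def)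
  have "c \<subseteq> VX" using assms by (auto simp: vertex_set_def)
  then show "card (\<sigma> g ` c) = card c" using \<sigma>_inj[OF assms(1)] by (meson card_image inj_on_subset)
qed

lemma \<sigma>_edge: "g \<in> carrier K \<Longrightarrow> e \<in> edges X \<Longrightarrow> \<sigma> g ` e \<in> edges X"
  using \<sigma>_cell by (simp add: edges_def)

lemma \<sigma>_square: "g \<in> carrier K \<Longrightarrow> q \<in> squares X \<Longrightarrow> \<sigma> g ` q \<in> squares X"
  using \<sigma>_cell by (simp add: squares_def)

lemma \<sigma>_nxt:
  assumes "g \<in> carrier K" "x \<in> VX" "a \<in> letters" "f x \<cdot> a \<in> f ` VX"
  shows "f (\<sigma> g x) \<cdot> a \<in> f ` VX" "nxt (\<sigma> g x) a = \<sigma> g (nxt x a)"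
proof -
  have n: "f (nxt x a) = f x \<cdot> a" "nxt x a \<in> VX" using f_nxt[OF assms(4)] by auto
  have e: "f (\<sigma> g (nxt x a)) = f (\<sigma> g x) \<cdot> a"
    using f_\<sigma>[OF assms(1) n(2)] f_\<sigma>[OF assms(1,2)] n(1)
      mult_act[OF \<psi>_carrier[OF assms(1)] f_carrier[OF assms(2)], of "[a]"] assms(3) by simp
  have v: "\<sigma> g (nxt x a) \<in> VX" using n(2) assms(1) by simp
  show "f (\<sigma> g x) \<cdot> a \<in> f ` VX" unfolding e[symmetric] using v by simp
  show "nxt (\<sigma> g x) a = \<sigma> g (nxt x a)" using nxt_eq[OF v e] .
qed

lemma \<sigma>_path:
  assumes "g \<in> carrier K" "valid x w"
  shows "valid (\<sigma> g x) w" "tgt (\<sigma> g x) w = \<sigma> g (tgt x w)" "eds (\<sigma> g x) w = map (map_prod (\<sigma> g) (\<sigma> g)) (eds x w)"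
    "vs (\<sigma> g x) w = map (\<sigma> g) (vs x w)"
  using assms(2)
proof (induction w arbitrary: x)
  case (Cons a w)
  { case 1 then show ?case using Cons.IH(1) \<sigma>_nxt[OF assms(1), of x a] assms(1) by auto }
  { case 2 then show ?case using Cons.IH(2) \<sigma>_nxt[OF assms(1), of x a] by auto }
  { case 3 then show ?case using Cons.IH(3) \<sigma>_nxt[OF assms(1), of x a] by auto }
  { case 4 then show ?case using Cons.IH(4) \<sigma>_nxt[OF assms(1), of x a] by auto }
qed (use assms(1) in simp_all)

abbreviation mv :: "'g \<Rightarrow> 'a \<times> 'a \<Rightarrow> 'a \<times> 'a" where "mv g \<equiv> map_prod (\<sigma> g) (\<sigma> g)"
abbreviation orb :: "'a \<times> 'a \<Rightarrow> ('a \<times> 'a) set" where "orb \<equiv> edge_orbit K \<sigma>"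
abbreviation label_of :: "'a \<times> 'a \<Rightarrow> ('a \<times> 'a) set set" where "label_of \<equiv> quotient_label K X \<sigma>"

lemma oriented_vertices: "e \<in> oriented_edges X \<Longrightarrow> fst e \<in> VX \<and> snd e \<in> VX"
  using edge_vertices(1)[of "{fst e, snd e}"] by (auto simp: oriented_edges_def)

lemma mv_oriented: "g \<in> carrier K \<Longrightarrow> e \<in> oriented_edges X \<Longrightarrow> mv g e \<in> oriented_edges X"
  using \<sigma>_edge[of g "{fst e, snd e}"] by (auto simp: oriented_edges_def)

lemma mv_parallel: "g \<in> carrier K \<Longrightarrow> (e, e') \<in> parallel_edges X \<Longrightarrow> (mv g e, mv g e') \<in> parallel_edges X"
  unfolding parallel_edges_def
proof clarsimp
  fix a b c d
  assume g: "g \<in> carrier K" and "{a, b, c, d} \<in> squares X" "{a, b} \<in> edges X" "{c, d} \<in> edges X" "{a, c} \<in> edges X" "{b, d} \<in> edges X"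
  then show "{\<sigma> g a, \<sigma> g b, \<sigma> g c, \<sigma> g d} \<in> squares X \<and> {\<sigma> g a, \<sigma> g b} \<in> edges X \<and> {\<sigma> g c, \<sigma> g d} \<in> edges X \<and>
     {\<sigma> g a, \<sigma> g c} \<in> edges X \<and> {\<sigma> g b, \<sigma> g d} \<in> edges X"
    using \<sigma>_square[OF g, of "{a, b, c, d}"] \<sigma>_edge[OF g, of "{a, b}"] \<sigma>_edge[OF g, of "{c, d}"]
      \<sigma>_edge[OF g, of "{a, c}"] \<sigma>_edge[OF g, of "{b, d}"] by simp
qed

lemma mv_letter:
  assumes "g \<in> carrier K" "e \<in> oriented_edges X"
  shows "letter_of (mv g e) = letter_of e"
proof -
  obtain x y where e: "e = (x, y)" by fastforce
  have "{x, y} \<in> edges X" using assms(2) by (simp add: e oriented_edges_def)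
  then obtain a where a: "valid x [a]" "y = nxt x a" by (rule edgeE)
  have "\<sigma> g y = nxt (\<sigma> g x) a" using \<sigma>_nxt[OF assms(1)] a by simp
  then show ?thesis using letter_of_nxt[OF \<sigma>_path(1)[OF assms(1) a(1)]] letter_of_nxt[OF a(1)] e a(2) by simp
qed

lemma orb_mem: "e \<in> oriented_edges X \<Longrightarrow> e \<in> orb e"
proof -
  assume "e \<in> oriented_edges X"
  then have v: "fst e \<in> VX" "snd e \<in> VX" using oriented_vertices by auto
  have one: "\<one>\<^bsub>K\<^esub> \<in> carrier K" using K_group by (simp add: group.is_monoid)
  have "\<sigma> \<one>\<^bsub>K\<^esub> x = x" if "x \<in> VX" for x
    using \<sigma>_inv[OF one that] \<sigma>_mult[OF inv_closed[OF one] one that] group.l_inv[OF K_group one] by simp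
  then have "mv \<one>\<^bsub>K\<^esub> e = e" using v by (cases e) simp
  then show ?thesis using one unfolding edge_orbit_def orbit_def by force
qed

lemma mv_mult:
  "g \<in> carrier K \<Longrightarrow> h \<in> carrier K \<Longrightarrow> e \<in> oriented_edges X \<Longrightarrow> mv (g \<otimes>\<^bsub>K\<^esub> h) e = mv g (mv h e)"
  using \<sigma>_mult oriented_vertices[of e] by (cases e) simp

lemma orb_mv:
  assumes "g \<in> carrier K" "e \<in> oriented_edges X"
  shows "orb (mv g e) = orb e"
proof
  have c: "h \<otimes>\<^bsub>K\<^esub> k \<in> carrier K" if "h \<in> carrier K" "k \<in> carrier K" for h k
    using that K_group by (simp add: group.is_monoid monoid.m_closed)
  have sub: "orb (mv g e) \<subseteq> orb e" if "g \<in> carrier K" "e \<in> oriented_edges X" for g e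
  proof
    fix d assume "d \<in> orb (mv g e)"
    then obtain h where h: "h \<in> carrier K" "d = mv h (mv g e)" by (auto simp: edge_orbit_def orbit_def)
    then have "d = mv (h \<otimes>\<^bsub>K\<^esub> g) e" using mv_mult that by simp
    then show "d \<in> orb e" using c h that unfolding edge_orbit_def orbit_def by blast
  qed
  show "orb (mv g e) \<subseteq> orb e" using sub assms .
  have "mv (inv\<^bsub>K\<^esub> g) (mv g e) = e"
    using \<sigma>_inv[OF assms(1)] oriented_vertices[OF assms(2)] by (cases e) simp
  then show "orb e \<subseteq> orb (mv g e)"
    using sub[OF inv_closed[OF assms(1)] mv_oriented[OF assms]] by simp
qed

lemma orb_eqE:
  assumes "orb e = orb e'" "e' \<in> oriented_edges X"
  obtains g where "g \<in> carrier K" "e' = mv g e"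
proof -
  have "e' \<in> orb e" using orb_mem[OF assms(2)] assms(1) by simp
  then show ?thesis using that by (auto simp: edge_orbit_def orbit_def)
qed

text \<open>
  Whenever two orbits of edges are parallel in the quotient, a translation moves the witnesses to any
  given representative of the first orbit, so chains of parallel orbits lift edge by edge.\<close>

lemma label_of_lift:
  assumes "Q \<in> label_of e" "e \<in> oriented_edges X"
  shows "\<exists>e'. (e, e') \<in> (parallel_edges X)\<^sup>* \<and> e' \<in> oriented_edges X \<and> Q = orb e'"
proof -
  have "(orb e, Q) \<in> (quotient_parallel K X \<sigma>)\<^sup>*" using assms(1) by (simp add: quotient_label_def)
  then show ?thesis
  proof (induction rule: rtrancl_induct)
    case base
    then show ?case using assms(2) by blast
  next
    case (step Q1 Q2)
    then obtain e1 where e1: "(e, e1) \<in> (parallel_edges X)\<^sup>*" "e1 \<in> oriented_edges X" "Q1 = orb e1" by blast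
    obtain d d' where d: "Q1 = orb d" "Q2 = orb d'" "(d, d') \<in> parallel_edges X"
      using step.hyps(2) by (auto simp: quotient_parallel_def)
    have od: "d \<in> oriented_edges X" "d' \<in> oriented_edges X" using parallel_oriented[OF d(3)] by auto
    have "orb d = orb e1" using d(1) e1(3) by simp
    then obtain g where g: "g \<in> carrier K" "e1 = mv g d" using orb_eqE e1(2) by blast
    have "(e1, mv g d') \<in> parallel_edges X" using mv_parallel[OF g(1) d(3)] g(2) by simp
    then show ?case
      using e1(1) mv_oriented[OF g(1) od(2)] orb_mv[OF g(1) od(2)] d(2)
      by (intro exI[of _ "mv g d'"]) (auto intro: rtrancl_into_rtrancl)
  qed
qed

lemma quotient_parallel_sym: "(Q1, Q2) \<in> (quotient_parallel K X \<sigma>)\<^sup>* \<Longrightarrow> (Q2, Q1) \<in> (quotient_parallel K X \<sigma>)\<^sup>*"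
proof -
  have "sym (quotient_parallel K X \<sigma>)"
    unfolding sym_def quotient_parallel_def using parallel_sym by blast
  then show "(Q1, Q2) \<in> (quotient_parallel K X \<sigma>)\<^sup>* \<Longrightarrow> (Q2, Q1) \<in> (quotient_parallel K X \<sigma>)\<^sup>*"
    using sym_rtrancl symD by metis
qed

lemma label_of_eqI: "(orb e, orb e') \<in> (quotient_parallel K X \<sigma>)\<^sup>* \<Longrightarrow> label_of e = label_of e'"
  unfolding quotient_label_def using quotient_parallel_sym by (auto intro: rtrancl_trans)

lemma orb_in_lab: "orb e \<in> label_of e"
  by (simp add: quotient_label_def)

lemma label_of_mv: "g \<in> carrier K \<Longrightarrow> e \<in> oriented_edges X \<Longrightarrow> label_of (mv g e) = label_of e"
  using orb_mv by (simp add: quotient_label_def)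

lemma label_of_parallel: "(e, e') \<in> (parallel_edges X)\<^sup>* \<Longrightarrow> label_of e = label_of e'"
proof (induction rule: rtrancl_induct)
  case (step e' e'')
  then have "(orb e', orb e'') \<in> quotient_parallel K X \<sigma>" unfolding quotient_parallel_def by blast
  then show ?case using label_of_eqI step.IH by blast
qed simp

text \<open>
  Parallelism and translations both preserve letters, so the label of an edge in the quotient determines
  its letter. Hence a path is determined by its first vertex and its labels.\<close>

lemma label_of_eq_parallel:
  assumes "label_of e = label_of e'" "e \<in> oriented_edges X" "e' \<in> oriented_edges X"
  shows "\<exists>g\<in>carrier K. (e, mv g e') \<in> (parallel_edges X)\<^sup>*"
proof -
  have "orb e' \<in> label_of e" using orb_in_lab assms(1) by blast
  then obtain d where d: "(e, d) \<in> (parallel_edges X)\<^sup>*" "d \<in> oriented_edges X" "orb e' = orb d"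
    using label_of_lift[OF _ assms(2)] by blast
  then show ?thesis using orb_eqE[OF d(3,2)] by metis
qed

lemma label_of_letter:
  assumes "label_of e = label_of e'" "e \<in> oriented_edges X" "e' \<in> oriented_edges X"
  shows "letter_of e = letter_of e'"
proof -
  obtain g where g: "g \<in> carrier K" "(e, mv g e') \<in> (parallel_edges X)\<^sup>*" using label_of_eq_parallel[OF assms] by blast
  then show ?thesis using parallel_rtrancl_letter mv_letter assms(3) by metis
qed

definition labels :: "'a \<Rightarrow> letter list \<Rightarrow> ('a \<times> 'a) set set list" where
  "labels x w = map label_of (eds x w)"

lemma labels_simps [simp]: "labels x [] = []" "labels x (a # w) = label_of (x, nxt x a) # labels (nxt x a) w"
  "labels x (u @ v) = labels x u @ labels (tgt x u) v" "length (labels x w) = length w"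
  by (simp_all add: labels_def)

lemma labels_\<sigma>: "g \<in> carrier K \<Longrightarrow> valid x w \<Longrightarrow> labels (\<sigma> g x) w = labels x w"
  unfolding labels_def using \<sigma>_path(3)[of g x w] label_of_mv eds_oriented by simp

lemma labels_inj:
  assumes "valid x w" "valid x' w'" "labels x w = labels x' w'"
  shows "w = w'"
proof -
  have len: "length (eds x w) = length (eds x' w')" using arg_cong[OF assms(3), of length] by simp
  have "map letter_of (eds x w) = map letter_of (eds x' w')"
  proof (rule nth_equalityI)
    fix i assume "i < length (map letter_of (eds x w))"
    then have i: "i < length (eds x w)" "i < length (eds x' w')" using len by simp_all
    have "label_of (eds x w ! i) = label_of (eds x' w' ! i)"
      using arg_cong[OF assms(3)[unfolded labels_def], of "\<lambda>l. l ! i"] i by simp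
    then have "letter_of (eds x w ! i) = letter_of (eds x' w' ! i)"
      using label_of_letter eds_oriented[OF assms(1) nth_mem[OF i(1)]] eds_oriented[OF assms(2) nth_mem[OF i(2)]] by blast
    then show "map letter_of (eds x w) ! i = map letter_of (eds x' w') ! i" using i by simp
  qed (use len in simp)
  then show ?thesis using letter_of_eds assms by simp
qed

lemma represents_labels: "valid x w \<Longrightarrow> represents K X \<sigma> (vs x w) (labels x w)"
  unfolding represents_def labels_def eds_def using comb_path_vs by simp

lemma geodesic_representative_labels:
  assumes "valid x w" "reduced w"
  shows "geodesic_representative K X \<sigma> x (labels x w) \<gamma> \<longleftrightarrow> \<gamma> = vs x w"
proof
  assume "geodesic_representative K X \<sigma> x (labels x w) \<gamma>"
  then have g: "hd \<gamma> = x" "comb_path X \<gamma>" "labels x w = map label_of (zip \<gamma> (tl \<gamma>))"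
    by (auto simp: geodesic_representative_def represents_def)
  obtain v where v: "valid x v" "\<gamma> = vs x v" using comb_path_word[OF g(2)] g(1) by blast
  then have "labels x w = labels x v" using g(3) by (simp add: labels_def eds_def)
  then show "\<gamma> = vs x w" using labels_inj[OF assms(1) v(1)] v(2) by simp
next
  assume "\<gamma> = vs x w"
  then show "geodesic_representative K X \<sigma> x (labels x w) \<gamma>"
    using represents_labels assms geodesic_vs[OF assms(1)] by (simp add: geodesic_representative_def)
qed

lemma unique_representative:
  assumes "valid x w" "reduced w"
  shows "\<exists>!\<gamma>. geodesic_representative K X \<sigma> x (labels x w) \<gamma>"
    "the_geodesic K X \<sigma> x (labels x w) = vs x w" "endpoint K X \<sigma> x (labels x w) = tgt x w"
  unfolding the_geodesic_def endpoint_def geodesic_representative_labels[OF assms] by simp_all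

lemma labels_hyperplanes: "valid x w \<Longrightarrow> set (labels x w) \<subseteq> quotient_oriented_hyperplanes K X \<sigma>"
  unfolding labels_def quotient_oriented_hyperplanes_def quotient_def quotient_label_def
  using eds_oriented by fastforce

lemma orbit_eqE:
  assumes "orbit K \<sigma> x = orbit K \<sigma> y" "x \<in> VX" "y \<in> VX"
  obtains g where "g \<in> carrier K" "y = \<sigma> g x"
proof -
  have "y \<in> orbit K \<sigma> x" using group_action.orbit_refl[OF group_action_X assms(3)] assms(1) by simp
  then show ?thesis using that by (auto simp: orbit_def)
qed

lemma orbit_\<sigma>: "g \<in> carrier K \<Longrightarrow> x \<in> VX \<Longrightarrow> orbit K \<sigma> (\<sigma> g x) = orbit K \<sigma> x"
proof -
  assume a: "g \<in> carrier K" "x \<in> VX"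
  have c: "h \<otimes>\<^bsub>K\<^esub> k \<in> carrier K" if "h \<in> carrier K" "k \<in> carrier K" for h k
    using that K_group by (simp add: group.is_monoid monoid.m_closed)
  have sub: "orbit K \<sigma> (\<sigma> g x) \<subseteq> orbit K \<sigma> x" if "g \<in> carrier K" "x \<in> VX" for g x
  proof
    fix y assume "y \<in> orbit K \<sigma> (\<sigma> g x)"
    then obtain h where h: "h \<in> carrier K" "y = \<sigma> h (\<sigma> g x)" by (auto simp: orbit_def)
    then have "y = \<sigma> (h \<otimes>\<^bsub>K\<^esub> g) x" using \<sigma>_mult[OF h(1) that] by simp
    then show "y \<in> orbit K \<sigma> x" using c[OF h(1) that(1)] unfolding orbit_def by blast
  qed
  have "orbit K \<sigma> (\<sigma> (inv\<^bsub>K\<^esub> g) (\<sigma> g x)) \<subseteq> orbit K \<sigma> (\<sigma> g x)" using sub a inv_closed by simp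
  then show ?thesis using sub[OF a] \<sigma>_inv[OF a] by simp
qed

end

section \<open>Automata with lookahead\<close>

context pre_digraph
begin

lemma cas_snoc: "cas u (p @ [e]) v \<longleftrightarrow> cas u p (tail G e) \<and> head G e = v"
  by (induction p arbitrary: u) auto

lemma awalk_snoc:
  "awalk u (p @ [e]) v \<longleftrightarrow> awalk u p (tail G e) \<and> e \<in> arcs G \<and> head G e = v"
  unfolding awalk_def cas_snoc by auto

lemma awalk_verts_snoc: "cas u p (tail G e) \<Longrightarrow> awalk_verts u (p @ [e]) = awalk_verts u p @ [head G e]"
  by (induction p arbitrary: u) auto

end

text \<open>A prefix-closed language with a right congruence \<open>\<kappa>\<close> of finite index is recognized by the automaton
  on the classes of \<open>\<kappa>\<close>. Here a state also announces the label of the next arc, so that functions of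
  states may depend on it. The announcements along an accepted path are dictated by the word, except for
  the one of its last vertex; so a path is determined by its word and its last vertex, and a word is
  represented by a bounded number of paths. The state \<open>(k, None)\<close> announces the end of the path.\<close>

lemma lookahead_automaton:
  fixes L :: "'s list set" and \<kappa> :: "'s list \<Rightarrow> 'k"
  assumes finS: "finite S" and LS: "L \<subseteq> lists S" and Nil: "[] \<in> L"
    and prefix_closed: "\<forall>w s. w @ [s] \<in> L \<longrightarrow> w \<in> L"
    and fin: "finite (\<kappa> ` L)"
    and congruence: "\<forall>w\<in>L. \<forall>w'\<in>L. \<forall>s. \<kappa> w = \<kappa> w' \<longrightarrow> w' @ [s] \<in> L \<longrightarrow>
      w @ [s] \<in> L \<and> \<kappa> (w @ [s]) = \<kappa> (w' @ [s])"
  shows "\<exists>(\<A> :: (nat, nat, 's) automaton) st.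
    automaton_over S \<A> \<and> pruned \<A> \<and> final \<A> = verts (graph \<A>) \<and> language \<A> = L \<and>
    (\<exists>C::nat. C \<ge> 1 \<and> (\<forall>w\<in>L. finite (initial_paths \<A> w) \<and> card (initial_paths \<A> w) \<le> C)) \<and>
    fst ` st ` verts (graph \<A>) \<subseteq> \<kappa> ` L \<and>
    (\<forall>w\<in>L. \<forall>(u, p)\<in>initial_paths \<A> w.
       map (\<lambda>e. (st (tail (graph \<A>) e), label \<A> e)) p
         = map (\<lambda>i. ((\<kappa> (take i w), Some (w ! i)), w ! i)) [0..<length w] \<and>
       map (fst \<circ> st) (pre_digraph.awalk_verts (graph \<A>) u p)
         = map (\<lambda>i. \<kappa> (take i w)) [0..<Suc (length w)])"
proof -
  note prefix = prefix_closed[rule_format] and cong = congruence[rule_format]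
  define N where "N = insert None (Some ` S)"
  define Q where "Q = \<kappa> ` L \<times> N"
  define T where "T = {((\<kappa> w, Some s), s, (\<kappa> (w @ [s]), n)) | w s n. w @ [s] \<in> L \<and> n \<in> N}"
  have inS: "s \<in> S" if "w @ [s] \<in> L" for w s using LS that by auto
  have finN: "finite N" using finS by (simp add: N_def)
  have finQ: "finite Q" using fin finN by (simp add: Q_def)
  have "T \<subseteq> Q \<times> S \<times> Q" unfolding T_def Q_def N_def using prefix inS by auto
  then have finT: "finite T" using finQ finS by (meson finite_SigmaI finite_subset)
  obtain eQ :: "('k \<times> 's option) \<Rightarrow> nat" where eQ: "inj_on eQ Q"
    using finite_imp_inj_to_nat_seg[OF finQ] by blast
  obtain eT :: "(('k \<times> 's option) \<times> 's \<times> ('k \<times> 's option)) \<Rightarrow> nat" where eT: "inj_on eT T"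
    using finite_imp_inj_to_nat_seg[OF finT] by blast
  define st where "st = inv_into Q eQ"
  define tr where "tr = inv_into T eT"
  have st [simp]: "st (eQ q) = q" if "q \<in> Q" for q using eQ that by (simp add: st_def)
  have tr [simp]: "tr (eT t) = t" if "t \<in> T" for t using eT that by (simp add: tr_def)
  define D :: "(nat, nat) pre_digraph" where
    "D = \<lparr>verts = eQ ` Q, arcs = eT ` T, tail = \<lambda>e. eQ (fst (tr e)), head = \<lambda>e. eQ (snd (snd (tr e)))\<rparr>"
  define \<A> :: "(nat, nat, 's) automaton" where
    "\<A> = \<lparr>graph = D, label = \<lambda>e. fst (snd (tr e)), initial = eQ ` ({\<kappa> []} \<times> N), final = eQ ` Q\<rparr>"
  have \<A>: "graph \<A> = D" "label \<A> = (\<lambda>e. fst (snd (tr e)))" "initial \<A> = eQ ` ({\<kappa> []} \<times> N)" "final \<A> = eQ ` Q"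
    by (simp_all add: \<A>_def)
  have D: "verts D = eQ ` Q" "arcs D = eT ` T" "tail D e = eQ (fst (tr e))" "head D e = eQ (snd (snd (tr e)))" for e
    by (simp_all add: D_def)
  have QI: "(\<kappa> w, n) \<in> Q" if "w \<in> L" "n \<in> N" for w n using that by (simp add: Q_def)
  have someN: "Some s \<in> N" if "w @ [s] \<in> L" for w s using inS[OF that] by (simp add: N_def)
  interpret D: pre_digraph D .
  have arcD: "\<exists>w n. w @ [label \<A> e] \<in> L \<and> n \<in> N \<and> tail D e = eQ (\<kappa> w, Some (label \<A> e)) \<and>
      head D e = eQ (\<kappa> (w @ [label \<A> e]), n) \<and> tr e = ((\<kappa> w, Some (label \<A> e)), label \<A> e, (\<kappa> (w @ [label \<A> e]), n))"
    if ein: "e \<in> arcs D" for e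
  proof -
    obtain t where t: "t \<in> T" "e = eT t" using ein unfolding D(2) by blast
    obtain w s n where "t = ((\<kappa> w, Some s), s, (\<kappa> (w @ [s]), n))" "w @ [s] \<in> L" "n \<in> N"
      using t(1) by (auto simp: T_def)
    then show ?thesis using t by (intro exI[of _ w] exI[of _ n]) (simp add: \<A> D)
  qed
  have wf: "fin_digraph D"
  proof
    fix e assume "e \<in> arcs D"
    then obtain w n where e: "w @ [label \<A> e] \<in> L" "n \<in> N" "tail D e = eQ (\<kappa> w, Some (label \<A> e))"
      "head D e = eQ (\<kappa> (w @ [label \<A> e]), n)" using arcD by blast
    show "tail D e \<in> verts D" unfolding e(3) D(1) using QI[OF prefix[OF e(1)] someN[OF e(1)]] by simp
    show "head D e \<in> verts D" unfolding e(4) D(1) using QI[OF e(1,2)] by simp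
  qed (simp_all add: D finQ finT)
  have initQ: "{\<kappa> []} \<times> N \<subseteq> Q" using Nil by (auto simp: Q_def)
  have NoneN: "None \<in> N" by (simp add: N_def)
  have build: "\<exists>u\<in>initial \<A>. \<exists>p. D.awalk u p (eQ (\<kappa> w, n)) \<and> map (label \<A>) p = w" if "w \<in> L" "n \<in> N" for w n
    using that
  proof (induction w arbitrary: n rule: rev_induct)
    case Nil
    have "eQ (\<kappa> [], n) \<in> initial \<A>" using Nil by (simp add: \<A>)
    moreover have "D.awalk (eQ (\<kappa> [], n)) [] (eQ (\<kappa> [], n))"
      using Nil QI by (simp add: D.awalk_def D)
    ultimately show ?case by (metis list.simps(8))
  next
    case (snoc s w)
    obtain u p where u: "u \<in> initial \<A>" "D.awalk u p (eQ (\<kappa> w, Some s))" "map (label \<A>) p = w"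
      using snoc.IH[OF prefix[OF snoc.prems(1)] someN[OF snoc.prems(1)]] by blast
    define t where "t = ((\<kappa> w, Some s), s, (\<kappa> (w @ [s]), n))"
    have t: "t \<in> T" using snoc.prems by (auto simp: T_def t_def)
    have "tail D (eT t) = eQ (\<kappa> w, Some s)" "head D (eT t) = eQ (\<kappa> (w @ [s]), n)" "label \<A> (eT t) = s" "eT t \<in> arcs D"
      using t by (simp_all add: D \<A>) (simp_all add: t_def)
    then have "D.awalk u (p @ [eT t]) (eQ (\<kappa> (w @ [s]), n))" "map (label \<A>) (p @ [eT t]) = w @ [s]"
      using u by (simp_all add: D.awalk_snoc)
    then show ?case using u(1) by blast
  qed
  have read: "map (label \<A>) p \<in> L \<and> (\<exists>n\<in>N. v = eQ (\<kappa> (map (label \<A>) p), n)) \<and>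
      map (\<lambda>e. (st (tail D e), label \<A> e)) p
         = map (\<lambda>i. ((\<kappa> (take i (map (label \<A>) p)), Some (map (label \<A>) p ! i)), map (label \<A>) p ! i)) [0..<length p] \<and>
      map (fst \<circ> st) (D.awalk_verts u p) = map (\<lambda>i. \<kappa> (take i (map (label \<A>) p))) [0..<Suc (length p)]"
    if init: "u \<in> initial \<A>" and "D.awalk u p v" for u p v
    using that(2)
  proof (induction p arbitrary: v rule: rev_induct)
    case Nil
    obtain n where n: "n \<in> N" "u = eQ (\<kappa> [], n)" using init by (auto simp: \<A>)
    moreover have "v = u" using Nil by (simp add: D.awalk_def)
    ultimately show ?case using \<open>[] \<in> L\<close> QI by auto
  next
    case (snoc e p)
    define w where "w = map (label \<A>) p"
    have e: "D.awalk u p (tail D e)" "e \<in> arcs D" "head D e = v" using snoc.prems by (simp_all add: D.awalk_snoc)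
    have IH: "w \<in> L" "\<exists>n\<in>N. tail D e = eQ (\<kappa> w, n)"
      "map (\<lambda>e. (st (tail D e), label \<A> e)) p = map (\<lambda>i. ((\<kappa> (take i w), Some (w ! i)), w ! i)) [0..<length p]"
      "map (fst \<circ> st) (D.awalk_verts u p) = map (\<lambda>i. \<kappa> (take i w)) [0..<Suc (length p)]"
      using snoc.IH[OF e(1)] unfolding w_def by blast+
    define s where "s = label \<A> e"
    obtain w0 n where w0: "w0 @ [s] \<in> L" "n \<in> N" "tail D e = eQ (\<kappa> w0, Some s)" "head D e = eQ (\<kappa> (w0 @ [s]), n)"
      using arcD[OF e(2)] unfolding s_def by blast
    obtain m where m: "m \<in> N" "tail D e = eQ (\<kappa> w, m)" using IH(2) by blast
    have "(\<kappa> w0, Some s) = (\<kappa> w, m)"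
      using inj_onD[OF eQ, of "(\<kappa> w0, Some s)" "(\<kappa> w, m)"] w0(3) m QI[OF IH(1) m(1)]
        QI[OF prefix[OF w0(1)] someN[OF w0(1)]] by simp
    then have k: "\<kappa> w = \<kappa> w0" "m = Some s" by simp_all
    have ws: "w @ [s] \<in> L" "\<kappa> (w @ [s]) = \<kappa> (w0 @ [s])"
      using cong[OF IH(1) prefix[OF w0(1)] k(1) w0(1)] by auto
    have len: "length w = length p" by (simp add: w_def)
    have v: "v = eQ (\<kappa> (w @ [s]), n)" using e(3) w0(4) ws(2) by simp
    have stt: "st (tail D e) = (\<kappa> w, Some s)" using m k QI[OF IH(1) m(1)] by simp
    have sth: "fst (st (head D e)) = \<kappa> (w @ [s])" using v e(3) QI[OF ws(1) w0(2)] by simp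
    have A: "map (label \<A>) (p @ [e]) = w @ [s]" by (simp add: w_def s_def)
    have B: "map (\<lambda>e. (st (tail D e), label \<A> e)) (p @ [e])
        = map (\<lambda>i. ((\<kappa> (take i (w @ [s])), Some ((w @ [s]) ! i)), (w @ [s]) ! i)) [0..<length (p @ [e])]"
      using IH(3) len stt by (simp add: s_def nth_append)
    have "D.awalk_verts u (p @ [e]) = D.awalk_verts u p @ [head D e]"
      using e(1) by (intro D.awalk_verts_snoc) (simp add: D.awalk_def)
    then have C: "map (fst \<circ> st) (D.awalk_verts u (p @ [e])) = map (\<lambda>i. \<kappa> (take i (w @ [s]))) [0..<Suc (length (p @ [e]))]"
      using IH(4) sth len by simp
    show ?case unfolding A using ws(1) v w0(2) B C by blast
  qed
  \<comment> \<open>read backwards, a path is determined by its labels: the class of the tail of an arc is that of the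
    word read before, and its announcement is the label of the arc\<close>
  have unique: "u = u' \<and> p = p'"
    if "u \<in> initial \<A>" "u' \<in> initial \<A>" "D.awalk u p v" "D.awalk u' p' v" "map (label \<A>) p = map (label \<A>) p'" for u u' p p' v
    using that(3-5)
  proof (induction p arbitrary: v p' rule: rev_induct)
    case Nil
    then show ?case by (simp add: D.awalk_def)
  next
    case (snoc e p)
    obtain e' p'' where p': "p' = p'' @ [e']" using snoc.prems(3) by (cases p' rule: rev_cases) auto
    have e: "D.awalk u p (tail D e)" "e \<in> arcs D" "head D e = v" using snoc.prems by (simp_all add: D.awalk_snoc)
    have e': "D.awalk u' p'' (tail D e')" "e' \<in> arcs D" "head D e' = v" using snoc.prems p' by (simp_all add: D.awalk_snoc)
    have l: "map (label \<A>) p = map (label \<A>) p''" "label \<A> e = label \<A> e'" using snoc.prems(3) p' by simp_all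
    obtain w n where w: "w @ [label \<A> e] \<in> L" "n \<in> N" "tail D e = eQ (\<kappa> w, Some (label \<A> e))" "head D e = eQ (\<kappa> (w @ [label \<A> e]), n)"
      "tr e = ((\<kappa> w, Some (label \<A> e)), label \<A> e, (\<kappa> (w @ [label \<A> e]), n))"
      using arcD[OF e(2)] by blast
    obtain w' n' where w': "w' @ [label \<A> e] \<in> L" "n' \<in> N" "tail D e' = eQ (\<kappa> w', Some (label \<A> e))" "head D e' = eQ (\<kappa> (w' @ [label \<A> e]), n')"
      "tr e' = ((\<kappa> w', Some (label \<A> e)), label \<A> e, (\<kappa> (w' @ [label \<A> e]), n'))"
      using arcD[OF e'(2)] unfolding l(2)[symmetric] by blast
    have st1: "st (tail D e) = (\<kappa> w, Some (label \<A> e))" "st (tail D e') = (\<kappa> w', Some (label \<A> e))"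
      unfolding w(3) w'(3) using QI[OF prefix[OF w(1)] someN[OF w(1)]] QI[OF prefix[OF w'(1)] someN[OF w'(1)]] by simp_all
    have "fst (st (tail D e)) = \<kappa> (map (label \<A>) p)" "fst (st (tail D e')) = \<kappa> (map (label \<A>) p'')"
      using read[OF that(1) e(1)] read[OF that(2) e'(1)] QI by auto
    then have k: "\<kappa> w = \<kappa> w'" using st1 l(1) by simp
    have "(\<kappa> (w @ [label \<A> e]), n) = (\<kappa> (w' @ [label \<A> e]), n')"
      using inj_onD[OF eQ] e(3) e'(3) w(4) w'(4) QI[OF w(1,2)] QI[OF w'(1,2)] by metis
    then have "tr e = tr e'" using w(5) w'(5) k by simp
    moreover have "e = eT (tr e)" "e' = eT (tr e')" using e(2) e'(2) D(2) by auto
    ultimately have "e = e'" by simp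
    then show ?case using snoc.IH[OF e(1) _ l(1)] e'(1) p' by simp
  qed
  have lang: "language \<A> = L"
  proof
    show "language \<A> \<subseteq> L" using read unfolding language_def \<A>(1) by blast
    show "L \<subseteq> language \<A>"
    proof
      fix w assume w: "w \<in> L"
      obtain u p where "u \<in> initial \<A>" "D.awalk u p (eQ (\<kappa> w, None))" "map (label \<A>) p = w"
        using build[OF w NoneN] by blast
      moreover have "eQ (\<kappa> w, None) \<in> final \<A>" using QI[OF w NoneN] by (simp add: \<A>)
      ultimately show "w \<in> language \<A>" unfolding language_def \<A>(1) by blast
    qed
  qed
  have count: "finite (initial_paths \<A> w) \<and> card (initial_paths \<A> w) \<le> Suc (card (verts D))" for w
  proof -
    define F where "F = (\<lambda>(u, p). SOME v. D.awalk u p v)"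
    have F: "D.awalk u p (F (u, p))" if "(u, p) \<in> initial_paths \<A> w" for u p
    proof -
      have "\<exists>v. D.awalk u p v" using that by (auto simp: initial_paths_def \<A>(1))
      then show ?thesis unfolding F_def prod.case by (rule someI_ex)
    qed
    have inj: "inj_on F (initial_paths \<A> w)"
    proof (rule inj_onI, clarify)
      fix u p u' p' assume a: "(u, p) \<in> initial_paths \<A> w" "(u', p') \<in> initial_paths \<A> w" "F (u, p) = F (u', p')"
      show "u = u' \<and> p = p'"
        using unique[of u u' p "F (u, p)" p'] F[OF a(1)] F[OF a(2)] a by (simp add: initial_paths_def)
    qed
    have sub: "F ` initial_paths \<A> w \<subseteq> verts D"
    proof clarify
      fix u p assume a: "(u, p) \<in> initial_paths \<A> w"
      then have "u \<in> initial \<A>" by (simp add: initial_paths_def)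
      then show "F (u, p) \<in> verts D" using read[OF _ F[OF a]] QI by (auto simp: D)
    qed
    have fV: "finite (verts D)" using finQ by (simp add: D)
    show ?thesis using inj_on_finite[OF inj sub fV] card_inj_on_le[OF inj sub fV] by simp
  qed
  have auto: "automaton_over S \<A>"
    unfolding automaton_over_def
  proof (intro conjI)
    show "finite S" using finS .
    show "fin_digraph (graph \<A>)" using wf \<A>(1) by simp
    show "label \<A> ` arcs (graph \<A>) \<subseteq> S" using arcD inS unfolding \<A>(1) by blast
    show "initial \<A> \<noteq> {}" using NoneN by (auto simp: \<A>)
    show "initial \<A> \<subseteq> verts (graph \<A>)" unfolding \<A>(1,3) D(1) using initQ by (rule image_mono)
    show "final \<A> \<noteq> {}" using QI[OF Nil NoneN] by (auto simp: \<A>)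
    show "final \<A> \<subseteq> verts (graph \<A>)" unfolding \<A>(1,4) D(1) by simp
  qed
  have pr: "pruned \<A>"
    unfolding pruned_def \<A>(1) D(1) using build by (force simp: Q_def)
  have st_ran: "fst ` st ` verts (graph \<A>) \<subseteq> \<kappa> ` L"
    unfolding \<A>(1) D(1) by (auto simp: Q_def intro: rev_image_eqI)
  have data: "map (\<lambda>e. (st (tail (graph \<A>) e), label \<A> e)) p
         = map (\<lambda>i. ((\<kappa> (take i w), Some (w ! i)), w ! i)) [0..<length w] \<and>
       map (fst \<circ> st) (pre_digraph.awalk_verts (graph \<A>) u p)
         = map (\<lambda>i. \<kappa> (take i w)) [0..<Suc (length w)]"
    if ip: "(u, p) \<in> initial_paths \<A> w" for w u p
  proof -
    obtain v where v: "u \<in> initial \<A>" "D.awalk u p v" "w = map (label \<A>) p"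
      using ip unfolding initial_paths_def \<A>(1) by blast
    then have "length w = length p" by simp
    then show ?thesis unfolding \<A>(1) using read[OF v(1,2)] v(3) by simp
  qed
  show ?thesis
  proof (intro exI[of _ \<A>] exI[of _ st] conjI)
    show "\<exists>C::nat. C \<ge> 1 \<and> (\<forall>w\<in>L. finite (initial_paths \<A> w) \<and> card (initial_paths \<A> w) \<le> C)"
      using count by (intro exI[of _ "Suc (card (verts D))"]) simp
    show "final \<A> = verts (graph \<A>)" by (simp add: \<A> D)
    show "\<forall>w\<in>L. \<forall>(u, p)\<in>initial_paths \<A> w.
       map (\<lambda>e. (st (tail (graph \<A>) e), label \<A> e)) p
         = map (\<lambda>i. ((\<kappa> (take i w), Some (w ! i)), w ! i)) [0..<length w] \<and>
       map (fst \<circ> st) (pre_digraph.awalk_verts (graph \<A>) u p)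
         = map (\<lambda>i. \<kappa> (take i w)) [0..<Suc (length w)]"
      using data by blast
  qed (use auto pr lang st_ran in auto)
qed

section \<open>Restriction quotients\<close>

lemma concat_eq_append_Cons:
  "concat xss = p @ x # s \<Longrightarrow>
    \<exists>xss1 ys zs xss2. xss = xss1 @ (ys @ x # zs) # xss2 \<and> p = concat xss1 @ ys \<and> s = zs @ concat xss2"
proof (induction xss arbitrary: p)
  case (Cons l xss)
  show ?case
  proof (cases "length p < length l")
    case True
    have "p = take (length p) l" using arg_cong[OF Cons.prems, of "take (length p)"] True by simp
    then obtain r where r: "l = p @ r" by (metis append_take_drop_id)
    then have "r @ concat xss = x # s" "r \<noteq> []" using Cons.prems True by auto
    then obtain zs where "r = x # zs" "s = zs @ concat xss" by (cases r) auto
    then show ?thesis using r by (intro exI[of _ "[]"] exI[of _ p] exI[of _ zs] exI[of _ xss]) simp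
  next
    case False
    have "l = take (length l) p" using arg_cong[OF Cons.prems, of "take (length l)"] False by simp
    then obtain p' where p': "p = l @ p'" by (metis append_take_drop_id)
    then obtain xss1 ys zs xss2 where "xss = xss1 @ (ys @ x # zs) # xss2" "p' = concat xss1 @ ys" "s = zs @ concat xss2"
      using Cons.IH[of p'] Cons.prems by auto
    then show ?thesis using p' by (intro exI[of _ "l # xss1"] exI[of _ ys] exI[of _ zs] exI[of _ xss2]) simp
  qed
qed simp

locale special_restriction =
  Zc: special_complex VZ AZ Z fZ K \<rho> \<psi>Z + Xc: special_complex VX AX X fX K \<sigma> \<psi>X
  for VZ AZ and Z :: "'a set set" and fZ and K :: "('g, 'm) monoid_scheme" and \<rho> \<psi>Z
    and VX AX and X :: "'b set set" and fX and \<sigma> \<psi>X +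
  fixes W :: "'a set set set" and \<phi> :: "'a \<Rightarrow> 'b"
  assumes restriction: "restriction_quotient Z W X \<phi>"
    and \<phi>_equivariant: "\<forall>g\<in>carrier K. \<forall>x\<in>vertex_set Z. \<phi> (\<rho> g x) = \<sigma> g (\<phi> x)"
begin

abbreviation kept :: "'a \<times> 'a \<Rightarrow> bool" where "kept e \<equiv> \<phi> (fst e) \<noteq> \<phi> (snd e)"
abbreviation \<phi>e :: "'a \<times> 'a \<Rightarrow> 'b \<times> 'b" where "\<phi>e \<equiv> map_prod \<phi> \<phi>"

lemma X_image: "X = (`) \<phi> ` Z"
  using restriction by (simp add: restriction_quotient_def)

lemma \<phi>_vertex [simp]: "z \<in> vertex_set Z \<Longrightarrow> \<phi> z \<in> vertex_set X"
  unfolding vertex_set_def X_image by blast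

lemma \<phi>_surj: "x \<in> vertex_set X \<Longrightarrow> \<exists>z\<in>vertex_set Z. \<phi> z = x"
  unfolding vertex_set_def X_image by blast

lemma \<phi>_\<rho>: "g \<in> carrier K \<Longrightarrow> z \<in> vertex_set Z \<Longrightarrow> \<phi> (\<rho> g z) = \<sigma> g (\<phi> z)"
  using \<phi>_equivariant by blast

lemma kept_edge:
  assumes "e \<in> oriented_edges Z" "kept e"
  shows "\<phi>e e \<in> oriented_edges X"
proof -
  obtain a b where e: "e = (a, b)" by fastforce
  have "{a, b} \<in> Z" using assms(1) by (simp add: e oriented_edges_def edges_def)
  then have "\<phi> ` {a, b} \<in> X" unfolding X_image by (rule imageI)
  then show ?thesis using assms(2) by (simp add: e oriented_edges_def edges_def)
qed

lemma edge_kept: "\<phi>e e \<in> oriented_edges X \<Longrightarrow> kept e"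
  by (auto simp: oriented_edges_def edges_def map_prod_def split: prod.splits)

lemma hyp_hyperplane: "e \<in> oriented_edges Z \<Longrightarrow> Zc.hyp e \<in> hyperplanes Z"
  unfolding hyperplanes_def Zc.hyp_def oriented_edges_def by (auto intro: quotientI)

lemma hyp_mem: "{fst e, snd e} \<in> Zc.hyp e"
  by (simp add: Zc.hyp_def)

lemma kept_iff_hyp:
  assumes "e \<in> oriented_edges Z"
  shows "kept e \<longleftrightarrow> Zc.hyp e \<in> W"
proof -
  have "card (\<phi> ` {fst e, snd e}) = 1 \<longleftrightarrow> Zc.hyp e \<notin> W"
    using restriction hyp_hyperplane[OF assms] hyp_mem[of e] unfolding restriction_quotient_def by blast
  moreover have "card (\<phi> ` {fst e, snd e}) = 1 \<longleftrightarrow> \<not> kept e" by (simp add: card_insert_if)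
  ultimately show ?thesis by blast
qed

lemma kept_parallel: "e \<in> oriented_edges Z \<Longrightarrow> e' \<in> oriented_edges Z \<Longrightarrow> Zc.hyp e = Zc.hyp e' \<Longrightarrow> kept e \<longleftrightarrow> kept e'"
  using kept_iff_hyp by simp

text \<open>The image is a whole hyperplane of \<open>X\<close>, and hyperplanes containing a common edge coincide.\<close>

lemma hyp_image:
  assumes "e \<in> oriented_edges Z" "kept e"
  shows "(`) \<phi> ` Zc.hyp e = Xc.hyp (\<phi>e e)"
proof -
  have "(`) \<phi> ` Zc.hyp e \<in> hyperplanes X"
    using restriction kept_iff_hyp[OF assms(1)] assms(2) unfolding restriction_quotient_def bij_betw_def by blast
  then obtain c where c: "(`) \<phi> ` Zc.hyp e = (opposite_edges X)\<^sup>* `` {c}"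
    unfolding hyperplanes_def by (elim quotientE)
  have "\<phi> ` {fst e, snd e} \<in> (`) \<phi> ` Zc.hyp e" using hyp_mem by (rule imageI)
  then have m: "(c, {\<phi> (fst e), \<phi> (snd e)}) \<in> (opposite_edges X)\<^sup>*" unfolding c by simp
  show ?thesis
    unfolding c Xc.hyp_def using rtrancl_trans[OF m] rtrancl_trans[OF Xc.opposite_rtrancl_sym[OF m]]
    by (auto simp: map_prod_def split: prod.splits)
qed

text \<open>This is the injectivity of the map from \<open>W\<close> to the hyperplanes of \<open>X\<close>.\<close>

lemma hyp_image_iff:
  assumes "e \<in> oriented_edges Z" "kept e" "e' \<in> oriented_edges Z" "kept e'"
  shows "Xc.hyp (\<phi>e e) = Xc.hyp (\<phi>e e') \<longleftrightarrow> Zc.hyp e = Zc.hyp e'"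
proof -
  have "inj_on (\<lambda>h. (`) \<phi> ` h) W"
    using restriction unfolding restriction_quotient_def bij_betw_def by blast
  then show ?thesis
    using inj_onD[of "\<lambda>h. (`) \<phi> ` h" W "Zc.hyp e" "Zc.hyp e'"] kept_iff_hyp assms hyp_image by metis
qed

lemma image_path:
  assumes "Zc.valid z w"
  shows "\<exists>v. Xc.valid (\<phi> z) v \<and> Xc.tgt (\<phi> z) v = \<phi> (Zc.tgt z w) \<and>
    Xc.eds (\<phi> z) v = map \<phi>e (filter kept (Zc.eds z w))"
  using assms
proof (induction w arbitrary: z)
  case Nil
  then show ?case by (intro exI[of _ "[]"]) simp
next
  case (Cons a w)
  then obtain v where v: "Xc.valid (\<phi> (Zc.nxt z a)) v" "Xc.tgt (\<phi> (Zc.nxt z a)) v = \<phi> (Zc.tgt z (a # w))"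
    "Xc.eds (\<phi> (Zc.nxt z a)) v = map \<phi>e (filter kept (Zc.eds (Zc.nxt z a) w))"
    by auto
  show ?case
  proof (cases "\<phi> z = \<phi> (Zc.nxt z a)")
    case True
    then show ?thesis using v by (intro exI[of _ v]) simp
  next
    case False
    have "(z, Zc.nxt z a) \<in> oriented_edges Z" using Zc.eds_oriented[OF Cons.prems, of "(z, Zc.nxt z a)"] by simp
    then have "(\<phi> z, \<phi> (Zc.nxt z a)) \<in> oriented_edges X" using kept_edge[of "(z, Zc.nxt z a)"] False by simp
    then have "{\<phi> z, \<phi> (Zc.nxt z a)} \<in> edges X" by (simp add: oriented_edges_def)
    then obtain b where b: "Xc.valid (\<phi> z) [b]" "\<phi> (Zc.nxt z a) = Xc.nxt (\<phi> z) b" by (rule Xc.edgeE)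
    show ?thesis using v b False by (intro exI[of _ "b # v"]) simp
  qed
qed

lemma distinct_hyp_image:
  assumes "set es \<subseteq> oriented_edges Z" "distinct (map Zc.hyp es)"
  shows "distinct (map Xc.hyp (map \<phi>e (filter kept es)))"
  using assms
proof (induction es)
  case (Cons e es)
  have "Xc.hyp (\<phi>e e) \<noteq> Xc.hyp (\<phi>e e')" if "kept e" "e' \<in> set es" "kept e'" for e'
    using hyp_image_iff[of e e'] that Cons.prems by auto
  then show ?case using Cons by auto
qed simp

text \<open>The image of a geodesic, once its constant pieces are removed, crosses no hyperplane twice.\<close>

lemma image_geodesic:
  assumes "Zc.valid z w" "Zc.reduced w"
  shows "\<exists>v. Xc.valid (\<phi> z) v \<and> Xc.tgt (\<phi> z) v = \<phi> (Zc.tgt z w) \<and>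
    Xc.eds (\<phi> z) v = map \<phi>e (filter kept (Zc.eds z w)) \<and> Xc.reduced v"
proof -
  obtain v where v: "Xc.valid (\<phi> z) v" "Xc.tgt (\<phi> z) v = \<phi> (Zc.tgt z w)"
    "Xc.eds (\<phi> z) v = map \<phi>e (filter kept (Zc.eds z w))" using image_path[OF assms(1)] by blast
  have "set (Zc.eds z w) \<subseteq> oriented_edges Z" using Zc.eds_oriented[OF assms(1)] by blast
  then have "distinct (map Xc.hyp (Xc.eds (\<phi> z) v))"
    unfolding v(3) using distinct_hyp_image Zc.reduced_iff_distinct_hyp[OF assms(1)] assms(2) by blast
  then have "Xc.reduced v" using Xc.reduced_iff_distinct_hyp[OF v(1)] by blast
  then show ?thesis using v by blast
qed

text \<open>The image of the path is a closed geodesic, so it is constant: fibres are convex.\<close>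

lemma fibre_geodesic:
  assumes "Zc.valid z w" "Zc.reduced w" "\<phi> (Zc.tgt z w) = \<phi> z"
  shows "\<forall>e\<in>set (Zc.eds z w). \<not> kept e"
proof -
  obtain v where v: "Xc.valid (\<phi> z) v" "Xc.tgt (\<phi> z) v = \<phi> (Zc.tgt z w)"
    "Xc.eds (\<phi> z) v = map \<phi>e (filter kept (Zc.eds z w))" "Xc.reduced v"
    using image_geodesic[OF assms(1,2)] by blast
  have "Xc.valid (\<phi> z) []" using v(1) Xc.valid_start by simp
  then have "Xc.wordeq [] v" using Xc.same_tgt_wordeq v(1,2) assms(3) by simp
  then have "length v \<le> length ([] :: letter list)" by (rule Xc.reduced_length[OF v(4)])
  then have "v = []" by simp
  then have "filter kept (Zc.eds z w) = []" using v(3) by simp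
  then show ?thesis by (simp add: filter_empty_conv)
qed

lemma not_kept_path: "\<forall>e\<in>set (Zc.eds z w). \<not> kept e \<Longrightarrow> \<phi> (Zc.tgt z w) = \<phi> z"
  by (induction w arbitrary: z) auto

text \<open>
  Lift the far end of the edge to a vertex \<open>u\<close> and take a geodesic from \<open>z\<close> to \<open>u\<close>. Its image is a geodesic
  with the ends of the given edge, so exactly one edge of the geodesic is kept.\<close>

lemma fibre_crossing:
  assumes "z \<in> vertex_set Z" "Xc.valid (\<phi> z) [b]"
  shows "\<exists>w a. Zc.valid z (w @ [a]) \<and> \<phi> (Zc.tgt z w) = \<phi> z \<and> \<phi> (Zc.tgt z (w @ [a])) = Xc.nxt (\<phi> z) b"
proof -
  obtain u where u: "u \<in> vertex_set Z" "\<phi> u = Xc.nxt (\<phi> z) b" using \<phi>_surj Xc.valid_tgt[OF assms(2)] by auto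
  obtain w where w: "Zc.reduced w" "Zc.valid z w" "Zc.tgt z w = u" using Zc.connected[OF assms(1) u(1)] by blast
  obtain v where v: "Xc.valid (\<phi> z) v" "Xc.tgt (\<phi> z) v = \<phi> u"
    "Xc.eds (\<phi> z) v = map \<phi>e (filter kept (Zc.eds z w))" "Xc.reduced v"
    using image_geodesic[OF w(2,1)] w(3) by blast
  have "{\<phi> z, Xc.nxt (\<phi> z) b} \<in> edges X" using assms(2) Xc.edge_nxt by simp
  then have ne: "\<phi> z \<noteq> Xc.nxt (\<phi> z) b" by (auto simp: edges_def)
  have "Xc.wordeq [b] v" using Xc.same_tgt_wordeq[OF assms(2) v(1)] v(2) u(2) by simp
  then have "length v \<le> length [b]" by (rule Xc.reduced_length[OF v(4)])
  moreover have "v \<noteq> []" using v(2) u(2) ne by auto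
  ultimately obtain c where c: "v = [c]" by (cases v; cases "tl v") auto
  then have single: "map \<phi>e (filter kept (Zc.eds z w)) = [(\<phi> z, Xc.nxt (\<phi> z) b)]"
    using v(2,3) u(2) by simp
  then obtain e where e: "filter kept (Zc.eds z w) = [e]" "\<phi>e e = (\<phi> z, Xc.nxt (\<phi> z) b)"
    by (cases "filter kept (Zc.eds z w)") auto
  obtain E1 E2 where E: "Zc.eds z w = E1 @ e # E2" "\<forall>d\<in>set E1. \<not> kept d"
    using filter_eq_ConsD[OF e(1)] by blast
  define i where "i = length E1"
  have i: "i < length w" using arg_cong[OF E(1), of length] by (simp add: i_def)
  have w': "w = take i w @ w ! i # drop (Suc i) w" using i by (simp add: id_take_nth_drop)
  have eds: "Zc.eds z w = Zc.eds z (take i w) @ (Zc.tgt z (take i w), Zc.tgt z (take i w @ [w ! i])) # Zc.eds (Zc.tgt z (take i w @ [w ! i])) (drop (Suc i) w)"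
    using Zc.eds_split w' by metis
  have "length (Zc.eds z (take i w)) = length E1" using i by (simp add: i_def)
  then have s: "Zc.eds z (take i w) = E1" "e = (Zc.tgt z (take i w), Zc.tgt z (take i w @ [w ! i]))"
    using eds E(1) by auto
  have "\<phi> (Zc.tgt z (take i w)) = \<phi> z" using not_kept_path s(1) E(2) by blast
  moreover have "\<phi> (Zc.tgt z (take i w @ [w ! i])) = Xc.nxt (\<phi> z) b" using e(2) s(2) by simp
  moreover have "Zc.valid z (take i w @ [w ! i])"
  proof -
    have "Zc.valid z ((take i w @ [w ! i]) @ drop (Suc i) w)" using w(2) w' by simp
    then show ?thesis unfolding Zc.valid_append by blast
  qed
  ultimately show ?thesis by blast
qed

section \<open>Labels of lifted edges\<close>

abbreviation incl where "incl \<equiv> hyperplane_inclusion K Z \<rho> X \<sigma> \<phi>"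

text \<open>A square of \<open>Z\<close> with a kept edge is mapped to a square or collapsed in the other direction. No diagonal can be collapsed:
  otherwise two consecutive edges of the square would cross the same hyperplane of \<open>X\<close>, hence of \<open>Z\<close>.\<close>

lemma parallel_image:
  assumes "(e, e') \<in> parallel_edges Z" "kept e"
  shows "kept e' \<and> (\<phi>e e, \<phi>e e') \<in> (parallel_edges X)\<^sup>*"
proof -
  obtain a b c d where e: "e = (a, b)" "e' = (c, d)" by (metis prod.collapse)
  note par = assms(1)[unfolded e]
  have o: "(a, b) \<in> oriented_edges Z" "(c, d) \<in> oriented_edges Z" using Zc.parallel_oriented[OF par] by auto
  have k': "kept (c, d)"
    using kept_parallel[OF o] Zc.parallel_rtrancl_hyp[OF r_into_rtrancl[OF par]] assms(2) e by simp
  have par2: "((a, c), (b, d)) \<in> parallel_edges Z"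
    using par unfolding parallel_edges_def by (simp add: insert_commute)
  have o2: "(a, c) \<in> oriented_edges Z" "(b, d) \<in> oriented_edges Z" using Zc.parallel_oriented[OF par2] by auto
  have h2: "Zc.hyp (a, c) = Zc.hyp (b, d)" using Zc.parallel_rtrancl_hyp[OF r_into_rtrancl[OF par2]] .
  show ?thesis
  proof (cases "\<phi> a = \<phi> c")
    case True
    then have "\<phi> b = \<phi> d" using kept_parallel[OF o2 h2] by simp
    then show ?thesis using True k' e by simp
  next
    case False
    then have k2: "\<phi> b \<noteq> \<phi> d" using kept_parallel[OF o2 h2] by simp
    obtain p q where pq: "Zc.comm p q" "Zc.valid a [p, q]" "b = Zc.nxt a p" "d = Zc.nxt b q"
      using Zc.parallel_letters[OF par] by metis
    have "distinct (map Zc.hyp (Zc.eds a [p, q]))"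
      using Zc.reduced_iff_distinct_hyp[OF pq(2)] Zc.reduced_pair[OF pq(1)] by blast
    then have hne: "Zc.hyp (a, b) \<noteq> Zc.hyp (b, d)" using pq by simp
    \<comment> \<open>the two diagonals of the square are not collapsed\<close>
    have kab: "\<phi> a \<noteq> \<phi> b" using assms(2) e by simp
    have ad: "\<phi> a \<noteq> \<phi> d"
    proof
      assume "\<phi> a = \<phi> d"
      then have "Xc.hyp (\<phi>e (a, b)) = Xc.hyp (\<phi>e (b, d))" by (simp add: Xc.hyp_def insert_commute)
      then show False using hyp_image_iff[OF o(1) _ o2(2)] kab k2 hne by simp
    qed
    have bc: "\<phi> b \<noteq> \<phi> c"
    proof
      assume "\<phi> b = \<phi> c"
      then have "Xc.hyp (\<phi>e (a, b)) = Xc.hyp (\<phi>e (a, c))" by simp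
      then show False using hyp_image_iff[OF o(1) _ o2(1)] kab False hne h2 by simp
    qed
    have "{a, b, c, d} \<in> Z" using par by (simp add: parallel_edges_def squares_def)
    then have "\<phi> ` {a, b, c, d} \<in> X" unfolding X_image by (rule imageI)
    moreover have "card (\<phi> ` {a, b, c, d}) = 4" using ad bc kab k2 k' False by (simp add: card_insert_if)
    ultimately have "{\<phi> a, \<phi> b, \<phi> c, \<phi> d} \<in> squares X" by (simp add: squares_def)
    moreover have "{\<phi> a, \<phi> b} \<in> edges X" "{\<phi> c, \<phi> d} \<in> edges X" "{\<phi> a, \<phi> c} \<in> edges X" "{\<phi> b, \<phi> d} \<in> edges X"
      using kept_edge[OF o(1)] kept_edge[OF o(2)] kept_edge[OF o2(1)] kept_edge[OF o2(2)] kab k' k2 False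
      by (simp_all add: oriented_edges_def)
    ultimately have "(\<phi>e e, \<phi>e e') \<in> parallel_edges X" by (simp add: e parallel_edges_def)
    then show ?thesis using k' e by blast
  qed
qed

lemma parallel_rtrancl_image:
  assumes "(e, e') \<in> (parallel_edges Z)\<^sup>*" "kept e"
  shows "kept e' \<and> (\<phi>e e, \<phi>e e') \<in> (parallel_edges X)\<^sup>*"
  using assms(1)
proof (induction rule: rtrancl_induct)
  case (step e' e'')
  then show ?case using parallel_image[of e' e''] by (meson rtrancl_trans)
qed (use assms(2) in simp)

lemma \<phi>e_mv: "g \<in> carrier K \<Longrightarrow> e \<in> oriented_edges Z \<Longrightarrow> \<phi>e (Zc.mv g e) = Xc.mv g (\<phi>e e)"
  using Zc.oriented_vertices[of e] \<phi>_\<rho> by (cases e) simp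

text \<open>By definition, the inclusion of hyperplanes collects the lifts of the edges with a given label.
  They all have the same label, because two lifts of parallel edges are dual to the same hyperplane of
  \<open>Z\<close>; their orientations agree since the letter of an edge is not its own inverse.\<close>

lemma label_of_kept:
  assumes "e \<in> oriented_edges Z" "kept e"
  shows "Zc.label_of e = incl (Xc.label_of (\<phi>e e))"
proof
  show "Zc.label_of e \<subseteq> incl (Xc.label_of (\<phi>e e))"
  proof
    fix Q assume "Q \<in> Zc.label_of e"
    then obtain e' where e': "(e, e') \<in> (parallel_edges Z)\<^sup>*" "e' \<in> oriented_edges Z" "Q = Zc.orb e'"
      using Zc.label_of_lift assms(1) by blast
    have k: "kept e'" "(\<phi>e e, \<phi>e e') \<in> (parallel_edges X)\<^sup>*" using parallel_rtrancl_image[OF e'(1) assms(2)] by auto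
    have "Xc.orb (\<phi>e e') \<in> Xc.label_of (\<phi>e e)" using Xc.label_of_parallel[OF k(2)] Xc.orb_in_lab by simp
    then show "Q \<in> incl (Xc.label_of (\<phi>e e))"
      unfolding hyperplane_inclusion_def using e'(2,3) kept_edge[OF e'(2) k(1)] by blast
  qed
  show "incl (Xc.label_of (\<phi>e e)) \<subseteq> Zc.label_of e"
  proof
    fix Q assume "Q \<in> incl (Xc.label_of (\<phi>e e))"
    then obtain e' where e': "Q = Zc.orb e'" "e' \<in> oriented_edges Z" "\<phi>e e' \<in> oriented_edges X"
      "Xc.orb (\<phi>e e') \<in> Xc.label_of (\<phi>e e)" unfolding hyperplane_inclusion_def by blast
    obtain d where d: "(\<phi>e e, d) \<in> (parallel_edges X)\<^sup>*" "d \<in> oriented_edges X" "Xc.orb (\<phi>e e') = Xc.orb d"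
      using Xc.label_of_lift[OF e'(4) kept_edge[OF assms]] by blast
    obtain g where g: "g \<in> carrier K" "d = Xc.mv g (\<phi>e e')" using Xc.orb_eqE[OF d(3,2)] .
    define e'' where "e'' = Zc.mv g e'"
    have o: "e'' \<in> oriented_edges Z" using Zc.mv_oriented[OF g(1) e'(2)] by (simp add: e''_def)
    have de: "d = \<phi>e e''" using g(2) \<phi>e_mv[OF g(1) e'(2)] by (simp add: e''_def)
    have k: "kept e''" using edge_kept d(2) de by simp
    have "Zc.hyp e = Zc.hyp e''"
      using Xc.parallel_rtrancl_hyp[OF d(1)] hyp_image_iff[OF assms o k] de by simp
    then consider "(e, e'') \<in> (parallel_edges Z)\<^sup>*" | "(e, (snd e'', fst e'')) \<in> (parallel_edges Z)\<^sup>*"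
      using Zc.same_hyp_parallel[OF assms(1) o] by blast
    then show "Q \<in> Zc.label_of e"
    proof cases
      case 1
      have "Q = Zc.orb e''" using e'(1,2) Zc.orb_mv[OF g(1)] by (simp add: e''_def)
      then show ?thesis using Zc.label_of_parallel[OF 1] Zc.orb_in_lab[of e''] by simp
    next
      case 2
      \<comment> \<open>the lifts are parallel with opposite orientations, which would make a letter its own inverse\<close>
      have "(\<phi>e e, (\<phi> (snd e''), \<phi> (fst e''))) \<in> (parallel_edges X)\<^sup>*"
        using parallel_rtrancl_image[OF 2 assms(2)] by simp
      then have "Xc.letter_of (\<phi>e e) = Xc.letter_of (\<phi> (snd e''), \<phi> (fst e''))" by (rule Xc.parallel_rtrancl_letter)
      moreover have "(\<phi> (fst e''), \<phi> (snd e'')) = d" using de by (simp add: map_prod_def split: prod.splits)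
      moreover have "Xc.letter_of (\<phi>e e) = Xc.letter_of d" using Xc.parallel_rtrancl_letter[OF d(1)] .
      ultimately show ?thesis using Xc.letter_of_flip[of "\<phi> (fst e'')" "\<phi> (snd e'')"] d(2) by simp
    qed
  qed
qed

text \<open>The orbits of edges collected by the inclusion consist of kept edges.\<close>

lemma label_of_collapsed:
  assumes "e \<in> oriented_edges Z" "\<not> kept e"
  shows "Zc.label_of e \<notin> range incl"
proof
  assume "Zc.label_of e \<in> range incl"
  then obtain s where "Zc.orb e \<in> incl s" using Zc.orb_in_lab[of e] by blast
  then obtain e' where e': "Zc.orb e' = Zc.orb e" "e' \<in> oriented_edges Z" "\<phi>e e' \<in> oriented_edges X"
    unfolding hyperplane_inclusion_def by blast
  obtain g where g: "g \<in> carrier K" "e = Zc.mv g e'" using Zc.orb_eqE[OF e'(1) assms(1)] .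
  have "\<phi>e e \<in> oriented_edges X" using \<phi>e_mv[OF g(1) e'(2)] Xc.mv_oriented[OF g(1) e'(3)] g(2) by simp
  then show False using edge_kept assms(2) by blast
qed

section \<open>Lifting paths from the quotient\<close>

text \<open>A pair \<open>(w, a)\<close> is a crossing path if \<open>w\<close> leads from \<open>z\<close> to a vertex of the same fibre and \<open>a\<close> then crosses
  over the edge with letter \<open>b\<close>.\<close>

definition crossing_path :: "'a \<Rightarrow> letter \<Rightarrow> letter list \<times> letter \<Rightarrow> bool" where
  "crossing_path z b q \<longleftrightarrow> Zc.valid z (fst q @ [snd q]) \<and> \<phi> (Zc.tgt z (fst q)) = \<phi> z \<and>
     \<phi> (Zc.tgt z (fst q @ [snd q])) = Xc.nxt (\<phi> z) b"

definition shortest_crossing :: "'a \<Rightarrow> letter \<Rightarrow> letter list \<times> letter \<Rightarrow> bool" where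
  "shortest_crossing z b q \<longleftrightarrow> crossing_path z b q \<and>
     (\<forall>q'. crossing_path z b q' \<longrightarrow> length (fst q) \<le> length (fst q'))"

definition lift :: "'a \<Rightarrow> letter \<Rightarrow> letter list \<times> letter" where
  "lift z b = (SOME q. shortest_crossing z b q)"

definition lifted :: "'a \<Rightarrow> letter \<Rightarrow> letter list" where
  "lifted z b = fst (lift z b) @ [snd (lift z b)]"

text \<open>The lift of a path moves each time along the chosen shortest crossing path; \<open>ztgt z u\<close> is the last vertex
  of the lift of the path reading \<open>u\<close> from \<open>\<phi> z\<close>.\<close>

definition znxt :: "'a \<Rightarrow> letter \<Rightarrow> 'a" where
  "znxt z b = Zc.tgt z (lifted z b)"

primrec lift_blocks :: "'a \<Rightarrow> letter list \<Rightarrow> letter list list" where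
  "lift_blocks z [] = []"
| "lift_blocks z (b # u) = lifted z b # lift_blocks (znxt z b) u"

definition lift_word :: "'a \<Rightarrow> letter list \<Rightarrow> letter list" where
  "lift_word z u = concat (lift_blocks z u)"

definition ztgt :: "'a \<Rightarrow> letter list \<Rightarrow> 'a" where
  "ztgt z u = foldl znxt z u"

lemma lift_shortest:
  assumes "z \<in> vertex_set Z" "Xc.valid (\<phi> z) [b]"
  shows "shortest_crossing z b (lift z b)"
proof -
  obtain w a where "crossing_path z b (w, a)" using fibre_crossing[OF assms] by (auto simp: crossing_path_def)
  then obtain q where "crossing_path z b q" "\<forall>q'. crossing_path z b q' \<longrightarrow> length (fst q) \<le> length (fst q')"
    using ex_has_least_nat[of "crossing_path z b" "(w, a)" "\<lambda>q. length (fst q)"] by blast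
  then have "\<exists>q. shortest_crossing z b q" unfolding shortest_crossing_def by blast
  then show ?thesis unfolding lift_def by (rule someI_ex)
qed

lemma lift_props:
  assumes "z \<in> vertex_set Z" "Xc.valid (\<phi> z) [b]"
  shows "Zc.valid z (lifted z b)" "\<phi> (znxt z b) = Xc.nxt (\<phi> z) b" "\<phi> (Zc.tgt z (fst (lift z b))) = \<phi> z"
    "\<forall>e\<in>set (Zc.eds z (fst (lift z b))). \<not> kept e" "kept (Zc.tgt z (fst (lift z b)), znxt z b)"
    "Zc.reduced (lifted z b)"
proof -
  obtain w a where q: "lift z b = (w, a)" by (metis surj_pair)
  have s: "crossing_path z b (w, a)" and min: "\<And>q'. crossing_path z b q' \<Longrightarrow> length w \<le> length (fst q')"
    using lift_shortest[OF assms] unfolding q shortest_crossing_def fst_conv by blast+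
  have wa: "Zc.valid z (w @ [a])" "\<phi> (Zc.tgt z w) = \<phi> z" "\<phi> (Zc.tgt z (w @ [a])) = Xc.nxt (\<phi> z) b"
    using s by (simp_all add: crossing_path_def)
  have l: "lifted z b = w @ [a]" by (simp add: lifted_def q)
  show "Zc.valid z (lifted z b)" "\<phi> (znxt z b) = Xc.nxt (\<phi> z) b" "\<phi> (Zc.tgt z (fst (lift z b))) = \<phi> z"
    unfolding znxt_def l using wa q by simp_all
  have vw: "Zc.valid z w" "Zc.valid (Zc.tgt z w) [a]" using wa(1) unfolding Zc.valid_append by auto
  have rw: "Zc.reduced w"
  proof -
    obtain w' where w': "Zc.wordeq w' w" "Zc.reduced w'" using Zc.reduced_exists[OF Zc.valid_words[OF vw(1)]] by blast
    have v': "Zc.valid z w'" "Zc.tgt z w' = Zc.tgt z w" using Zc.reduced_valid_wordeq[OF vw(1) Zc.wordeq_sym[OF w'(1)] w'(2)] by auto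
    then have "crossing_path z b (w', a)" using wa vw by (simp add: crossing_path_def)
    then have "length w \<le> length w'" using min by fastforce
    moreover have "length w' \<le> length w" using Zc.reduced_length[OF w'(2) Zc.wordeq_sym[OF w'(1)]] .
    ultimately show ?thesis using Zc.reduced_wordeq[OF w'(2,1)] by simp
  qed
  show nk: "\<forall>e\<in>set (Zc.eds z (fst (lift z b))). \<not> kept e" using fibre_geodesic[OF vw(1) rw wa(2)] q by simp
  have "{\<phi> z, Xc.nxt (\<phi> z) b} \<in> edges X" using assms(2) Xc.edge_nxt by simp
  then have ne: "\<phi> z \<noteq> Xc.nxt (\<phi> z) b" by (auto simp: edges_def)
  then show k: "kept (Zc.tgt z (fst (lift z b)), znxt z b)" using wa(2,3) by (simp add: q znxt_def l)
  have o: "set (Zc.eds z (w @ [a])) \<subseteq> oriented_edges Z" using Zc.eds_oriented[OF wa(1)] by blast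
  have "Zc.hyp e \<noteq> Zc.hyp (Zc.tgt z w, Zc.tgt z (w @ [a]))" if "e \<in> set (Zc.eds z w)" for e
    using kept_parallel[of e "(Zc.tgt z w, Zc.tgt z (w @ [a]))"] nk k that o by (auto simp: q znxt_def l)
  then have "distinct (map Zc.hyp (Zc.eds z (w @ [a])))"
    using Zc.reduced_iff_distinct_hyp[OF vw(1)] rw by (auto simp: image_iff)
  then show "Zc.reduced (lifted z b)" unfolding l using Zc.reduced_iff_distinct_hyp[OF wa(1)] by blast
qed

lemma crossing_path_equivariant:
  assumes "g \<in> carrier K" "z \<in> vertex_set Z" "Xc.valid (\<phi> z) [b]" "crossing_path z b q"
  shows "crossing_path (\<rho> g z) b q"
proof -
  have v: "Zc.valid z (fst q @ [snd q])" "\<phi> (Zc.tgt z (fst q)) = \<phi> z" "\<phi> (Zc.tgt z (fst q @ [snd q])) = Xc.nxt (\<phi> z) b"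
    using assms(4) by (simp_all only: crossing_path_def)
  have vq: "Zc.valid z (fst q)" using v(1) unfolding Zc.valid_append by blast
  have "Xc.nxt (\<sigma> g (\<phi> z)) b = \<sigma> g (Xc.nxt (\<phi> z) b)" using Xc.\<sigma>_nxt[OF assms(1)] assms(3) by simp
  then show ?thesis
    using Zc.\<sigma>_path(1,2)[OF assms(1) v(1)] Zc.\<sigma>_path(2)[OF assms(1) vq] v(2,3)
      \<phi>_\<rho>[OF assms(1,2)] \<phi>_\<rho>[OF assms(1) Zc.valid_tgt[OF v(1)]] \<phi>_\<rho>[OF assms(1) Zc.valid_tgt[OF vq]]
    unfolding crossing_path_def by (simp only:)
qed

text \<open>The choice made by \<open>lift\<close> only depends on the set of shortest crossing paths, which is the same for
  all translates of \<open>z\<close>.\<close>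

lemma lift_equivariant:
  assumes "g \<in> carrier K" "z \<in> vertex_set Z" "Xc.valid (\<phi> z) [b]"
  shows "lift (\<rho> g z) b = lift z b" "znxt (\<rho> g z) b = \<rho> g (znxt z b)"
proof -
  have v': "Xc.valid (\<phi> (\<rho> g z)) [b]" using Xc.\<sigma>_path(1)[OF assms(1,3)] \<phi>_\<rho>[OF assms(1,2)] by simp
  have undo: "\<rho> (inv\<^bsub>K\<^esub> g) (\<rho> g z) = z" using Zc.\<sigma>_inv[OF assms(1,2)] .
  have "crossing_path (\<rho> g z) b q \<longleftrightarrow> crossing_path z b q" for q
    using crossing_path_equivariant[OF assms]
      crossing_path_equivariant[OF Zc.inv_closed[OF assms(1)] Zc.\<sigma>_VX[OF assms(1,2)] v'] undo by metis
  then have "shortest_crossing (\<rho> g z) b = shortest_crossing z b" by (auto simp: shortest_crossing_def fun_eq_iff)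
  then show e: "lift (\<rho> g z) b = lift z b" by (simp add: lift_def)
  show "znxt (\<rho> g z) b = \<rho> g (znxt z b)"
    unfolding znxt_def lifted_def e using Zc.\<sigma>_path(2)[OF assms(1) lift_props(1)[OF assms(2,3), unfolded lifted_def]] .
qed

lemma lift_path:
  assumes "z \<in> vertex_set Z" "Xc.valid (\<phi> z) u"
  shows "Zc.valid z (lift_word z u) \<and> Zc.tgt z (lift_word z u) = ztgt z u \<and> \<phi> (ztgt z u) = Xc.tgt (\<phi> z) u \<and>
    map \<phi>e (filter kept (Zc.eds z (lift_word z u))) = Xc.eds (\<phi> z) u"
  using assms
proof (induction u arbitrary: z)
  case Nil
  then show ?case by (simp add: lift_word_def ztgt_def)
next
  case (Cons b u)
  have vb: "Xc.valid (\<phi> z) [b]" using Cons.prems(2) by (auto dest: Xc.valid_start)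
  note p = lift_props[OF Cons.prems(1) vb]
  have t: "Zc.tgt z (lifted z b) = znxt z b" by (simp add: znxt_def)
  have zv: "znxt z b \<in> vertex_set Z" using Zc.valid_tgt[OF p(1)] t by simp
  have IH: "Zc.valid (znxt z b) (lift_word (znxt z b) u)" "Zc.tgt (znxt z b) (lift_word (znxt z b) u) = ztgt (znxt z b) u"
    "\<phi> (ztgt (znxt z b) u) = Xc.tgt (\<phi> (znxt z b)) u"
    "map \<phi>e (filter kept (Zc.eds (znxt z b) (lift_word (znxt z b) u))) = Xc.eds (\<phi> (znxt z b)) u"
    using Cons.IH[OF zv] Cons.prems(2) p(2) by simp_all
  have w: "lift_word z (b # u) = lifted z b @ lift_word (znxt z b) u" by (simp add: lift_word_def)
  have "Zc.eds z (lifted z b) = Zc.eds z (fst (lift z b)) @ [(Zc.tgt z (fst (lift z b)), znxt z b)]"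
    by (simp add: lifted_def znxt_def)
  moreover have "filter kept (Zc.eds z (fst (lift z b))) = []" using p(4) by (simp add: filter_empty_conv)
  ultimately have "map \<phi>e (filter kept (Zc.eds z (lifted z b))) = [(\<phi> z, Xc.nxt (\<phi> z) b)]"
    using p(2,3,5) by simp
  then show ?case using IH p(1,2) t by (simp add: w ztgt_def)
qed

lemma ztgt_vertex: "z \<in> vertex_set Z \<Longrightarrow> Xc.valid (\<phi> z) u \<Longrightarrow> ztgt z u \<in> vertex_set Z"
  using lift_path[of z u] Zc.valid_tgt[of z "lift_word z u"] by simp

lemma lift_blocks_split:
  "lift_blocks z u = Bs1 @ B # Bs2 \<Longrightarrow>
    \<exists>u1 b u2. u = u1 @ b # u2 \<and> Bs1 = lift_blocks z u1 \<and> B = lifted (ztgt z u1) b"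
proof (induction u arbitrary: z Bs1)
  case (Cons b u)
  show ?case
  proof (cases Bs1)
    case Nil
    then show ?thesis using Cons.prems by (intro exI[of _ "[]"] exI[of _ b] exI[of _ u]) (simp add: ztgt_def)
  next
    case (Cons B' Bs)
    then obtain u1 c u2 where "u = u1 @ c # u2" "Bs = lift_blocks (znxt z b) u1" "B = lifted (ztgt (znxt z b) u1) c"
      using Cons.IH[of "znxt z b" Bs] Cons.prems by auto
    then show ?thesis using Cons.prems Cons
      by (intro exI[of _ "b # u1"] exI[of _ c] exI[of _ u2]) (simp add: ztgt_def)
  qed
qed simp

text \<open>A letter \<open>c\<close> of the fibre part that commutes with everything up to the crossing is useless: reading
  \<open>a\<close> right after \<open>ys zs\<close> traverses the edge opposite to the original one in a square whose other two
  edges, labelled by \<open>c\<close>, are collapsed.\<close>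

lemma shorter_crossing:
  assumes z: "z \<in> vertex_set Z" "Xc.valid (\<phi> z) [b]" and l: "lift z b = (ys @ c # zs, a)"
    and cm: "\<forall>d\<in>set zs. Zc.comm c d" "Zc.comm c a"
  shows False
proof -
  note p = lift_props[OF z, unfolded lifted_def znxt_def l fst_conv snd_conv]
  have s: "shortest_crossing z b (ys @ c # zs, a)" using lift_shortest[OF z] l by simp
  have wds: "ys \<in> Zc.words" "c \<in> Zc.letters" "zs \<in> Zc.words" "a \<in> Zc.letters" using Zc.valid_words[OF p(1)] by simp_all
  have "Zc.wordeq (c # zs) (zs @ [c])" using Zc.commute_past[OF cm(1) wds(2)] .
  then have e1: "Zc.wordeq (ys @ c # zs) (ys @ zs @ [c])" using Zc.wordeq_context[of "c # zs" "zs @ [c]" ys "[]"] wds by simp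
  have "Zc.wordeq (c # zs @ [a]) ((zs @ [a]) @ [c])" using Zc.commute_past[of "zs @ [a]" c] cm wds(2) by simp
  then have e2: "Zc.wordeq (ys @ (c # zs) @ [a]) (ys @ zs @ [a, c])"
    using Zc.wordeq_context[of "c # zs @ [a]" "zs @ [a, c]" ys "[]"] wds by simp
  have r: "Zc.reduced (ys @ c # zs)" using Zc.reduced_infix[of "[]" "ys @ c # zs" "[a]"] p(6) by simp
  have v: "Zc.valid z (ys @ c # zs)" using p(1) unfolding Zc.valid_append by blast
  have r1: "Zc.reduced (ys @ zs @ [c])" using Zc.reduced_wordeq[OF r e1] by simp
  have r2: "Zc.reduced (ys @ zs @ [a, c])" using Zc.reduced_wordeq[OF p(6)] e2 by simp
  have v1: "Zc.valid z (ys @ zs @ [c])" "Zc.tgt z (ys @ zs @ [c]) = Zc.tgt z (ys @ c # zs)"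
    using Zc.reduced_valid_wordeq[OF v e1 r1] by auto
  have v2: "Zc.valid z (ys @ zs @ [a, c])" using Zc.reduced_valid_wordeq(1)[OF p(1) _ r2] e2 by simp
  define y where "y = Zc.tgt z (ys @ zs)"
  have t: "Zc.nxt y c = Zc.tgt z (ys @ c # zs)" using v1(2) by (simp add: y_def)
  have vy: "Zc.valid z (ys @ zs)" "Zc.valid y [c]" "Zc.valid y [a]"
    using v1(1) v2 by (auto simp: y_def dest: Zc.valid_start)
  have "Zc.valid (Zc.tgt z (ys @ c # zs)) [a]" using p(1) unfolding Zc.valid_append by blast
  then have vca: "Zc.valid y [c, a]" using vy(2) t by simp
  have par: "((y, Zc.nxt y c), (Zc.nxt y a, Zc.nxt (Zc.nxt y c) a)) \<in> parallel_edges Z"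
    using Zc.square_parallel[OF cm(2) vca] vy(3) by simp
  have fib: "\<forall>e\<in>set (Zc.eds z (ys @ zs @ [c])). \<not> kept e"
    using fibre_geodesic[OF v1(1) r1] v1(2) p(3) by simp
  then have col: "\<not> kept (y, Zc.nxt y c)" by (simp add: y_def)
  have \<phi>y: "\<phi> y = \<phi> z" using not_kept_path[of z "ys @ zs"] fib by (simp add: y_def)
  have "\<not> kept (Zc.nxt y a, Zc.nxt (Zc.nxt y c) a)"
    using kept_parallel[OF _ _ Zc.parallel_rtrancl_hyp[OF r_into_rtrancl[OF par]]] Zc.parallel_oriented[OF par] col by blast
  moreover have "Zc.nxt (Zc.nxt y c) a = Zc.tgt z ((ys @ c # zs) @ [a])" using t by simp
  ultimately have "\<phi> (Zc.tgt z ((ys @ zs) @ [a])) = Xc.nxt (\<phi> z) b"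
    using p(2) by (simp add: y_def)
  moreover have "Zc.valid z ((ys @ zs) @ [a])" using vy unfolding Zc.valid_append y_def by blast
  ultimately have "crossing_path z b (ys @ zs, a)" using \<phi>y by (simp only: crossing_path_def fst_conv snd_conv y_def)
  then have "length (ys @ c # zs) \<le> length (ys @ zs)" using s unfolding shortest_crossing_def by fastforce
  then show False by simp
qed

text \<open>
  The lift of a geodesic is a geodesic. Suppose that it crosses a hyperplane twice, by \<open>c\<close> and then by the
  inverse of \<open>c\<close>, where \<open>c\<close> commutes with all letters in between. The hyperplane is collapsed, as the
  image crosses no hyperplane twice. So \<open>c\<close> lies in the fibre part of some crossing path. If the second
  crossing were in the same fibre part, this part would not be geodesic. Otherwise \<open>c\<close> commutes
  with the rest of the crossing path, which is then not a shortest one.\<close>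

lemma lift_reduced:
  assumes z: "z \<in> vertex_set Z" and u: "Xc.valid (\<phi> z) u" "Xc.reduced u"
  shows "Zc.reduced (lift_word z u)"
proof (rule ccontr)
  assume nr: "\<not> Zc.reduced (lift_word z u)"
  have vl: "Zc.valid z (lift_word z u)" and im: "map \<phi>e (filter kept (Zc.eds z (lift_word z u))) = Xc.eds (\<phi> z) u"
    using lift_path[OF z u(1)] by auto
  obtain p c v q where d: "lift_word z u = p @ c # v @ linv c # q" "v \<in> Zc.linkw (fst c)"
    "Zc.hyp (Zc.tgt z p, Zc.tgt z (p @ [c])) = Zc.hyp (Zc.tgt z (p @ c # v), Zc.tgt z (p @ c # v @ [linv c]))"
    using Zc.not_reduced_repeats_hyp[OF vl nr] by metis
  define e1 where "e1 = (Zc.tgt z p, Zc.tgt z (p @ [c]))"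
  define e2 where "e2 = (Zc.tgt z (p @ c # v), Zc.tgt z (p @ c # v @ [linv c]))"
  have h: "Zc.hyp e1 = Zc.hyp e2" using d(3) by (simp only: e1_def e2_def)
  obtain A B where eds: "Zc.eds z (lift_word z u) = Zc.eds z p @ e1 # A @ e2 # B"
    unfolding d(1) e1_def e2_def by simp
  have "set (Zc.eds z (lift_word z u)) \<subseteq> oriented_edges Z" using Zc.eds_oriented[OF vl] by blast
  then have o: "e1 \<in> oriented_edges Z" "e2 \<in> oriented_edges Z" unfolding eds by auto
  have nk: "\<not> kept e1"
  proof
    assume k1: "kept e1"
    then have k2: "kept e2" using kept_parallel[OF o h] by simp
    have "distinct (map Xc.hyp (Xc.eds (\<phi> z) u))" using Xc.reduced_iff_distinct_hyp[OF u(1)] u(2) by blast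
    then show False using hyp_image_iff[OF o(1) k1 o(2) k2] h k1 k2 unfolding im[symmetric] eds by simp
  qed
  then have nk2: "\<not> kept e2" using kept_parallel[OF o h] by simp
  obtain Bs1 ys zs Bs2 where bl: "lift_blocks z u = Bs1 @ (ys @ c # zs) # Bs2" "p = concat Bs1 @ ys"
    "v @ linv c # q = zs @ concat Bs2"
    using concat_eq_append_Cons[OF d(1)[unfolded lift_word_def]] by blast
  \<comment> \<open>the letter \<open>c\<close> belongs to the block that lifts the edge with letter \<open>b\<close>\<close>
  obtain u1 b u2 where ub: "u = u1 @ b # u2" "Bs1 = lift_blocks z u1" "ys @ c # zs = lifted (ztgt z u1) b"
    using lift_blocks_split[OF bl(1)] by blast
  define y where "y = ztgt z u1"
  have vu1: "Xc.valid (\<phi> z) u1" "Xc.valid (Xc.tgt (\<phi> z) u1) [b]"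
    using u(1) unfolding ub(1) by (auto dest: Xc.valid_start)
  have y: "y \<in> vertex_set Z" "Zc.tgt z (concat Bs1) = y" "Xc.valid (\<phi> y) [b]"
    using ztgt_vertex[OF z vu1(1)] lift_path[OF z vu1(1)] vu1(2) by (simp_all add: y_def ub(2) lift_word_def)
  obtain w a where la: "lift y b = (w, a)" by (metis surj_pair)
  have blk: "ys @ c # zs = w @ [a]" using ub(3) by (simp add: y_def[symmetric] lifted_def la)
  note P = lift_props[OF y(1,3), unfolded lifted_def znxt_def la fst_conv snd_conv]
  have kl: "kept (Zc.tgt z (concat Bs1 @ w), Zc.tgt z (concat Bs1 @ w @ [a]))" using P(5) y(2) by simp
  show False
  proof (cases zs rule: rev_cases)
    case Nil
    then have "ys = w" "c = a" using blk by simp_all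
    then show False using kl nk by (simp add: e1_def bl(2))
  next
    case (snoc zs' a')
    then have w: "w = ys @ c # zs'" and a': "a' = a" using blk by simp_all
    have rw: "Zc.reduced w" using Zc.reduced_infix[of "[]" w "[a]"] P(6) by simp
    have eq: "v @ linv c # q = zs' @ a # concat Bs2" using bl(3) snoc a' by simp
    then obtain us where "v = zs' @ us \<and> us @ linv c # q = a # concat Bs2 \<or>
        zs' = v @ us \<and> linv c # q = us @ a # concat Bs2"
      by (auto simp: append_eq_append_conv2)
    then consider (long) us' where "v = zs' @ a # us'" | (last) "v = zs'" "linv c = a" | (short) us' where "zs' = v @ linv c # us'"
      by (cases us) auto
    then show False
    proof cases
      case long
      then have "\<forall>d\<in>set zs'. Zc.comm c d" "Zc.comm c a" using d(2) Zc.linkw_iff[of v c] by simp_all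
      then show False using shorter_crossing[OF y(1,3), of ys c zs' a] la w by simp
    next
      case last
      \<comment> \<open>the second edge would be the lifted edge that ends the block, and this one is kept\<close>
      then have "p @ c # v = concat Bs1 @ w" "p @ c # v @ [linv c] = concat Bs1 @ w @ [a]" using bl(2) w by simp_all
      then have "e2 = (Zc.tgt z (concat Bs1 @ w), Zc.tgt z (concat Bs1 @ w @ [a]))" unfolding e2_def by (simp only:)
      then show False using kl nk2 by simp
    next
      case short
      \<comment> \<open>both crossings lie in the fibre part \<open>w\<close>, which is geodesic\<close>
      then have "Zc.reduced (c # v @ [linv c])" using Zc.reduced_infix[of ys "c # v @ [linv c]" us'] rw w by simp
      moreover have "c \<in> Zc.letters" using Zc.reduced_words[OF rw] w by simp
      then have "Zc.wordeq v (c # v @ [linv c])" using Zc.wordeq_sym[OF Zc.bookends_cancel[OF _ d(2)]] by blast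
      ultimately show False using Zc.reduced_length by fastforce
    qed
  qed
qed

lemma lift_blocks_snoc: "lift_blocks z (u @ [b]) = lift_blocks z u @ [lifted (ztgt z u) b]"
  by (induction u arbitrary: z) (simp_all add: ztgt_def)

lemma labels_lift:
  assumes "z \<in> vertex_set Z" "Xc.valid (\<phi> z) u"
  shows "Zc.labels z (lift_word z u) = concat (map (\<lambda>i. Zc.labels (ztgt z (take i u)) (fst (lift (ztgt z (take i u)) (u ! i)))
     @ [incl (Xc.labels (\<phi> z) u ! i)]) [0..<length u])" (is "_ = concat (map (?F u) _)")
  using assms(2)
proof (induction u rule: rev_induct)
  case Nil
  then show ?case by (simp add: lift_word_def)
next
  case (snoc b u)
  have vu: "Xc.valid (\<phi> z) u" "Xc.valid (Xc.tgt (\<phi> z) u) [b]" using snoc.prems by simp_all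
  define y where "y = ztgt z u"
  have y: "y \<in> vertex_set Z" "Zc.tgt z (lift_word z u) = y" "Xc.valid (\<phi> y) [b]" "\<phi> y = Xc.tgt (\<phi> z) u"
    using ztgt_vertex[OF assms(1) vu(1)] lift_path[OF assms(1) vu(1)] vu(2) by (simp_all add: y_def)
  note P = lift_props[OF y(1,3)]
  define e where "e = (Zc.tgt y (fst (lift y b)), znxt y b)"
  have eds: "Zc.eds y (lifted y b) = Zc.eds y (fst (lift y b)) @ [e]" by (simp add: e_def lifted_def znxt_def)
  have o: "e \<in> oriented_edges Z" using Zc.eds_oriented[OF P(1)] eds by simp
  have "Zc.label_of e = incl (Xc.label_of (\<phi>e e))" using label_of_kept[OF o] P(5) by (simp add: e_def)
  moreover have "\<phi>e e = (Xc.tgt (\<phi> z) u, Xc.nxt (Xc.tgt (\<phi> z) u) b)" using P(2,3) y(4) by (simp add: e_def)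
  ultimately have le: "Zc.label_of e = incl (Xc.labels (\<phi> z) (u @ [b]) ! length u)" by (simp add: nth_append)
  have "Zc.labels z (lift_word z (u @ [b])) = Zc.labels z (lift_word z u) @ Zc.labels y (lifted y b)"
    using y(2) by (simp add: lift_word_def lift_blocks_snoc y_def)
  also have "Zc.labels y (lifted y b) = Zc.labels y (fst (lift y b)) @ [incl (Xc.labels (\<phi> z) (u @ [b]) ! length u)]"
    using eds le by (simp add: Zc.labels_def)
  finally have "Zc.labels z (lift_word z (u @ [b])) = concat (map (?F u) [0..<length u]) @ ?F (u @ [b]) (length u)"
    using snoc.IH[OF vu(1)] by (simp add: y_def)
  moreover have "map (?F u) [0..<length u] = map (?F (u @ [b])) [0..<length u]"
    by (rule map_cong) (simp_all add: nth_append)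
  ultimately show ?case by simp
qed

lemma labels_fibre:
  assumes "z \<in> vertex_set Z" "Xc.valid (\<phi> z) [b]"
  shows "set (Zc.labels z (fst (lift z b))) \<subseteq> quotient_oriented_hyperplanes K Z \<rho> - range incl"
proof -
  have v: "Zc.valid z (fst (lift z b))" using lift_props(1)[OF assms] unfolding lifted_def Zc.valid_append by blast
  have "Zc.label_of e \<notin> range incl" if "e \<in> set (Zc.eds z (fst (lift z b)))" for e
    using label_of_collapsed[OF Zc.eds_oriented[OF v that]] lift_props(4)[OF assms] that by blast
  then show ?thesis using Zc.labels_hyperplanes[OF v] unfolding Zc.labels_def by auto
qed

end

section \<open>Finiteness of the quotients\<close>

lemma subgroup_cubical_action:
  assumes "cubical_action \<Gamma> X \<sigma>" "subgroup H \<Gamma>"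
  shows "cubical_action (\<Gamma>\<lparr>carrier := H\<rparr>) X \<sigma>"
proof -
  have a: "group_action \<Gamma> (vertex_set X) \<sigma>" "\<forall>g\<in>carrier \<Gamma>. \<forall>c\<in>X. \<sigma> g ` c \<in> X"
    using assms(1) by (simp_all add: cubical_action_def)
  have g: "group \<Gamma>" "group (BijGroup (vertex_set X))" "\<sigma> \<in> hom \<Gamma> (BijGroup (vertex_set X))"
    using a(1) by (simp_all add: group_action_def group_hom_def group_hom_axioms_def)
  have sub: "H \<subseteq> carrier \<Gamma>" using subgroup.subset[OF assms(2)] .
  have "\<sigma> \<in> hom (\<Gamma>\<lparr>carrier := H\<rparr>) (BijGroup (vertex_set X))"
    using g(3) sub unfolding hom_def by (auto simp: subset_iff Pi_iff)
  moreover have "group (\<Gamma>\<lparr>carrier := H\<rparr>)" using subgroup.subgroup_is_group[OF assms(2) g(1)] .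
  ultimately have "group_action (\<Gamma>\<lparr>carrier := H\<rparr>) (vertex_set X) \<sigma>"
    using g(2) by (simp add: group_action_def group_hom_def group_hom_axioms_def)
  then show ?thesis using a(2) sub by (auto simp: cubical_action_def)
qed

text \<open>Translate a finite set of representatives for the large group by representatives of the cosets.\<close>

lemma finite_index_cocompact:
  fixes \<Gamma> :: "('g, 'm) monoid_scheme"
  assumes act: "cubical_action \<Gamma> X \<sigma>" and H: "subgroup H \<Gamma>" "finite (rcosets\<^bsub>\<Gamma>\<^esub> H)"
    and coc: "cocompact_action \<Gamma> X \<sigma>"
  shows "cocompact_action (\<Gamma>\<lparr>carrier := H\<rparr>) X \<sigma>"
proof -
  have a: "group_action \<Gamma> (vertex_set X) \<sigma>" "\<forall>g\<in>carrier \<Gamma>. \<forall>c\<in>X. \<sigma> g ` c \<in> X"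
    using act by (simp_all add: cubical_action_def)
  interpret \<Gamma>: group \<Gamma> using a(1) by (simp add: group_action_def group_hom_def)
  have sub: "H \<subseteq> carrier \<Gamma>" using subgroup.subset[OF H(1)] .
  obtain F where F: "finite F" "F \<subseteq> X" "\<forall>c\<in>X. \<exists>g\<in>carrier \<Gamma>. \<exists>d\<in>F. c = \<sigma> g ` d"
    using coc unfolding cocompact_action_def by blast
  define rep where "rep C = (SOME r. r \<in> C)" for C :: "'g set"
  define F' where "F' = (\<Union>C\<in>rcosets\<^bsub>\<Gamma>\<^esub> H. (\<lambda>d. \<sigma> (rep C) ` d) ` F)"
  have rep: "\<exists>h\<in>H. rep (H #>\<^bsub>\<Gamma>\<^esub> g) = h \<otimes>\<^bsub>\<Gamma>\<^esub> g" if "g \<in> carrier \<Gamma>" for g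
  proof -
    have "rep (H #>\<^bsub>\<Gamma>\<^esub> g) \<in> H #>\<^bsub>\<Gamma>\<^esub> g" unfolding rep_def using \<Gamma>.rcos_self[OF that H(1)] by (rule someI)
    then show ?thesis by (auto simp: r_coset_def)
  qed
  have "finite F'" unfolding F'_def using H(2) F(1) by simp
  moreover have "F' \<subseteq> X"
  proof
    fix c assume "c \<in> F'"
    then obtain C d where c: "C \<in> rcosets\<^bsub>\<Gamma>\<^esub> H" "d \<in> F" "c = \<sigma> (rep C) ` d" by (auto simp: F'_def)
    obtain g where g: "g \<in> carrier \<Gamma>" "C = H #>\<^bsub>\<Gamma>\<^esub> g" using c(1) by (auto simp: RCOSETS_def)
    obtain h where "h \<in> H" "rep C = h \<otimes>\<^bsub>\<Gamma>\<^esub> g" using rep[OF g(1)] g(2) by blast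
    then have "rep C \<in> carrier \<Gamma>" using g(1) sub by auto
    then show "c \<in> X" using a(2) c F(2) by blast
  qed
  moreover have "\<exists>h\<in>H. \<exists>d\<in>F'. c = \<sigma> h ` d" if cX: "c \<in> X" for c
  proof -
    obtain g d where g: "g \<in> carrier \<Gamma>" "d \<in> F" "c = \<sigma> g ` d" using F(3) cX by blast
    obtain h where h: "h \<in> H" "rep (H #>\<^bsub>\<Gamma>\<^esub> g) = h \<otimes>\<^bsub>\<Gamma>\<^esub> g" using rep[OF g(1)] by blast
    have hc: "h \<in> carrier \<Gamma>" "inv\<^bsub>\<Gamma>\<^esub> h \<in> H" "inv\<^bsub>\<Gamma>\<^esub> h \<in> carrier \<Gamma>" "h \<otimes>\<^bsub>\<Gamma>\<^esub> g \<in> carrier \<Gamma>"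
      using h(1) sub subgroup.m_inv_closed[OF H(1)] g(1) by auto
    have gg: "inv\<^bsub>\<Gamma>\<^esub> h \<otimes>\<^bsub>\<Gamma>\<^esub> (h \<otimes>\<^bsub>\<Gamma>\<^esub> g) = g" using hc(1,3) g(1) by (simp add: \<Gamma>.m_assoc[symmetric])
    have dX: "d \<subseteq> vertex_set X" using g(2) F(2) by (auto simp: vertex_set_def)
    have "\<sigma> (inv\<^bsub>\<Gamma>\<^esub> h) (\<sigma> (h \<otimes>\<^bsub>\<Gamma>\<^esub> g) x) = \<sigma> g x" if "x \<in> d" for x
      using group_action.composition_rule[OF a(1) _ hc(3,4), of x] gg that dX by auto
    then have "c = \<sigma> (inv\<^bsub>\<Gamma>\<^esub> h) ` (\<sigma> (rep (H #>\<^bsub>\<Gamma>\<^esub> g)) ` d)" using g(3) h(2) by (simp add: image_image)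
    moreover have "H #>\<^bsub>\<Gamma>\<^esub> g \<in> rcosets\<^bsub>\<Gamma>\<^esub> H" using g(1) by (auto simp: RCOSETS_def)
    then have "\<sigma> (rep (H #>\<^bsub>\<Gamma>\<^esub> g)) ` d \<in> F'" unfolding F'_def using g(2) by blast
    ultimately show ?thesis using hc(2) by blast
  qed
  ultimately show ?thesis unfolding cocompact_action_def by auto
qed

context special_complex
begin

lemma finite_quotient:
  assumes "cube_complex X" "cocompact_action K X \<sigma>"
  shows "finite (orbit K \<sigma> ` VX)" "finite (quotient_oriented_hyperplanes K X \<sigma>)"
proof -
  obtain F where F: "finite F" "F \<subseteq> X" "\<forall>c\<in>X. \<exists>g\<in>carrier K. \<exists>d\<in>F. c = \<sigma> g ` d"
    using assms(2) unfolding cocompact_action_def by blast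
  have "\<forall>c\<in>X. \<exists>n k. cube_chart X n k \<and> c = k ` Pow {..<n}"
    using assms(1) unfolding cube_complex_def by (rule conjunct1)
  then have "finite c" if "c \<in> X" for c
    using that by (metis finite_Pow_iff finite_imageI finite_lessThan)
  then have fin: "finite (\<Union>F)" using F by blast
  have "orbit K \<sigma> ` VX \<subseteq> orbit K \<sigma> ` \<Union>F"
  proof clarify
    fix x assume "x \<in> VX"
    then obtain c where "c \<in> X" "x \<in> c" by (auto simp: vertex_set_def)
    then obtain g d y where g: "g \<in> carrier K" "d \<in> F" "y \<in> d" "x = \<sigma> g y" using F(3) by blast
    have "y \<in> VX" using g(2,3) F(2) by (auto simp: vertex_set_def)
    then have "orbit K \<sigma> x = orbit K \<sigma> y" using orbit_\<sigma> g by simp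
    then show "orbit K \<sigma> x \<in> orbit K \<sigma> ` \<Union>F" using g(2,3) by blast
  qed
  then show "finite (orbit K \<sigma> ` VX)" using fin finite_subset by blast
  have "orb ` oriented_edges X \<subseteq> orb ` (\<Union>F \<times> \<Union>F)"
  proof (rule image_subsetI)
    fix e assume e: "e \<in> oriented_edges X"
    then have "{fst e, snd e} \<in> X" by (auto simp: oriented_edges_def edges_def)
    then obtain g d where g: "g \<in> carrier K" "d \<in> F" "{fst e, snd e} = \<sigma> g ` d" using F(3) by blast
    then obtain x y where xy: "x \<in> d" "y \<in> d" "fst e = \<sigma> g x" "snd e = \<sigma> g y" by blast
    have "x \<in> VX" "y \<in> VX" using xy(1,2) g(2) F(2) by (auto simp: vertex_set_def)
    then have "mv (inv\<^bsub>K\<^esub> g) e = (x, y)" using \<sigma>_inv[OF g(1)] xy(3,4) by (cases e) simp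
    then have "orb e = orb (x, y)" using orb_mv[OF inv_closed[OF g(1)] e] by simp
    then show "orb e \<in> orb ` (\<Union>F \<times> \<Union>F)" using xy(1,2) g(2) by blast
  qed
  then have "finite (orb ` oriented_edges X)" using fin finite_subset by blast
  then show "finite (quotient_oriented_hyperplanes K X \<sigma>)"
    unfolding quotient_oriented_hyperplanes_def quotient_def by (rule finite_UN_I) simp
qed

lemma vs_take: "vs x u = map (\<lambda>i. tgt x (take i u)) [0..<Suc (length u)]"
proof (induction u arbitrary: x)
  case (Cons a u)
  have "[0..<Suc (length (a # u))] = 0 # map Suc [0..<Suc (length u)]"
    by (metis length_Cons map_Suc_upt upt_conv_Cons zero_less_Suc)
  then show ?case using Cons[of "nxt x a"] by (simp del: upt_Suc add: comp_def)
qed simp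

lemma labels_take: "labels x (take i u) = take i (labels x u)"
proof (induction u arbitrary: x i)
  case (Cons a u)
  then show ?case by (cases i) simp_all
qed simp

lemma labels_nth: "i < length u \<Longrightarrow> labels x u ! i = label_of (tgt x (take i u), nxt (tgt x (take i u)) (u ! i))"
proof (induction u arbitrary: x i)
  case (Cons a u)
  then show ?case by (cases i) simp_all
qed simp

lemma valid_take:
  assumes "valid x u"
  shows "valid x (take i u)" "i < length u \<Longrightarrow> valid (tgt x (take i u)) [u ! i]"
proof -
  have "valid x (take i u @ drop i u)" using assms by simp
  then have v: "valid x (take i u)" "valid (tgt x (take i u)) (drop i u)" unfolding valid_append by auto
  then show "valid x (take i u)" by simp
  assume "i < length u"
  then have "drop i u = u ! i # drop (Suc i) u" by (simp add: Cons_nth_drop_Suc)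
  then show "valid (tgt x (take i u)) [u ! i]" using v(2) by (auto dest: valid_start)
qed

end

section \<open>The automaton\<close>

context special_restriction
begin

text \<open>The labels of the fibre part of the lift at \<open>z\<close> only depend on the orbit \<open>Q\<close> of \<open>z\<close> and on the label \<open>s\<close>
  of the edge to be lifted; \<open>fibre_word Q s\<close> is the word of these labels.\<close>

definition fibre_label :: "'a set \<Rightarrow> ('b \<times> 'b) set set \<Rightarrow> 'a \<Rightarrow> letter \<Rightarrow> bool" where
  "fibre_label Q s z b \<longleftrightarrow> z \<in> vertex_set Z \<and> orbit K \<rho> z = Q \<and> Xc.valid (\<phi> z) [b] \<and>
     Xc.label_of (\<phi> z, Xc.nxt (\<phi> z) b) = s"

definition fibre_word :: "'a set \<Rightarrow> ('b \<times> 'b) set set \<Rightarrow> ('a \<times> 'a) set set list" where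
  "fibre_word Q s = (if \<exists>z b. fibre_label Q s z b
     then (SOME p. \<exists>z b. fibre_label Q s z b \<and> p = Zc.labels z (fst (lift z b))) else [])"

lemma fibre_word_unique:
  assumes "fibre_label Q s z b" "fibre_label Q s z' b'"
  shows "Zc.labels z (fst (lift z b)) = Zc.labels z' (fst (lift z' b'))"
proof -
  have z: "z \<in> vertex_set Z" "Xc.valid (\<phi> z) [b]" and z': "z' \<in> vertex_set Z" "Xc.valid (\<phi> z') [b']"
    and orb: "orbit K \<rho> z = orbit K \<rho> z'"
    and lb: "Xc.label_of (\<phi> z, Xc.nxt (\<phi> z) b) = Xc.label_of (\<phi> z', Xc.nxt (\<phi> z') b')"
    using assms unfolding fibre_label_def by auto
  obtain g where g: "g \<in> carrier K" "z' = \<rho> g z" using Zc.orbit_eqE[OF orb z(1) z'(1)] .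
  have "(\<phi> z, Xc.nxt (\<phi> z) b) \<in> oriented_edges X" "(\<phi> z', Xc.nxt (\<phi> z') b') \<in> oriented_edges X"
    using Xc.eds_oriented[OF z(2)] Xc.eds_oriented[OF z'(2)] by simp_all
  then have "Xc.letter_of (\<phi> z, Xc.nxt (\<phi> z) b) = Xc.letter_of (\<phi> z', Xc.nxt (\<phi> z') b')" using Xc.label_of_letter[OF lb] by blast
  then have b: "b' = b" using Xc.letter_of_nxt z(2) z'(2) by simp
  have "Zc.valid z (fst (lift z b))" using lift_props(1)[OF z] unfolding lifted_def Zc.valid_append by blast
  then show ?thesis unfolding b g(2) lift_equivariant(1)[OF g(1) z] using Zc.labels_\<sigma>[OF g(1)] by simp
qed

lemma fibre_word_eq:
  assumes "fibre_label Q s z b"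
  shows "fibre_word Q s = Zc.labels z (fst (lift z b))"
proof -
  have ex: "\<exists>p z b. fibre_label Q s z b \<and> p = Zc.labels z (fst (lift z b))" using assms by blast
  then obtain z' b' where "fibre_label Q s z' b'" "fibre_word Q s = Zc.labels z' (fst (lift z' b'))"
    using someI_ex[OF ex] assms unfolding fibre_word_def by auto
  then show ?thesis using fibre_word_unique[OF assms] by metis
qed

lemma fibre_word_set: "set (fibre_word Q s) \<subseteq> quotient_oriented_hyperplanes K Z \<rho> - range incl"
proof (cases "\<exists>z b. fibre_label Q s z b")
  case True
  then obtain z b where z: "fibre_label Q s z b" by blast
  then have "z \<in> vertex_set Z" "Xc.valid (\<phi> z) [b]" unfolding fibre_label_def by blast+
  then show ?thesis unfolding fibre_word_eq[OF z] by (rule labels_fibre)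
qed (simp add: fibre_word_def)

definition orbit_image :: "'a set \<Rightarrow> 'b set" where
  "orbit_image Q = orbit K \<sigma> (\<phi> (SOME z. z \<in> vertex_set Z \<and> orbit K \<rho> z = Q))"

lemma orbit_image_eq:
  assumes "z \<in> vertex_set Z"
  shows "orbit_image (orbit K \<rho> z) = orbit K \<sigma> (\<phi> z)"
proof -
  define z' where "z' = (SOME z'. z' \<in> vertex_set Z \<and> orbit K \<rho> z' = orbit K \<rho> z)"
  have z': "z' \<in> vertex_set Z \<and> orbit K \<rho> z' = orbit K \<rho> z"
    unfolding z'_def by (rule someI[of _ z]) (use assms in blast)
  then obtain g where g: "g \<in> carrier K" "z' = \<rho> g z" using Zc.orbit_eqE[of z z'] assms by metis
  show ?thesis
    using \<phi>_\<rho>[OF g(1) assms] Xc.orbit_\<sigma>[OF g(1)] assms g(2) unfolding orbit_image_def z'_def[symmetric] by simp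
qed

text \<open>The words of \<open>L\<close> are the labels of the paths from \<open>oX\<close> that read normal words: each vertex is the end of
  exactly one of them. The class \<open>\<kappa> w\<close> consists of the orbit of the end of the lift of \<open>w\<close>, which determines
  the edges available at the end of \<open>w\<close>, and of the set of blocked letters, which determines those among
  them that continue a normal word.\<close>

lemma geodesic_automaton:
  assumes fin: "finite (orbit K \<rho> ` vertex_set Z)" "finite SX" and o: "oZ \<in> vertex_set Z"
    and SX: "SX = quotient_oriented_hyperplanes K X \<sigma>" and SZ: "SZ = quotient_oriented_hyperplanes K Z \<rho>"
    and oX: "oX = \<phi> oZ"
  shows "\<exists>L \<A>. L \<subseteq> lists SX \<and>
      automaton_over SX (\<A> :: (nat, nat, ('b \<times> 'b) set set) automaton) \<and>
      pruned \<A> \<and> final \<A> = verts (graph \<A>) \<and> L = language \<A> \<and>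
      (\<exists>C::nat. C \<ge> 1 \<and> (\<forall>w\<in>L. finite (initial_paths \<A> w) \<and> card (initial_paths \<A> w) \<le> C)) \<and>
      (\<forall>w\<in>L. \<exists>!\<gamma>. geodesic_representative K X \<sigma> oX w \<gamma>) \<and>
      bij_betw (endpoint K X \<sigma> oX) L (vertex_set X) \<and>
      (\<exists>\<Psi> \<Xi>. \<Psi> ` verts (graph \<A>) \<subseteq> lists (SZ - incl ` SX) \<and>
         \<Xi> ` verts (graph \<A>) \<subseteq> quotient_vertices K X \<sigma> \<and>
         (\<forall>w\<in>L. \<forall>(u, p)\<in>initial_paths \<A> w.
            (\<exists>!\<gamma>. geodesic_representative K Z \<rho> oZ (interleave \<A> \<Psi> incl p) \<gamma>) \<and>
            \<phi> (endpoint K Z \<rho> oZ (interleave \<A> \<Psi> incl p)) = endpoint K X \<sigma> oX w) \<and>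
         (\<forall>w\<in>L. \<forall>(u, p)\<in>initial_paths \<A> w.
            map (orbit K \<sigma>) (the_geodesic K X \<sigma> oX w) =
            map \<Xi> (pre_digraph.awalk_verts (graph \<A>) u p)))"
proof -
  have oXv: "oX \<in> vertex_set X" using o oX by simp
  define L where "L = {Xc.labels oX u | u. Xc.valid oX u \<and> Xc.normal_word u}"
  define wd where "wd w = (THE u. Xc.valid oX u \<and> Xc.labels oX u = w)" for w
  have wd: "wd (Xc.labels oX u) = u" if "Xc.valid oX u" for u
    unfolding wd_def by (rule the_equality) (use that Xc.labels_inj in blast)+
  define \<kappa> where "\<kappa> w = (orbit K \<rho> (ztgt oZ (wd w)), {b \<in> Xc.letters. Xc.blocks (wd w) b})" for w
  have LE: "\<exists>u. Xc.valid oX u \<and> Xc.normal_word u \<and> Xc.reduced u \<and> w = Xc.labels oX u \<and> wd w = u" if "w \<in> L" for w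
    using that wd Xc.normal_word_reduced unfolding L_def by blast
  have LS: "L \<subseteq> lists SX"
    unfolding L_def SX using Xc.labels_hyperplanes by fastforce
  have Nil: "[] \<in> L" unfolding L_def using oXv by (intro CollectI exI[of _ "[]"]) simp
  have prefix: "\<forall>w s. w @ [s] \<in> L \<longrightarrow> w \<in> L"
  proof (intro allI impI)
    fix w s assume ws: "w @ [s] \<in> L"
    obtain u where u: "Xc.valid oX u" "Xc.normal_word u" "w @ [s] = Xc.labels oX u" using ws unfolding L_def by blast
    then have "u \<noteq> []" by auto
    then obtain v b where v: "u = v @ [b]" by (metis rev_exhaust)
    then have "w = Xc.labels oX v" using u(3) by simp
    moreover have "Xc.valid oX v" "Xc.normal_word v" using u v by (simp_all add: Xc.normal_word_snoc)
    ultimately show "w \<in> L" unfolding L_def by blast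
  qed
  have ztgt_v: "ztgt oZ u \<in> vertex_set Z" "\<phi> (ztgt oZ u) = Xc.tgt oX u" if "Xc.valid oX u" for u
    using ztgt_vertex[OF o] lift_path[OF o] that oX by auto
  have finL: "finite (\<kappa> ` L)"
  proof (rule finite_subset)
    show "\<kappa> ` L \<subseteq> (orbit K \<rho> ` vertex_set Z) \<times> Pow Xc.letters"
    proof (rule image_subsetI)
      fix w assume "w \<in> L"
      then show "\<kappa> w \<in> (orbit K \<rho> ` vertex_set Z) \<times> Pow Xc.letters"
        using LE ztgt_v(1) unfolding \<kappa>_def by blast
    qed
    show "finite ((orbit K \<rho> ` vertex_set Z) \<times> Pow Xc.letters)" using fin(1) Xc.finite_letters by blast
  qed
  \<comment> \<open>equal classes differ by a translation, which carries the possible next steps of the path and of its lift\<close>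
  have cong: "\<forall>w\<in>L. \<forall>w'\<in>L. \<forall>s. \<kappa> w = \<kappa> w' \<longrightarrow> w' @ [s] \<in> L \<longrightarrow>
      w @ [s] \<in> L \<and> \<kappa> (w @ [s]) = \<kappa> (w' @ [s])"
  proof (intro ballI allI impI)
    fix w w' s assume a: "w \<in> L" "w' \<in> L" "\<kappa> w = \<kappa> w'" "w' @ [s] \<in> L"
    obtain u where u: "Xc.valid oX u" "Xc.normal_word u" "w = Xc.labels oX u" "wd w = u" using LE[OF a(1)] by blast
    obtain v where v: "Xc.valid oX v" "Xc.normal_word v" "w' @ [s] = Xc.labels oX v" "wd (w' @ [s]) = v" using LE[OF a(4)] by blast
    then have "v \<noteq> []" by auto
    then obtain u' b where vb: "v = u' @ [b]" by (metis rev_exhaust)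
    have w': "w' = Xc.labels oX u'" "s = Xc.label_of (Xc.tgt oX u', Xc.nxt (Xc.tgt oX u') b)" using v(3) vb by simp_all
    have u': "Xc.valid oX u'" "Xc.valid (Xc.tgt oX u') [b]" "Xc.normal_word u'" "\<not> Xc.blocks u' b" "b \<in> Xc.letters"
      using v(1,2) unfolding vb Xc.valid_append Xc.normal_word_snoc by auto
    have k: "orbit K \<rho> (ztgt oZ u') = orbit K \<rho> (ztgt oZ u)"
      "{b \<in> Xc.letters. Xc.blocks u b} = {b \<in> Xc.letters. Xc.blocks u' b}"
      using a(3) wd[OF u'(1)] u(4) w'(1) by (simp_all add: \<kappa>_def)
    have kb: "Xc.blocks u c \<longleftrightarrow> Xc.blocks u' c" if "c \<in> Xc.letters" for c using k(2) that by blast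
    obtain g where g: "g \<in> carrier K" "ztgt oZ u = \<rho> g (ztgt oZ u')"
      using Zc.orbit_eqE[OF k(1) ztgt_v(1)[OF u'(1)] ztgt_v(1)[OF u(1)]] .
    have t: "Xc.tgt oX u = \<sigma> g (Xc.tgt oX u')"
      using ztgt_v(2)[OF u(1)] ztgt_v(2)[OF u'(1)] g \<phi>_\<rho>[OF g(1) ztgt_v(1)[OF u'(1)]] by simp
    have vb': "Xc.valid (Xc.tgt oX u) [b]" using Xc.\<sigma>_path(1)[OF g(1) u'(2)] t by simp
    have "Xc.labels (Xc.tgt oX u) [b] = Xc.labels (Xc.tgt oX u') [b]" unfolding t using Xc.labels_\<sigma>[OF g(1) u'(2)] .
    then have lb: "Xc.labels oX (u @ [b]) = w @ [s]" using u(3) w'(2) by simp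
    have val: "Xc.valid oX (u @ [b])" using u(1) vb' by simp
    have norm: "Xc.normal_word (u @ [b])" using u(2) u'(4,5) kb by (simp add: Xc.normal_word_snoc)
    have "Xc.valid (\<phi> (ztgt oZ u')) [b]" using u'(2) ztgt_v(2)[OF u'(1)] by simp
    then have zb: "ztgt oZ (u @ [b]) = \<rho> g (ztgt oZ (u' @ [b]))"
      using lift_equivariant(2)[OF g(1) ztgt_v(1)[OF u'(1)]] g(2) by (simp add: ztgt_def)
    have "orbit K \<rho> (ztgt oZ (u @ [b])) = orbit K \<rho> (ztgt oZ (u' @ [b]))"
      unfolding zb using Zc.orbit_\<sigma>[OF g(1)] ztgt_v(1)[OF v(1)] vb by simp
    moreover have "{c \<in> Xc.letters. Xc.blocks (u @ [b]) c} = {c \<in> Xc.letters. Xc.blocks (u' @ [b]) c}"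
      using kb unfolding Xc.blocks_snoc by blast
    ultimately have "\<kappa> (w @ [s]) = \<kappa> (w' @ [s])"
      using wd[OF val] lb v(4) vb by (simp add: \<kappa>_def)
    moreover have "w @ [s] \<in> L" unfolding L_def using val norm lb[symmetric] by blast
    ultimately show "w @ [s] \<in> L \<and> \<kappa> (w @ [s]) = \<kappa> (w' @ [s])" by blast
  qed
  obtain \<A> :: "(nat, nat, ('b \<times> 'b) set set) automaton" and st where A:
    "automaton_over SX \<A>" "pruned \<A>" "final \<A> = verts (graph \<A>)" "language \<A> = L"
    "\<exists>C::nat. C \<ge> 1 \<and> (\<forall>w\<in>L. finite (initial_paths \<A> w) \<and> card (initial_paths \<A> w) \<le> C)"
    "fst ` st ` verts (graph \<A>) \<subseteq> \<kappa> ` L"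
    and data: "\<forall>w\<in>L. \<forall>(u, p)\<in>initial_paths \<A> w.
       map (\<lambda>e. (st (tail (graph \<A>) e), label \<A> e)) p
         = map (\<lambda>i. ((\<kappa> (take i w), Some (w ! i)), w ! i)) [0..<length w] \<and>
       map (fst \<circ> st) (pre_digraph.awalk_verts (graph \<A>) u p)
         = map (\<lambda>i. \<kappa> (take i w)) [0..<Suc (length w)]"
    using lookahead_automaton[OF fin(2) LS Nil prefix finL cong] by blast
  define \<Psi> where "\<Psi> v = (case snd (st v) of None \<Rightarrow> [] | Some s \<Rightarrow> fibre_word (fst (fst (st v))) s)" for v
  define \<Xi> where "\<Xi> v = orbit_image (fst (fst (st v)))" for v
  have rep: "(\<exists>!\<gamma>. geodesic_representative K X \<sigma> oX w \<gamma>) \<and> the_geodesic K X \<sigma> oX w = Xc.vs oX (wd w) \<and>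
      endpoint K X \<sigma> oX w = Xc.tgt oX (wd w)" if "w \<in> L" for w
    using LE[OF that] Xc.unique_representative by metis
  have bij: "bij_betw (endpoint K X \<sigma> oX) L (vertex_set X)"
    unfolding bij_betw_def
  proof
    show "inj_on (endpoint K X \<sigma> oX) L"
    proof (rule inj_onI)
      fix w w' assume w: "w \<in> L" "w' \<in> L" and e: "endpoint K X \<sigma> oX w = endpoint K X \<sigma> oX w'"
      obtain u where u: "Xc.valid oX u" "Xc.normal_word u" "w = Xc.labels oX u" "wd w = u" using LE[OF w(1)] by blast
      obtain u' where u': "Xc.valid oX u'" "Xc.normal_word u'" "w' = Xc.labels oX u'" "wd w' = u'" using LE[OF w(2)] by blast
      have "Xc.tgt oX u = Xc.tgt oX u'" using e rep[OF w(1)] rep[OF w(2)] u(4) u'(4) by simp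
      then have "Xc.wordeq u u'" using Xc.same_tgt_wordeq[OF u(1) u'(1)] by blast
      then show "w = w'" using Xc.normal_word_unique[OF u(2) u'(2)] u(3) u'(3) by simp
    qed
    show "endpoint K X \<sigma> oX ` L = vertex_set X"
    proof
      show "endpoint K X \<sigma> oX ` L \<subseteq> vertex_set X"
        using rep LE Xc.valid_tgt by fastforce
      show "vertex_set X \<subseteq> endpoint K X \<sigma> oX ` L"
      proof
        fix x assume "x \<in> vertex_set X"
        then obtain v where v: "Xc.valid oX v" "Xc.tgt oX v = x" using Xc.connected[OF oXv] by blast
        obtain u where u: "Xc.wordeq u v" "Xc.normal_word u" using Xc.normal_word_exists[OF Xc.valid_words[OF v(1)]] by blast
        have vu: "Xc.valid oX u" "Xc.tgt oX u = x"
          using Xc.reduced_valid_wordeq[OF v(1) Xc.wordeq_sym[OF u(1)] Xc.normal_word_reduced[OF u(2)]] v(2) by auto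
        have "Xc.labels oX u \<in> L" unfolding L_def using vu u(2) by blast
        moreover have "endpoint K X \<sigma> oX (Xc.labels oX u) = x" using rep[OF calculation] wd[OF vu(1)] vu(2) by simp
        ultimately show "x \<in> endpoint K X \<sigma> oX ` L" by blast
      qed
    qed
  qed
  have \<Psi>_ran: "\<Psi> ` verts (graph \<A>) \<subseteq> lists (SZ - incl ` SX)"
  proof (rule image_subsetI)
    fix v
    have "set (\<Psi> v) \<subseteq> SZ - range incl"
      unfolding \<Psi>_def SZ using fibre_word_set by (cases "snd (st v)") simp_all
    then show "\<Psi> v \<in> lists (SZ - incl ` SX)" by (auto simp: in_lists_conv_set)
  qed
  have \<Xi>_ran: "\<Xi> ` verts (graph \<A>) \<subseteq> quotient_vertices K X \<sigma>"
  proof (rule image_subsetI)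
    fix v assume "v \<in> verts (graph \<A>)"
    then obtain w where w: "w \<in> L" "fst (st v) = \<kappa> w" using A(6) by blast
    obtain u where u: "Xc.valid oX u" "wd w = u" using LE[OF w(1)] by blast
    have "\<Xi> v = orbit K \<sigma> (\<phi> (ztgt oZ u))"
      using orbit_image_eq[OF ztgt_v(1)[OF u(1)]] w(2) u(2) by (simp add: \<kappa>_def \<Xi>_def)
    then show "\<Xi> v \<in> quotient_vertices K X \<sigma>"
      unfolding quotient_vertices_def orbits_def using ztgt_v(1)[OF u(1)] by auto
  qed
  have path: "interleave \<A> \<Psi> incl p = Zc.labels oZ (lift_word oZ (wd w)) \<and>
      map (orbit K \<sigma>) (Xc.vs oX (wd w)) = map \<Xi> (pre_digraph.awalk_verts (graph \<A>) v p)"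
    if w: "w \<in> L" and vp: "(v, p) \<in> initial_paths \<A> w" for w v p
  proof -
    obtain u where u: "Xc.valid oX u" "w = Xc.labels oX u" "wd w = u" using LE[OF w] by blast
    have len: "length w = length u" using u(2) by simp
    have wi: "wd (take i w) = take i u" for i
      using wd[OF Xc.valid_take(1)[OF u(1)]] unfolding u(2) Xc.labels_take[symmetric] .
    have d: "map (\<lambda>e. (st (tail (graph \<A>) e), label \<A> e)) p
         = map (\<lambda>i. ((\<kappa> (take i w), Some (w ! i)), w ! i)) [0..<length u]"
       "map (fst \<circ> st) (pre_digraph.awalk_verts (graph \<A>) v p) = map (\<lambda>i. \<kappa> (take i w)) [0..<Suc (length u)]"
      using bspec[OF bspec[OF data w] vp] unfolding prod.case len by blast+
    define h where "h = (\<lambda>((k :: 'a set \<times> letter set, n), s). (case n of None \<Rightarrow> [] | Some t \<Rightarrow> fibre_word (fst k) t) @ [incl s])"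
    have "interleave \<A> \<Psi> incl p = concat (map h (map (\<lambda>e. (st (tail (graph \<A>) e), label \<A> e)) p))"
      unfolding interleave_def map_map by (rule arg_cong[where f = concat], rule map_cong)
        (simp_all add: h_def \<Psi>_def split_beta)
    also have "\<dots> = concat (map (\<lambda>i. fibre_word (orbit K \<rho> (ztgt oZ (take i u))) (w ! i) @ [incl (w ! i)]) [0..<length u])"
      unfolding d(1) map_map by (simp add: h_def comp_def \<kappa>_def wi)
    also have "\<dots> = concat (map (\<lambda>i. Zc.labels (ztgt oZ (take i u)) (fst (lift (ztgt oZ (take i u)) (u ! i)))
        @ [incl (Xc.labels oX u ! i)]) [0..<length u])"
    proof (rule arg_cong[where f = concat], rule map_cong[OF refl])
      fix i assume "i \<in> set [0..<length u]"
      then have i: "i < length u" by simp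
      have vi: "Xc.valid oX (take i u)" "Xc.valid (Xc.tgt oX (take i u)) [u ! i]"
        using Xc.valid_take[OF u(1)] i by auto
      have "fibre_label (orbit K \<rho> (ztgt oZ (take i u))) (w ! i) (ztgt oZ (take i u)) (u ! i)"
        unfolding fibre_label_def using ztgt_v[OF vi(1)] vi(2) Xc.labels_nth[OF i] u(2) by simp
      then show "fibre_word (orbit K \<rho> (ztgt oZ (take i u))) (w ! i) @ [incl (w ! i)] =
          Zc.labels (ztgt oZ (take i u)) (fst (lift (ztgt oZ (take i u)) (u ! i))) @ [incl (Xc.labels oX u ! i)]"
        using fibre_word_eq u(2) by simp
    qed
    also have "\<dots> = Zc.labels oZ (lift_word oZ u)" using labels_lift[OF o] u(1) oX by simp
    finally have 1: "interleave \<A> \<Psi> incl p = Zc.labels oZ (lift_word oZ (wd w))" using u(3) by simp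
    have "map \<Xi> (pre_digraph.awalk_verts (graph \<A>) v p)
        = map (orbit_image \<circ> fst) (map (fst \<circ> st) (pre_digraph.awalk_verts (graph \<A>) v p))"
      by (simp add: \<Xi>_def)
    also have "\<dots> = map (\<lambda>i. orbit_image (fst (\<kappa> (take i w)))) [0..<Suc (length u)]"
      unfolding d(2) map_map by (simp only: comp_def)
    also have "\<dots> = map (\<lambda>i. orbit K \<sigma> (Xc.tgt oX (take i u))) [0..<Suc (length u)]"
    proof (rule map_cong[OF refl])
      fix i
      have vi: "Xc.valid oX (take i u)" using Xc.valid_take[OF u(1)] by auto
      show "orbit_image (fst (\<kappa> (take i w))) = orbit K \<sigma> (Xc.tgt oX (take i u))"
        using orbit_image_eq[OF ztgt_v(1)[OF vi]] ztgt_v(2)[OF vi] by (simp add: \<kappa>_def wi)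
    qed
    also have "\<dots> = map (orbit K \<sigma>) (Xc.vs oX (wd w))" unfolding u(3) Xc.vs_take map_map by (simp only: comp_def)
    finally show ?thesis using 1 by simp
  qed
  have lifted_rep: "(\<exists>!\<gamma>. geodesic_representative K Z \<rho> oZ (Zc.labels oZ (lift_word oZ (wd w))) \<gamma>) \<and>
      \<phi> (endpoint K Z \<rho> oZ (Zc.labels oZ (lift_word oZ (wd w)))) = endpoint K X \<sigma> oX w" if w: "w \<in> L" for w
  proof -
    obtain u where u: "Xc.valid oX u" "Xc.reduced u" "wd w = u" using LE[OF w] by blast
    have vu: "Xc.valid (\<phi> oZ) u" using u(1) oX by simp
    have l: "Zc.valid oZ (lift_word oZ u)" "Zc.tgt oZ (lift_word oZ u) = ztgt oZ u" "\<phi> (ztgt oZ u) = Xc.tgt oX u"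
      using lift_path[OF o vu] oX by auto
    show ?thesis unfolding u(3) using Zc.unique_representative[OF l(1) lift_reduced[OF o vu u(2)]] l rep[OF w] u(3) by simp
  qed
  show ?thesis
  proof (intro exI[of _ L] exI[of _ \<A>] exI[of _ \<Psi>] exI[of _ \<Xi>] conjI)
    show "\<forall>w\<in>L. \<exists>!\<gamma>. geodesic_representative K X \<sigma> oX w \<gamma>" using rep by blast
    show "\<forall>w\<in>L. \<forall>(u, p)\<in>initial_paths \<A> w.
            (\<exists>!\<gamma>. geodesic_representative K Z \<rho> oZ (interleave \<A> \<Psi> incl p) \<gamma>) \<and>
            \<phi> (endpoint K Z \<rho> oZ (interleave \<A> \<Psi> incl p)) = endpoint K X \<sigma> oX w"
    proof (intro ballI, unfold split_beta)
      fix w q assume w: "w \<in> L" "q \<in> initial_paths \<A> w"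
      have "interleave \<A> \<Psi> incl (snd q) = Zc.labels oZ (lift_word oZ (wd w))"
        using path[OF w(1), of "fst q" "snd q"] w(2) by simp
      then show "(\<exists>!\<gamma>. geodesic_representative K Z \<rho> oZ (interleave \<A> \<Psi> incl (snd q)) \<gamma>) \<and>
            \<phi> (endpoint K Z \<rho> oZ (interleave \<A> \<Psi> incl (snd q))) = endpoint K X \<sigma> oX w"
        using lifted_rep[OF w(1)] by (simp only:)
    qed
    show "\<forall>w\<in>L. \<forall>(u, p)\<in>initial_paths \<A> w.
            map (orbit K \<sigma>) (the_geodesic K X \<sigma> oX w) = map \<Xi> (pre_digraph.awalk_verts (graph \<A>) u p)"
    proof (intro ballI, unfold split_beta)
      fix w q assume w: "w \<in> L" "q \<in> initial_paths \<A> w"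
      then show "map (orbit K \<sigma>) (the_geodesic K X \<sigma> oX w) = map \<Xi> (pre_digraph.awalk_verts (graph \<A>) (fst q) (snd q))"
        using path[OF w(1), of "fst q" "snd q"] rep[OF w(1)] by simp
    qed
  qed (use LS A bij \<Psi>_ran \<Xi>_ran in simp_all)
qed

end

theorem proposition5p9:
  fixes \<Gamma> :: "('g, 'm) monoid_scheme" and H :: "'g set"
    and Z :: "'a set set" and \<rho> :: "'g \<Rightarrow> 'a \<Rightarrow> 'a" and W :: "'a set set set"
    and X :: "'b set set" and \<sigma> :: "'g \<Rightarrow> 'b \<Rightarrow> 'b" and \<phi> :: "'a \<Rightarrow> 'b"
    and oZ :: 'a and oX :: 'b
  assumes "group \<Gamma>" and "\<not> virtually_cyclic \<Gamma>"
    and "cat0_cube_complex Z" and "cubical_action \<Gamma> Z \<rho>"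
    and "proper_action \<Gamma> Z \<rho>" and "cocompact_action \<Gamma> Z \<rho>" and "essential_action \<Gamma> Z \<rho>"
    and "W \<subseteq> hyperplanes Z" and "\<forall>g\<in>carrier \<Gamma>. \<forall>h\<in>W. (`) (\<rho> g) ` h \<in> W"
    and "restriction_quotient Z W X \<phi>" and "cubical_action \<Gamma> X \<sigma>"
    and "\<forall>g\<in>carrier \<Gamma>. \<forall>x\<in>vertex_set Z. \<phi> (\<rho> g x) = \<sigma> g (\<phi> x)"
    and "proper_action \<Gamma> X \<sigma>" and "cocompact_action \<Gamma> X \<sigma>" and "essential_action \<Gamma> X \<sigma>"
    and "subgroup H \<Gamma>" and "finite (rcosets\<^bsub>\<Gamma>\<^esub> H)"
    and K: "K = \<Gamma>\<lparr>carrier := H\<rparr>"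
    and "special_quotient K Z \<rho>" and "special_quotient K X \<sigma>"
    and "oZ \<in> vertex_set Z" and oX: "oX = \<phi> oZ"
    and SZ: "SZ = quotient_oriented_hyperplanes K Z \<rho>"
    and SX: "SX = quotient_oriented_hyperplanes K X \<sigma>"
    and incl: "\<iota> = hyperplane_inclusion K Z \<rho> X \<sigma> \<phi>"
  shows "\<exists>L \<A>. L \<subseteq> lists SX \<and>
      automaton_over SX (\<A> :: (nat, nat, ('b \<times> 'b) set set) automaton) \<and>
      pruned \<A> \<and> final \<A> = verts (graph \<A>) \<and> L = language \<A> \<and>
      (\<exists>C::nat. C \<ge> 1 \<and> (\<forall>w\<in>L. finite (initial_paths \<A> w) \<and> card (initial_paths \<A> w) \<le> C)) \<and>
      (\<forall>w\<in>L. \<exists>!\<gamma>. geodesic_representative K X \<sigma> oX w \<gamma>) \<and>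
      bij_betw (endpoint K X \<sigma> oX) L (vertex_set X) \<and>
      (\<exists>\<Psi> \<Xi>. \<Psi> ` verts (graph \<A>) \<subseteq> lists (SZ - \<iota> ` SX) \<and>
         \<Xi> ` verts (graph \<A>) \<subseteq> quotient_vertices K X \<sigma> \<and>
         (\<forall>w\<in>L. \<forall>(u, p)\<in>initial_paths \<A> w.
            (\<exists>!\<gamma>. geodesic_representative K Z \<rho> oZ (interleave \<A> \<Psi> \<iota> p) \<gamma>) \<and>
            \<phi> (endpoint K Z \<rho> oZ (interleave \<A> \<Psi> \<iota> p)) = endpoint K X \<sigma> oX w) \<and>
         (\<forall>w\<in>L. \<forall>(u, p)\<in>initial_paths \<A> w.
            map (orbit K \<sigma>) (the_geodesic K X \<sigma> oX w) =
            map \<Xi> (pre_digraph.awalk_verts (graph \<A>) u p)))"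
proof -
  have cubes: "cube_complex Z" "cube_complex X"
    using \<open>cat0_cube_complex Z\<close> \<open>restriction_quotient Z W X \<phi>\<close>
    unfolding restriction_quotient_def cat0_cube_complex_def npc_cube_complex_def by blast+
  have act: "cubical_action K Z \<rho>" "cubical_action K X \<sigma>"
    unfolding K using subgroup_cubical_action assms by blast+
  have coc: "cocompact_action K Z \<rho>" "cocompact_action K X \<sigma>"
    unfolding K using finite_index_cocompact assms by blast+
  have sub: "carrier K \<subseteq> carrier \<Gamma>" using subgroup.subset[OF \<open>subgroup H \<Gamma>\<close>] by (simp add: K)
  obtain VZ AZ \<psi>Z fZ where Z: "simple_graph VZ AZ" "\<psi>Z \<in> hom K (raag VZ AZ)"
    "fZ ` vertex_set Z \<subseteq> carrier (raag VZ AZ)" "inj_on fZ (vertex_set Z)"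
    "\<forall>g\<in>carrier K. \<forall>x\<in>vertex_set Z. fZ (\<rho> g x) = \<psi>Z g \<otimes>\<^bsub>raag VZ AZ\<^esub> fZ x"
    "convex_subcomplex ((`) fZ ` Z) (salvetti_cover VZ AZ)"
    using \<open>special_quotient K Z \<rho>\<close> unfolding special_quotient_def by metis
  obtain VX AX \<psi>X fX where X: "simple_graph VX AX" "\<psi>X \<in> hom K (raag VX AX)"
    "fX ` vertex_set X \<subseteq> carrier (raag VX AX)" "inj_on fX (vertex_set X)"
    "\<forall>g\<in>carrier K. \<forall>x\<in>vertex_set X. fX (\<sigma> g x) = \<psi>X g \<otimes>\<^bsub>raag VX AX\<^esub> fX x"
    "convex_subcomplex ((`) fX ` X) (salvetti_cover VX AX)"
    using \<open>special_quotient K X \<sigma>\<close> unfolding special_quotient_def by metis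
  interpret special_restriction VZ AZ Z fZ K \<rho> \<psi>Z VX AX X fX \<sigma> \<psi>X W \<phi>
  proof
    show "\<forall>g\<in>carrier K. \<forall>x\<in>vertex_set Z. \<phi> (\<rho> g x) = \<sigma> g (\<phi> x)"
      using assms(12) sub by blast
  qed (fact Z X act \<open>restriction_quotient Z W X \<phi>\<close>)+
  have "finite (orbit K \<rho> ` vertex_set Z)" "finite SX"
    unfolding SX using Zc.finite_quotient(1)[OF cubes(1) coc(1)] Xc.finite_quotient(2)[OF cubes(2) coc(2)] .
  from geodesic_automaton[OF this \<open>oZ \<in> vertex_set Z\<close> SX SZ oX] show ?thesis unfolding incl .
qed

end
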